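(* Let $n\ge d\ge 2$ be integers and let $\boldsymbol{\mu}$ be a $d$-part partition satisfying $d\le|\boldsymbol{\mu}|\le n$. The Zariski closure of $\mathcal{P}_{n,d}^{\boldsymbol{\mu}}$ in $\mathcal{CP}_{n,d}$ is $$\overline{\mathcal{P}}_{n,d}^{\boldsymbol{\mu}}=\bigcup_{\boldsymbol{\mu}'\le\boldsymbol{\mu}}\mathcal{P}_{n,d}^{\boldsymbol{\mu}'},$$ where the union is over all $d$-part partitions $\boldsymbol{\mu}'$ with $d\le|\boldsymbol{\mu}'|\le n$ and $\boldsymbol{\mu}'\le\boldsymbol{\mu}$.
   Context: $\mathsf{k}$ is an arbitrary infinite field, $R=\mathsf{k}[s,t]$ with the standard grading, and $R_n$ is the space of homogeneous polynomials of degree $n$. A $d$-part partition is a tuple of integers $\boldsymbol{\mu}=(\mu_1,\dots,\mu_d)$ with $1\le\mu_1\le\cdots\le\mu_d$; put $|\boldsymbol{\mu}|=\mu_1+\cdots+\mu_d$. For $d$-part partitions, $\boldsymbol{\mu}\le\boldsymbol{\mu}'$ means $\mu_1+\cdots+\mu_i\le\mu_1'+\cdots+\mu_i'$ for all $i=1,\dots,d$ (so $|\boldsymbol{\mu}|\le|\boldsymbol{\mu}'|$, equality not being required). For linearly independent $a_0,\dots,a_d\in R_n$ with $I=\langle a_0,\dots,a_d\rangle\subseteq R$, there is a graded exact sequence $0\to\bigoplus_{i=1}^d R(-n-\mu_i)\to R(-n)^{d+1}\xrightarrow{(a_0,\dots,a_d)} I\to 0$ with uniquely determined integers $1\le\mu_1\le\cdots\le\mu_d$;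 the tuple $\boldsymbol{\mu}=(\mu_1,\dots,\mu_d)$ is called the $\boldsymbol{\mu}$-type (or type) of $(a_0,\dots,a_d)$. One has $|\boldsymbol{\mu}|=n-\deg\gcd(a_0,\dots,a_d)$. $\mathcal{CP}_{n,d}\subseteq R_n^{d+1}$ is the set of all linearly independent $(a_0,\dots,a_d)$ (a common factor is allowed), with the Zariski topology induced from the affine space $R_n^{d+1}$, and for a $d$-part partition $\boldsymbol{\mu}$ with $|\boldsymbol{\mu}|\le n$, $\mathcal{P}_{n,d}^{\boldsymbol{\mu}}\subseteq\mathcal{CP}_{n,d}$ is the subset of those of type $\boldsymbol{\mu}$. *)

theory Defs
  imports
    "Jordan_Normal_Form.Matrix"
    "HOL-Analysis.Abstract_Topology"
    "HOL-Library.Poly_Mapping"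
    "HOL-Computational_Algebra.Polynomial"
begin

text \<open>
  \<open>R\<close> is the type \<open>'a poly poly\<close>, i.e. \<open>k[t][s]\<close>: \<^term>\<open>poly.coeff (poly.coeff p i) j\<close> is the
  coefficient of \<open>s\<^sup>i t\<^sup>j\<close> in \<open>p\<close>, and a constant \<open>c \<in> k\<close> is \<open>[:[:c:]:]\<close>.
  The grading is indexed by \<open>int\<close> so that twists need no truncation; \<open>forms m = {0}\<close> for \<open>m < 0\<close>.
\<close>

definition forms :: "int \<Rightarrow> 'a::zero poly poly set" where
  "forms m = {p. \<forall>i j. poly.coeff (poly.coeff p i) j \<noteq> 0 \<longrightarrow> int i + int j = m}"

text \<open>
  The degree \<open>m\<close> component of the graded free module \<open>R(q 0) \<oplus> \<dots> \<oplus> R(q (r - 1))\<close>, where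
  \<open>R(e)\<close> has degree \<open>m\<close> component \<open>forms (m + e)\<close>. The underlying module is \<open>carrier_vec r\<close>.
\<close>

definition free_component :: "nat \<Rightarrow> (nat \<Rightarrow> int) \<Rightarrow> int \<Rightarrow> 'a::zero poly poly vec set" where
  "free_component r q m = {v \<in> carrier_vec r. \<forall>i<r. v $ i \<in> forms (m + q i)}"

definition graded_hom ::
  "nat \<Rightarrow> (nat \<Rightarrow> int) \<Rightarrow> nat \<Rightarrow> (nat \<Rightarrow> int)
    \<Rightarrow> ('a::field poly poly vec \<Rightarrow> 'a poly poly vec) \<Rightarrow> bool" where
  "graded_hom r q r' q' \<phi> \<longleftrightarrow>
     \<phi> \<in> carrier_vec r \<rightarrow> carrier_vec r' \<and>
     (\<forall>v\<in>carrier_vec r. \<forall>w\<in>carrier_vec r. \<phi> (v + w) = \<phi> v + \<phi> w) \<and>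
     (\<forall>c. \<forall>v\<in>carrier_vec r. \<phi> (c \<cdot>\<^sub>v v) = c \<cdot>\<^sub>v \<phi> v) \<and>
     (\<forall>m. \<phi> ` free_component r q m \<subseteq> free_component r' q' m)"

definition is_partition :: "nat \<Rightarrow> nat list \<Rightarrow> bool" where
  "is_partition d mu \<longleftrightarrow> length mu = d \<and> sorted mu \<and> (\<forall>m\<in>set mu. 1 \<le> m)"

text \<open>The order \<open>mu' \<le> mu\<close> on \<open>d\<close>-part partitions; the total sums may differ.\<close>

definition partition_le :: "nat \<Rightarrow> nat list \<Rightarrow> nat list \<Rightarrow> bool" where
  "partition_le d mu' mu \<longleftrightarrow> (\<forall>i\<in>{1..d}. sum_list (take i mu') \<le> sum_list (take i mu))"

text \<open>The affine space \<open>R\<^sub>n\<^sup>d\<^sup>+\<^sup>1\<close>; a tuple \<open>(a\<^sub>0, \<dots>, a\<^sub>d)\<close> is a vector of dimension \<open>d + 1\<close>.\<close>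

definition tuples :: "nat \<Rightarrow> nat \<Rightarrow> 'a::zero poly poly vec set" where
  "tuples n d = {a \<in> carrier_vec (d + 1). \<forall>j\<le>d. a $ j \<in> forms (int n)}"

definition CP :: "nat \<Rightarrow> nat \<Rightarrow> 'a::field poly poly vec set" where
  "CP n d = {a \<in> tuples n d.
     \<forall>c. (\<Sum>j\<le>d. [:[:c j:]:] * a $ j) = 0 \<longrightarrow> (\<forall>j\<le>d. c j = 0)}"

text \<open>
  Exactness of \<open>0 \<rightarrow> \<Oplus>\<^sub>i R(-n-\<mu>\<^sub>i) \<rightarrow> R(-n)\<^sup>d\<^sup>+\<^sup>1 \<rightarrow> I \<rightarrow> 0\<close> for some graded homomorphism \<open>\<phi>\<close>,
  with second map \<open>v \<mapsto> \<Sum>\<^sub>j v\<^sub>j a\<^sub>j\<close> and \<open>I\<close> the ideal generated by the entries of \<open>a\<close>.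
  A predicate instead of a function \<open>a \<mapsto> mu\<close>, so uniqueness of \<open>mu\<close> is not built in.
\<close>

definition has_mu_type :: "nat \<Rightarrow> nat \<Rightarrow> nat list \<Rightarrow> 'a::field poly poly vec \<Rightarrow> bool" where
  "has_mu_type n d mu a \<longleftrightarrow> is_partition d mu \<and>
     (\<exists>\<phi>. graded_hom d (\<lambda>i. - int n - int (mu ! i)) (d + 1) (\<lambda>j. - int n) \<phi> \<and>
          inj_on \<phi> (carrier_vec d) \<and>
          \<phi> ` carrier_vec d = {v \<in> carrier_vec (d + 1). v \<bullet> a = 0} \<and>
          (\<lambda>v. v \<bullet> a) ` carrier_vec (d + 1) = module.span (*) (set\<^sub>v a))"

definition P_type :: "nat \<Rightarrow> nat \<Rightarrow> nat list \<Rightarrow> 'a::field poly poly vec set" where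
  "P_type n d mu = {a \<in> CP n d. has_mu_type n d mu a}"

text \<open>
  Polynomials in variables \<open>'v\<close> over \<open>'a\<close> are elements of the monoid algebra
  \<open>('v \<Rightarrow>\<^sub>0 nat) \<Rightarrow>\<^sub>0 'a\<close>; the inner mapping is the exponent vector of a monomial.
\<close>

type_synonym ('v, 'a) mpolynomial = "('v \<Rightarrow>\<^sub>0 nat) \<Rightarrow>\<^sub>0 'a"

definition monom_eval :: "('v \<Rightarrow> 'a::comm_semiring_1) \<Rightarrow> ('v \<Rightarrow>\<^sub>0 nat) \<Rightarrow> 'a" where
  "monom_eval x m = (\<Prod>v\<in>Poly_Mapping.keys m. x v ^ Poly_Mapping.lookup m v)"

definition mpoly_eval :: "('v \<Rightarrow> 'a::comm_semiring_1) \<Rightarrow> ('v, 'a) mpolynomial \<Rightarrow> 'a" where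
  "mpoly_eval x f =
     (\<Sum>m\<in>Poly_Mapping.keys f. Poly_Mapping.lookup f m * monom_eval x m)"

text \<open>
  The variable \<open>(j, i)\<close> with \<open>j \<le> d\<close> and \<open>i \<le> n\<close> stands for the coefficient of \<open>s\<^sup>i t\<^sup>n\<^sup>-\<^sup>i\<close>
  in \<open>a\<^sub>j\<close>.
\<close>

definition coords :: "nat \<Rightarrow> 'a::zero poly poly vec \<Rightarrow> nat \<times> nat \<Rightarrow> 'a" where
  "coords n a = (\<lambda>(j, i). poly.coeff (poly.coeff (a $ j) i) (n - i))"

definition coord_polys :: "nat \<Rightarrow> nat \<Rightarrow> (nat \<times> nat, 'a::zero) mpolynomial set" where
  "coord_polys n d = {f. \<forall>m\<in>Poly_Mapping.keys f. Poly_Mapping.keys m \<subseteq> {..d} \<times> {..n}}"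

definition zero_locus ::
  "nat \<Rightarrow> nat \<Rightarrow> (nat \<times> nat, 'a::field) mpolynomial set \<Rightarrow> 'a poly poly vec set" where
  "zero_locus n d F = {a \<in> tuples n d. \<forall>f\<in>F. mpoly_eval (coords n a) f = 0}"

definition zariski :: "nat \<Rightarrow> nat \<Rightarrow> 'a::field poly poly vec topology" where
  "zariski n d = topology (\<lambda>U. \<exists>F\<subseteq>coord_polys n d. U = tuples n d - zero_locus n d F)"

lemma monom_eval_superset:
  assumes "finite S" "Poly_Mapping.keys m \<subseteq> S"
  shows "monom_eval x m = (\<Prod>v\<in>S. x v ^ Poly_Mapping.lookup m v)"
  unfolding monom_eval_def
  by (rule prod.mono_neutral_left) (use assms in \<open>auto simp: in_keys_iff\<close>)

lemma monom_eval_add: "monom_eval x (m + m') = monom_eval x m * monom_eval x m'"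
proof -
  let ?S = "Poly_Mapping.keys m \<union> Poly_Mapping.keys m'"
  have "Poly_Mapping.keys (m + m') \<subseteq> ?S" by (rule keys_add)
  then show ?thesis
    by (simp add: monom_eval_superset[of ?S] lookup_add power_add prod.distrib)
qed

lemma mpoly_eval_superset:
  assumes "finite S" "Poly_Mapping.keys f \<subseteq> S"
  shows "mpoly_eval x f = (\<Sum>m\<in>S. Poly_Mapping.lookup f m * monom_eval x m)"
  unfolding mpoly_eval_def
  by (rule sum.mono_neutral_left) (use assms in \<open>auto simp: in_keys_iff\<close>)

lemma mpoly_eval_0 [simp]: "mpoly_eval x 0 = 0"
  by (simp add: mpoly_eval_def)

lemma mpoly_eval_1 [simp]: "mpoly_eval x 1 = 1"
  by (simp add: mpoly_eval_def monom_eval_def)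

lemma mpoly_eval_add: "mpoly_eval x (f + g) = mpoly_eval x f + mpoly_eval x g"
proof -
  let ?S = "Poly_Mapping.keys f \<union> Poly_Mapping.keys g"
  have "Poly_Mapping.keys (f + g) \<subseteq> ?S" by (rule keys_add)
  then show ?thesis
    by (simp add: mpoly_eval_superset[of ?S] lookup_add distrib_right sum.distrib)
qed

lemma mpoly_eval_sum: "mpoly_eval x (sum h A) = (\<Sum>i\<in>A. mpoly_eval x (h i))"
  by (induction A rule: infinite_finite_induct) (auto simp: mpoly_eval_add)

lemma mpoly_eval_single: "mpoly_eval x (Poly_Mapping.single m c) = c * monom_eval x m"
  by (simp add: mpoly_eval_def)

lemma sum_singles:
  "f = (\<Sum>m\<in>Poly_Mapping.keys f. Poly_Mapping.single m (Poly_Mapping.lookup f m))"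
  by (rule poly_mapping_eqI) (auto simp: lookup_sum lookup_single when_def in_keys_iff)

lemma mpoly_eval_mult: "mpoly_eval x (f * g) = mpoly_eval x f * mpoly_eval x g"
proof -
  have "f * g = (\<Sum>m\<in>Poly_Mapping.keys f. \<Sum>m'\<in>Poly_Mapping.keys g.
      Poly_Mapping.single (m + m') (Poly_Mapping.lookup f m * Poly_Mapping.lookup g m'))"
    by (subst sum_singles[of f], subst sum_singles[of g])
      (simp add: sum_product mult_single)
  then show ?thesis
    by (simp add: mpoly_eval_sum mpoly_eval_single monom_eval_add)
      (simp add: mpoly_eval_def sum_product algebra_simps)
qed

lemma coord_polys_mult:
  assumes "f \<in> coord_polys n d" "g \<in> coord_polys n d"
  shows "f * g \<in> coord_polys n d"
  unfolding coord_polys_def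
proof (intro CollectI ballI)
  fix m assume "m \<in> Poly_Mapping.keys (f * g)"
  then obtain m1 m2 where "m = m1 + m2" "m1 \<in> Poly_Mapping.keys f" "m2 \<in> Poly_Mapping.keys g"
    using keys_mult[of f g] by auto
  then show "Poly_Mapping.keys m \<subseteq> {..d} \<times> {..n}"
    using assms keys_add[of m1 m2] unfolding coord_polys_def by blast
qed

lemma istopology_zariski:
  "istopology (\<lambda>U :: 'a::field poly poly vec set.
     \<exists>F\<subseteq>coord_polys n d. U = tuples n d - zero_locus n d F)"
  (is "istopology ?L")
  unfolding istopology_def
proof (intro conjI allI impI)
  fix S T :: "'a poly poly vec set" assume "?L S" "?L T"
  then obtain F G where FG: "F \<subseteq> coord_polys n d" "G \<subseteq> coord_polys n d"
    and S: "S = tuples n d - zero_locus n d F" and T: "T = tuples n d - zero_locus n d G"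
    by blast
  let ?H = "(\<lambda>(f, g). f * g) ` (F \<times> G)"
  have "?H \<subseteq> coord_polys n d" using FG by (auto intro: coord_polys_mult)
  moreover have "S \<inter> T = tuples n d - zero_locus n d ?H"
    unfolding S T zero_locus_def by (auto simp: mpoly_eval_mult)
  ultimately show "?L (S \<inter> T)" by blast
next
  fix \<K> :: "'a poly poly vec set set" assume "\<forall>K\<in>\<K>. ?L K"
  then obtain F where F: "\<And>K. K \<in> \<K> \<Longrightarrow> F K \<subseteq> coord_polys n d"
    "\<And>K. K \<in> \<K> \<Longrightarrow> K = tuples n d - zero_locus n d (F K)" by metis
  have "x \<in> \<Union>\<K> \<longleftrightarrow> x \<in> tuples n d - zero_locus n d (\<Union>(F ` \<K>))" for x
  proof -
    have "x \<in> \<Union>\<K> \<longleftrightarrow> (\<exists>K\<in>\<K>. x \<in> tuples n d - zero_locus n d (F K))"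
      using F(2) by blast
    then show ?thesis by (auto simp: zero_locus_def)
  qed
  then have "\<Union>\<K> = tuples n d - zero_locus n d (\<Union>(F ` \<K>))" by blast
  then show "?L (\<Union>\<K>)" using F(1) by (intro exI[of _ "\<Union>(F ` \<K>)"]) blast
qed

lemma openin_zariski:
  "openin (zariski n d) U \<longleftrightarrow> (\<exists>F\<subseteq>coord_polys n d. U = tuples n d - zero_locus n d F)"
  unfolding zariski_def by (simp add: topology_inverse' istopology_zariski)

lemma topspace_zariski [simp]: "topspace (zariski n d) = tuples n d"
proof -
  have "1 \<in> coord_polys n d" by (simp add: coord_polys_def)
  then have "openin (zariski n d) (tuples n d)"
    unfolding openin_zariski by (intro exI[of _ "{1}"]) (auto simp: zero_locus_def)
  moreover have "topspace (zariski n d) \<subseteq> tuples n d"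
    unfolding topspace_def openin_zariski by blast
  ultimately show ?thesis using openin_subset by blast
qed

lemma closedin_zariski:
  "closedin (zariski n d) C \<longleftrightarrow> (\<exists>F\<subseteq>coord_polys n d. C = zero_locus n d F)"
proof -
  have "zero_locus n d F \<subseteq> tuples n d" for F by (auto simp: zero_locus_def)
  then show ?thesis
    unfolding closedin_def openin_zariski topspace_zariski by (metis Diff_subset double_diff order_refl)
qed

end

theory Submission
  imports Defs "Jordan_Normal_Form.Determinant" "HOL-Library.Function_Algebras"
begin

text \<open>
  The syzygies of \<open>a\<close> in degree \<open>m\<close> have dimension \<open>H mu m\<close>, the sum of the \<open>m + 1 - mu\<^sub>i\<close>
  (truncated at zero), if \<open>a\<close> has type \<open>mu\<close>. Partial sums of a partition and the function \<open>H mu\<close>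
  determine each other by a Legendre transform, under which \<open>mu' \<le> mu\<close> corresponds to
  \<open>H mu' \<ge> H mu\<close>. Since this dimension is upper semicontinuous, the closure is contained in the union.

  Conversely, a tuple of type \<open>mu'\<close> is \<open>g\<close> times the maximal minors of a matrix with row degrees
  \<open>mu'\<close>. Such tuples form the image \<open>Z\<close> of an affine space, so by semicontinuity a single tuple
  of type \<open>mu\<close> makes the generic element of \<open>Z\<close> on every line through it have type \<open>mu\<close>.
  It remains to pass from \<open>mu'\<close> to \<open>mu\<close> by elementary steps. Raising the last part moves a linear
  factor of \<open>g\<close> into the matrix; forms \<open>g\<close> with such a factor are dense. Replacing parts \<open>e\<close>,
  \<open>f\<close> with \<open>e + 2 \<le> f\<close> by \<open>e + 1\<close>, \<open>f - 1\<close> uses the family with rows \<open>s p + \<tau> u\<close> and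
  \<open>t\<^sup>k p + \<tau> w\<close>, whose minors divided by \<open>\<tau>\<close> specialise at \<open>\<tau> = 0\<close> to those with rows \<open>p\<close> and
  \<open>s w - t\<^sup>k u\<close>.
\<close>

section \<open>Forms\<close>

text \<open>Over an infinite field that need not be algebraically closed, a form need not have
  linear factors. The density statements are therefore proved on curves: a coordinate polynomial
  pulled back to one parameter and vanishing at infinitely many values vanishes everywhere
  (\<open>vcl_curve\<close>). This is why the parametrised sets \<open>Z\<close> stand in for the
  sets of tuples of a given type, for which no parametrisation is given. The parametrisation rests
  on a graded basis of the syzygies, obtained from saturation with respect to s, and, for
  Hilbert--Burch, on a double orthogonal of rank one that replaces division by a gcd. Semicontinuity
  controls one degree m at a time, and a curve may meet only finitely many exceptional points, so it
  matters that a type with sum at most n is determined by \<open>H\<close> in degrees up to n. The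
  elementary steps need not preserve sortedness, hence \<open>Z\<close> accepts arbitrary degree
  sequences and only the target of a chain of steps is sorted.\<close>

abbreviation cc :: "'a::zero poly poly \<Rightarrow> nat \<Rightarrow> nat \<Rightarrow> 'a" where
  "cc p i j \<equiv> poly.coeff (poly.coeff p i) j"

lemma cc_eqI: "(\<And>i j. cc p i j = cc q i j) \<Longrightarrow> p = q"
  by (simp add: poly_eq_iff)

lemma cc_mult:
  "cc (p * q) i j = (\<Sum>i'\<le>i. \<Sum>j'\<le>j. cc p i' j' * cc q (i - i') (j - j'))"
  for p q :: "'a::comm_semiring_1 poly poly"
  by (simp add: coeff_mult coeff_sum)

lemma formsI: "(\<And>i j. cc p i j \<noteq> 0 \<Longrightarrow> int i + int j = m) \<Longrightarrow> p \<in> forms m"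
  by (simp add: forms_def)

lemma formsD: "p \<in> forms m \<Longrightarrow> int i + int j \<noteq> m \<Longrightarrow> cc p i j = 0"
  by (auto simp: forms_def)

lemma forms_0 [simp]: "0 \<in> forms m"
  by (simp add: forms_def)

lemma forms_add: "p \<in> forms m \<Longrightarrow> q \<in> forms m \<Longrightarrow> p + q \<in> forms m"
  for p q :: "'a::comm_monoid_add poly poly"
proof (rule formsI)
  fix i j assume "p \<in> forms m" "q \<in> forms m" "cc (p + q) i j \<noteq> 0"
  moreover from this have "cc p i j \<noteq> 0 \<or> cc q i j \<noteq> 0" by auto
  ultimately show "int i + int j = m" by (auto simp: forms_def)
qed

lemma forms_minus: "p \<in> forms m \<Longrightarrow> - p \<in> forms m" for p :: "'a::ab_group_add poly poly"
  by (auto simp: forms_def)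

lemma forms_diff: "p \<in> forms m \<Longrightarrow> q \<in> forms m \<Longrightarrow> p - q \<in> forms m"
  for p :: "'a::ab_group_add poly poly"
  using forms_add[of p m "- q"] forms_minus[of q m] by simp

lemma forms_sum:
  fixes f :: "'b \<Rightarrow> 'a::comm_monoid_add poly poly"
  shows "(\<And>x. x \<in> A \<Longrightarrow> f x \<in> forms m) \<Longrightarrow> sum f A \<in> forms m"
  by (induction A rule: infinite_finite_induct) (auto intro: forms_add)

lemma forms_mult:
  fixes p q :: "'a::comm_semiring_1 poly poly"
  assumes "p \<in> forms a" "q \<in> forms b"
  shows "p * q \<in> forms (a + b)"
proof (rule formsI, rule ccontr)
  fix i j assume nz: "cc (p * q) i j \<noteq> 0" and ne: "int i + int j \<noteq> a + b"
  have "cc p i' j' * cc q (i - i') (j - j') = 0" if "i' \<le> i" "j' \<le> j" for i' j'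
  proof (cases "int i' + int j' = a")
    case True
    then have "int (i - i') + int (j - j') \<noteq> b" using that ne by auto
    then show ?thesis using formsD[OF assms(2)] by simp
  next
    case False then show ?thesis using formsD[OF assms(1)] by simp
  qed
  then show False using nz unfolding cc_mult by simp
qed

lemma forms_1: "(1 :: 'a::comm_semiring_1 poly poly) \<in> forms 0"
  by (auto simp: forms_def split: if_splits nat.splits simp: coeff_pCons one_pCons)

lemma forms_prod:
  fixes f :: "'b \<Rightarrow> 'a::comm_semiring_1 poly poly"
  assumes "\<And>x. x \<in> A \<Longrightarrow> f x \<in> forms (e x)"
  shows "prod f A \<in> forms (sum e A)"
  using assms by (induction A rule: infinite_finite_induct) (auto intro: forms_mult forms_1)

lemma forms_neg: "m < 0 \<Longrightarrow> p \<in> forms m \<Longrightarrow> p = 0"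
  by (rule cc_eqI) (simp add: formsD)

lemma forms_monom: "monom (monom c j) i \<in> forms (int i + int j)"
  by (auto simp: forms_def split: if_splits)

lemma forms_const: "[:[:c:]:] \<in> forms 0"
  using forms_monom[of c 0 0] by (simp add: monom_0)

lemma forms_smult: "p \<in> forms m \<Longrightarrow> smult [:c:] p \<in> forms m"
  for p :: "'a::comm_semiring_1 poly poly"
  using forms_mult[OF forms_const[of c], of p m] by simp

lemma forms_eqI:
  assumes "p \<in> forms (int e)" "q \<in> forms (int e)" "\<And>i. i \<le> e \<Longrightarrow> cc p i (e - i) = cc q i (e - i)"
  shows "p = q"
proof (rule cc_eqI)
  fix i j show "cc p i j = cc q i j"
  proof (cases "i + j = e")
    case True then show ?thesis using assms(3)[of i] by auto
  next
    case False
    then show ?thesis using formsD[OF assms(1), of i j] formsD[OF assms(2), of i j]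
      by (metis of_nat_add of_nat_eq_iff)
  qed
qed

lemma forms_expand:
  fixes p :: "'a::comm_monoid_add poly poly"
  assumes "p \<in> forms (int e)"
  shows "p = (\<Sum>i\<le>e. monom (monom (cc p i (e - i)) (e - i)) i)"
  using assms
proof (rule forms_eqI)
  show "(\<Sum>i\<le>e. monom (monom (cc p i (e - i)) (e - i)) i) \<in> forms (int e)"
  proof (rule forms_sum)
    fix i assume "i \<in> {..e}"
    then show "monom (monom (cc p i (e - i)) (e - i)) i \<in> forms (int e)"
      using forms_monom[of "cc p i (e - i)" "e - i" i] by (simp add: of_nat_diff)
  qed
  show "cc p i (e - i) = cc (\<Sum>i\<le>e. monom (monom (cc p i (e - i)) (e - i)) i) i (e - i)"
    if "i \<le> e" for i
    using that by (simp add: coeff_sum if_distrib[of "\<lambda>p. poly.coeff p _"] sum.delta cong: if_cong)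
qed

text \<open>The degree is an \<open>int\<close> because shifted degrees \<open>m - e\<close> occur;
  negative degrees give zero, in agreement with \<open>forms\<close>. The usable description is
  \<open>cc_hom_part\<close>.\<close>

definition hom_part :: "int \<Rightarrow> 'a::comm_ring_1 poly poly \<Rightarrow> 'a poly poly" where
  "hom_part m p = (\<Sum>i\<le>degree p. if int i \<le> m
      then monom (monom (cc p i (nat (m - int i))) (nat (m - int i))) i else 0)"

lemma cc_hom_part: "cc (hom_part m p) i j = (if int i + int j = m then cc p i j else 0)"
proof -
  have "cc (hom_part m p) i j = (\<Sum>i'\<le>degree p. if i' = i then
      (if int i + int j = m then cc p i j else 0) else 0)"
    unfolding hom_part_def coeff_sum
    by (rule sum.cong) (auto split: if_splits)
  also have "\<dots> = (if int i + int j = m then cc p i j else 0)"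
    by (auto simp: coeff_eq_0)
  finally show ?thesis .
qed

lemma hom_part_in_forms: "hom_part m p \<in> forms m"
  by (rule formsI) (auto simp: cc_hom_part split: if_splits)

lemma hom_part_add: "hom_part m (p + q) = hom_part m p + hom_part m q"
  by (rule cc_eqI) (simp add: cc_hom_part)

lemma hom_part_0 [simp]: "hom_part m 0 = 0"
  by (rule cc_eqI) (simp add: cc_hom_part)

lemma hom_part_sum: "hom_part m (sum f A) = (\<Sum>x\<in>A. hom_part m (f x))"
  by (induction A rule: infinite_finite_induct) (auto simp: hom_part_add)

lemma hom_part_forms: "p \<in> forms m' \<Longrightarrow> hom_part m p = (if m = m' then p else 0)"
  by (rule cc_eqI) (auto simp: cc_hom_part formsD)

text \<open>Multiplication by a form shifts the grading. This is what allows the coefficients of a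
  relation to be replaced by homogeneous ones.\<close>

lemma hom_part_mult: 
  assumes "f \<in> forms e"
  shows "hom_part m (f * p) = f * hom_part (m - e) p"
proof (rule cc_eqI)
  fix i j
  have *: "(if int i + int j = m then cc f i' j' * cc p (i - i') (j - j') else 0)
     = cc f i' j' * cc (hom_part (m - e) p) (i - i') (j - j')" if "i' \<le> i" "j' \<le> j" for i' j'
  proof (cases "int i' + int j' = e")
    case True
    then show ?thesis using that by (auto simp: cc_hom_part of_nat_diff)
  next
    case False then show ?thesis using formsD[OF assms] by simp
  qed
  have "cc (hom_part m (f * p)) i j =
      (\<Sum>i'\<le>i. \<Sum>j'\<le>j. if int i + int j = m then cc f i' j' * cc p (i - i') (j - j') else 0)"
    by (simp add: cc_hom_part cc_mult)
  also have "\<dots> = cc (f * hom_part (m - e) p) i j"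
    unfolding cc_mult by (intro sum.cong refl *) auto
  finally show "cc (hom_part m (f * p)) i j = cc (f * hom_part (m - e) p) i j" .
qed

text \<open>The bound holds for every larger \<open>N'\<close> too, so that the finitely many
  entries of a vector can share one bound.\<close>

lemma hom_part_decomp: "\<exists>N. \<forall>N'\<ge>N. p = (\<Sum>m<N'. hom_part (int m) p)"
proof -
  define D where "D = Max ((\<lambda>i. degree (poly.coeff p i)) ` {..degree p})"
  have D: "cc p i j = 0" if "i + j > degree p + D" for i j
  proof (cases "i \<le> degree p")
    case True
    then have "degree (poly.coeff p i) \<le> D" unfolding D_def by (intro Max_ge) auto
    then show ?thesis using that True by (intro coeff_eq_0) auto
  qed (simp add: coeff_eq_0)
  have "p = (\<Sum>m<N. hom_part (int m) p)" if "N \<ge> degree p + D + 1" for N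
  proof (rule cc_eqI)
    fix i j
    have "cc (\<Sum>m<N. hom_part (int m) p) i j = (\<Sum>m<N. if m = i + j then cc p i j else 0)"
      unfolding coeff_sum by (rule sum.cong) (auto simp: cc_hom_part)
    also have "\<dots> = cc p i j" using D[of i j] that by auto
    finally show "cc p i j = cc (\<Sum>m<N. hom_part (int m) p) i j" by simp
  qed
  then show ?thesis by blast
qed

text \<open>Taking parts of degree \<open>m\<close> turns \<open>f * p\<close> into
  \<open>f * hom_part (m - e) p\<close>, and \<open>f\<close> cancels in a domain.\<close>

lemma forms_factor:
  fixes f p :: "'a::idom poly poly"
  assumes f: "f \<in> forms e" "f \<noteq> 0" and fp: "f * p \<in> forms m"
  shows "p \<in> forms (m - e)"
proof -
  have "f * p = f * hom_part (m - e) p"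
    using hom_part_mult[OF f(1), of m p] hom_part_forms[OF fp, of m] by simp
  then have "p = hom_part (m - e) p" using f(2) by simp
  then show ?thesis using hom_part_in_forms by metis
qed

lemma forms_deg_0:
  assumes "p \<in> forms 0" shows "\<exists>c. p = [:[:c:]:]"
proof
  show "p = [:[:cc p 0 0:]:]"
  proof (rule cc_eqI)
    fix i j show "cc p i j = cc [:[:cc p 0 0:]:] i j"
      using formsD[OF assms, of i j] by (cases i; cases j) auto
  qed
qed

text \<open>The variable s. It is the outer variable, so t is \<open>[:monom 1 1:]\<close> and
  \<open>poly.coeff p 0\<close> is the reduction of \<open>p\<close> modulo s.\<close>

abbreviation (input) S :: "'a::comm_semiring_1 poly poly" where "S \<equiv> [:0, 1:]"

lemma S_forms: "S \<in> forms 1"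
  by (auto simp: forms_def coeff_pCons one_pCons split: nat.splits if_splits)

text \<open>Modulo s a form becomes a scalar times a power of t, so reductions of forms can be
  compared by linear algebra over k.\<close>

lemma coeff_0_forms:
  assumes "p \<in> forms (int m)"
  shows "poly.coeff p 0 = monom (cc p 0 m) m"
  by (rule poly_eqI) (use formsD[OF assms, of 0] in auto)

section \<open>Determinants\<close>

text \<open>With matrices as functions, replacing a row is a function update; minors and
  degenerations are built this way.\<close>

definition Det :: "nat \<Rightarrow> (nat \<Rightarrow> nat \<Rightarrow> 'a::comm_ring_1) \<Rightarrow> 'a" where
  "Det N A = det (mat N N (\<lambda>(i, j). A i j))"

lemma Det_Leibniz:
  "Det N A = (\<Sum>p\<in>{p. p permutes {0..<N}}. signof p * (\<Prod>i=0..<N. A i (p i)))"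
proof -
  have "(\<Prod>i=0..<N. mat N N (\<lambda>(i, j). A i j) $$ (i, p i)) = (\<Prod>i=0..<N. A i (p i))"
    if "p permutes {0..<N}" for p
    using permutes_in_image[OF that] by (intro prod.cong) auto
  then show ?thesis unfolding Det_def by (subst det_def'[of _ N]) auto
qed

lemma Det_cong: "(\<And>i j. i < N \<Longrightarrow> j < N \<Longrightarrow> A i j = B i j) \<Longrightarrow> Det N A = Det N B"
  unfolding Det_def by (rule arg_cong[of _ _ det]) auto

lemma prod_row:
  fixes A :: "nat \<Rightarrow> nat \<Rightarrow> 'a::comm_ring_1"
  assumes "k < N"
  shows "(\<Prod>i=0..<N. (A(k := x)) i (p i)) = x (p k) * (\<Prod>i\<in>{0..<N} - {k}. A i (p i))"
proof -
  have "(\<Prod>i=0..<N. (A(k := x)) i (p i)) = (A(k := x)) k (p k) * (\<Prod>i\<in>{0..<N} - {k}. (A(k := x)) i (p i))"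
    using assms by (intro prod.remove) auto
  also have "(\<Prod>i\<in>{0..<N} - {k}. (A(k := x)) i (p i)) = (\<Prod>i\<in>{0..<N} - {k}. A i (p i))"
    by (rule prod.cong) auto
  finally show ?thesis by simp
qed

lemma Det_row_add:
  "k < N \<Longrightarrow> Det N (A(k := (\<lambda>j. x j + y j))) = Det N (A(k := x)) + Det N (A(k := y))"
  unfolding Det_Leibniz
  by (simp add: prod_row sum.distrib[symmetric] algebra_simps del: fun_upd_apply)

lemma Det_row_smult:
  "k < N \<Longrightarrow> Det N (A(k := (\<lambda>j. c * x j))) = c * Det N (A(k := x))"
  unfolding Det_Leibniz
  by (simp add: prod_row sum_distrib_left algebra_simps del: fun_upd_apply)

lemma Det_row_0: "k < N \<Longrightarrow> Det N (A(k := (\<lambda>j. 0))) = 0"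
  using Det_row_smult[of k N A 0 "\<lambda>j. 0"] by simp

lemma Det_row_sum:
  "k < N \<Longrightarrow> Det N (A(k := (\<lambda>j. \<Sum>l\<in>L. x l j))) = (\<Sum>l\<in>L. Det N (A(k := x l)))"
  by (induction L rule: infinite_finite_induct) (auto simp: Det_row_add Det_row_0)

lemma Det_same:
  assumes "i < N" "j < N" "i \<noteq> j" "\<And>l. l < N \<Longrightarrow> A i l = A j l"
  shows "Det N A = 0"
  unfolding Det_def using assms by (intro det_identical_rows[of _ N i j]) auto

text \<open>Polarisation: expand the vanishing determinant that has \<open>x + y\<close> in both
  rows.\<close>

lemma Det_swap:
  assumes ij: "i < N" "j < N" "i \<noteq> j"
  shows "Det N (A(i := x, j := y)) = - Det N (A(i := y, j := x))"
proof -
  have D: "Det N (A(i := z, j := z)) = 0" for z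
    using ij by (intro Det_same[of i N j]) auto
  let ?xy = "\<lambda>l. x l + y l"
  have "Det N (A(i := ?xy, j := ?xy)) = Det N (A(i := ?xy, j := x)) + Det N (A(i := ?xy, j := y))"
    by (rule Det_row_add[OF ij(2)])
  moreover have "Det N (A(i := ?xy, j := z)) = Det N (A(i := x, j := z)) + Det N (A(i := y, j := z))" for z
    using Det_row_add[OF ij(1), of "A(j := z)" x y] ij(3) by (simp add: fun_upd_twist)
  ultimately have "Det N (A(i := x, j := y)) + Det N (A(i := y, j := x)) = 0"
    by (simp only: D add_0_left add_0_right add.commute)
  then show ?thesis by (simp only: eq_neg_iff_add_eq_0)
qed

lemma Det_0_iff:
  fixes A :: "nat \<Rightarrow> nat \<Rightarrow> 'a::idom"
  shows "Det N A = 0 \<longleftrightarrow> (\<exists>x. (\<exists>j<N. x j \<noteq> 0) \<and> (\<forall>i<N. (\<Sum>j<N. A i j * x j) = 0))" (is "?l = ?r")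
proof -
  let ?A = "mat N N (\<lambda>(i, j). A i j)"
  have "?l \<longleftrightarrow> (\<exists>v. v \<in> carrier_vec N \<and> v \<noteq> 0\<^sub>v N \<and> ?A *\<^sub>v v = 0\<^sub>v N)"
    unfolding Det_def by (rule det_0_iff_vec_prod_zero) auto
  also have "\<dots> = ?r"
  proof
    assume "\<exists>v. v \<in> carrier_vec N \<and> v \<noteq> 0\<^sub>v N \<and> ?A *\<^sub>v v = 0\<^sub>v N"
    then obtain v where v: "v \<in> carrier_vec N" "v \<noteq> 0\<^sub>v N" "?A *\<^sub>v v = 0\<^sub>v N" by blast
    have "\<exists>j<N. v $ j \<noteq> 0" using v(1,2) by (metis carrier_vecD eq_vecI index_zero_vec(1,2))
    moreover have "(\<Sum>j<N. A i j * v $ j) = 0" if "i < N" for i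
    proof -
      have "(?A *\<^sub>v v) $ i = 0" using v(3) that by simp
      then show ?thesis using v(1) that by (simp add: scalar_prod_def atLeast0LessThan)
    qed
    ultimately show ?r by (intro exI[of _ "\<lambda>j. v $ j"]) auto
  next
    assume ?r
    then obtain x where x: "\<exists>j<N. x j \<noteq> 0" "\<forall>i<N. (\<Sum>j<N. A i j * x j) = 0" by blast
    have "vec N x \<noteq> 0\<^sub>v N" using x(1) by (metis index_vec index_zero_vec(1))
    moreover have "?A *\<^sub>v vec N x = 0\<^sub>v N"
      using x(2) by (intro eq_vecI) (auto simp: scalar_prod_def atLeast0LessThan)
    ultimately show "\<exists>v. v \<in> carrier_vec N \<and> v \<noteq> 0\<^sub>v N \<and> ?A *\<^sub>v v = 0\<^sub>v N"
      by (intro exI[of _ "vec N x"]) auto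
  qed
  finally show ?thesis .
qed

lemma Det_transpose: "Det N (\<lambda>i j. A j i) = Det N A"
proof -
  have "Det N (\<lambda>i j. A j i) = det (transpose_mat (mat N N (\<lambda>(i, j). A i j)))"
    unfolding Det_def by (rule arg_cong[of _ _ det]) auto
  then show ?thesis unfolding Det_def by (subst (asm) det_transpose[of _ N]) auto
qed

lemma Det_0_iff_rows:
  fixes A :: "nat \<Rightarrow> nat \<Rightarrow> 'a::idom"
  shows "Det N A = 0 \<longleftrightarrow> (\<exists>w. (\<exists>i<N. w i \<noteq> 0) \<and> (\<forall>j<N. (\<Sum>i<N. w i * A i j) = 0))"
  by (subst Det_transpose[of N A, symmetric], subst Det_0_iff) (simp only: mult.commute)

lemma Det_forms:
  fixes A :: "nat \<Rightarrow> nat \<Rightarrow> 'a::comm_ring_1 poly poly"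
  assumes "\<And>i j. i < N \<Longrightarrow> j < N \<Longrightarrow> A i j \<in> forms (e i)"
  shows "Det N A \<in> forms (\<Sum>i<N. e i)"
  unfolding Det_Leibniz
proof (rule forms_sum)
  fix p assume "p \<in> {p. p permutes {0..<N}}"
  then have "(\<Prod>i=0..<N. A i (p i)) \<in> forms (\<Sum>i=0..<N. e i)"
    by (intro forms_prod assms) (auto simp: permutes_in_image)
  moreover have "(signof p :: 'a poly poly) \<in> forms 0"
    using forms_1 forms_minus[OF forms_1] by (auto simp: sign_def)
  ultimately show "signof p * (\<Prod>i=0..<N. A i (p i)) \<in> forms (\<Sum>i<N. e i)"
    using forms_mult by (metis add_0 atLeast0LessThan)
qed

section \<open>Dimension counts\<close>

context vector_space
begin

lemma card_independent_le_dim: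
  assumes "finite T" "V \<subseteq> span T" "independent B" "B \<subseteq> V"
  shows "finite B" "card B \<le> dim V"
proof -
  obtain B' where B': "B' \<subseteq> V" "independent B'" "V \<subseteq> span B'" "card B' = dim V"
    by (rule basis_exists)
  have "finite B'" using independent_span_bound[OF assms(1) B'(2)] B'(1) assms(2) by auto
  then have "finite B \<and> card B \<le> card B'"
    using assms(3,4) B'(3) by (intro independent_span_bound) auto
  then show "finite B" "card B \<le> dim V" using B'(4) by auto
qed

lemma dim_mono_finite:
  assumes "finite T" "V \<subseteq> span T" "U \<subseteq> V"
  shows "dim U \<le> dim V"
proof -
  obtain B where "B \<subseteq> U" "independent B" "U \<subseteq> span B" "card B = dim U"
    by (rule basis_exists)
  then show ?thesis using card_independent_le_dim(2)[OF assms(1,2), of B] assms(3) by auto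
qed

lemma span_Int_independent:
  assumes "independent (A \<union> B)" "A \<inter> B = {}" "x \<in> span A" "x \<in> span B"
  shows "x = 0"
proof -
  have "representation (A \<union> B) x = representation A x" "representation (A \<union> B) x = representation B x"
    using assms by (auto intro!: representation_extend)
  then have z: "representation A x b = 0" for b
    using assms(2) representation_ne_zero[of A x b] representation_ne_zero[of B x b] by auto
  have "independent A" using assms(1) by (rule independent_mono) auto
  then show ?thesis using sum_nonzero_representation_eq[of A x] assms(3) z by simp
qed

end

context vector_space_pair
begin

lemma dim_inj_image:
  assumes f: "Vector_Spaces.linear s1 s2 f" and V: "vs1.subspace V"
    and inj: "\<And>x. x \<in> V \<Longrightarrow> f x = 0 \<Longrightarrow> x = 0"
  shows "vs2.dim (f ` V) = vs1.dim V"
proof -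
  obtain B where B: "B \<subseteq> V" "vs1.independent B" "V \<subseteq> vs1.span B" "card B = vs1.dim V"
    by (rule vs1.basis_exists)
  have sp: "vs1.span B = V" using B(1,3) V by (simp add: vs1.span_subspace)
  have inj': "inj_on f (vs1.span B)"
    unfolding sp linear_inj_on_iff_eq_0[OF f V] using inj by blast
  have "vs2.independent (f ` B)" by (rule linear_independent_injective_image[OF f B(2) inj'])
  moreover have "f ` V \<subseteq> vs2.span (f ` B)" by (rule linear_spans_image[OF f B(3)])
  moreover have "card (f ` B) = card B"
    using inj' sp B(1) by (metis card_image inj_on_subset)
  ultimately show ?thesis using B(1,4) by (intro vs2.dim_unique[of "f ` B"]) auto
qed

text \<open>\<open>W\<close> consists of the vectors extending a basis of the kernel to a basis of
  \<open>V\<close>; \<open>f\<close> is injective on its span.\<close>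

lemma kernel_complement:
  assumes f: "Vector_Spaces.linear s1 s2 f" and V: "vs1.subspace V" "finite T" "V \<subseteq> vs1.span T"
  obtains W where "W \<subseteq> V" "finite W" "inj_on f W" "vs2.independent (f ` W)"
    "card W + vs1.dim {x \<in> V. f x = 0} = vs1.dim V"
proof -
  let ?K = "{x \<in> V. f x = 0}"
  obtain B where B: "B \<subseteq> ?K" "vs1.independent B" "?K \<subseteq> vs1.span B" "card B = vs1.dim ?K"
    by (rule vs1.basis_exists)
  then have "B \<subseteq> V" by auto
  then obtain C where C: "B \<subseteq> C" "C \<subseteq> V" "vs1.independent C" "V \<subseteq> vs1.span C"
    using B(2) by (rule vs1.maximal_independent_subset_extend)
  let ?W = "C - B"
  have finC: "finite C" using vs1.card_independent_le_dim(1)[OF V(2,3) C(3,2)] .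
  have dimV: "card C = vs1.dim V" using C by (intro vs1.basis_card_eq_dim)
  have "x = 0" if "x \<in> vs1.span ?W" "f x = 0" for x
  proof -
    have "x \<in> V" using that(1) C(2) V(1) vs1.span_minimal[of ?W V] by auto
    then have "x \<in> vs1.span B" using B(3) that(2) by auto
    then show ?thesis using that(1) C(1,3)
      by (intro vs1.span_Int_independent[of ?W B]) (auto simp: Un_absorb2)
  qed
  then have inj: "inj_on f (vs1.span ?W)"
    using linear_inj_on_iff_eq_0[OF f vs1.subspace_span[of ?W]] by blast
  have "vs1.independent ?W" using C(3) by (rule vs1.independent_mono) auto
  then have "vs2.independent (f ` ?W)" by (rule linear_independent_injective_image[OF f _ inj])
  moreover have "inj_on f ?W" using inj by (rule inj_on_subset) (auto intro: vs1.span_base)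
  moreover have "card ?W + vs1.dim ?K = vs1.dim V"
    using B(4) dimV finC C(1) card_mono[OF finC C(1)] by (simp add: card_Diff_subset finite_subset)
  ultimately show thesis using that[of ?W] C(2) finC by auto
qed

text \<open>\<open>W\<close> together with a basis of the kernel is still independent. The images
  are taken as a family indexed by \<open>W\<close>, so injectivity of \<open>f\<close> on
  \<open>W\<close> does not have to be known beforehand.\<close>

lemma kernel_dim_bound:
  assumes f: "Vector_Spaces.linear s1 s2 f" and V: "vs1.subspace V" "finite T" "V \<subseteq> vs1.span T"
    and W: "W \<subseteq> V" "finite W"
    and indep: "\<And>c. (\<Sum>w\<in>W. s2 (c w) (f w)) = 0 \<Longrightarrow> \<forall>w\<in>W. c w = 0"
  shows "card W + vs1.dim {x \<in> V. f x = 0} \<le> vs1.dim V"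
proof -
  let ?K = "{x \<in> V. f x = 0}"
  obtain B where B: "B \<subseteq> ?K" "vs1.independent B" "?K \<subseteq> vs1.span B" "card B = vs1.dim ?K"
    by (rule vs1.basis_exists)
  have BV: "B \<subseteq> V" using B by auto
  have finB: "finite B" using vs1.card_independent_le_dim(1)[OF V(2,3) B(2) BV] .
  have disj: "W \<inter> B = {}"
  proof (rule ccontr)
    assume "W \<inter> B \<noteq> {}"
    then obtain w where w: "w \<in> W" "w \<in> B" by auto
    have "(\<Sum>v\<in>W. s2 (if v = w then 1 else 0) (f v)) = (\<Sum>v\<in>W. if v = w then f v else 0)"
      by (rule sum.cong) auto
    also have "\<dots> = 0" using w B(1) W(2) by auto
    finally show False using indep[of "\<lambda>v. if v = w then 1 else 0"] w by auto
  qed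
  have "vs1.independent (W \<union> B)"
  proof (rule vs1.independent_if_scalars_zero)
    fix c x assume c: "(\<Sum>x\<in>W \<union> B. s1 (c x) x) = 0" and x: "x \<in> W \<union> B"
    have split: "(\<Sum>x\<in>W \<union> B. s1 (c x) x) = (\<Sum>x\<in>W. s1 (c x) x) + (\<Sum>x\<in>B. s1 (c x) x)"
      by (rule sum.union_disjoint) (use W finB disj in auto)
    have "f (\<Sum>x\<in>W \<union> B. s1 (c x) x) = (\<Sum>x\<in>W. s2 (c x) (f x)) + (\<Sum>x\<in>B. s2 (c x) (f x))"
      unfolding split by (simp add: linear_add[OF f] linear_sum[OF f] linear_scale[OF f])
    also have "(\<Sum>x\<in>B. s2 (c x) (f x)) = 0" using B(1) by (intro sum.neutral) auto
    finally have "(\<Sum>x\<in>W. s2 (c x) (f x)) = 0" using c linear_0[OF f] by simp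
    then have cW: "\<forall>w\<in>W. c w = 0" by (rule indep)
    then have "(\<Sum>x\<in>B. s1 (c x) x) = 0" using c split by simp
    then have "\<forall>x\<in>B. c x = 0" using B(2) finB vs1.independentD[of B B] by blast
    then show "c x = 0" using cW x by auto
  qed (use W finB in auto)
  then have "card (W \<union> B) \<le> vs1.dim V"
    using W(1) BV by (intro vs1.card_independent_le_dim(2)[OF V(2,3)]) auto
  then show ?thesis using B(4) card_Un_disjoint[OF W(2) finB disj] by simp
qed

end

section \<open>Polynomials and vectors of polynomials as vector spaces over k\<close>

definition sc :: "'k::field \<Rightarrow> (nat \<Rightarrow> 'k poly poly) \<Rightarrow> nat \<Rightarrow> 'k poly poly" where
  "sc c w = (\<lambda>j. smult [:c:] (w j))"

lemma sc_apply [simp]: "sc c w j = smult [:c:] (w j)"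
  by (simp add: sc_def)

lemma sum_fun_apply: "(\<Sum>x\<in>A. f x) j = (\<Sum>x\<in>A. f x j)"
  for f :: "'b \<Rightarrow> 'c \<Rightarrow> 'a::comm_monoid_add"
  by (induction A rule: infinite_finite_induct) auto

global_interpretation V: vector_space "sc :: 'k::field \<Rightarrow> _"
  by unfold_locales (auto simp: fun_eq_iff smult_add_right smult_add_left[symmetric] mult.commute simp flip: one_pCons)

global_interpretation R: vector_space "\<lambda>c::'k::field. smult [:c:] :: 'k poly poly \<Rightarrow> _"
  by unfold_locales (auto simp: smult_add_right smult_add_left[symmetric] mult.commute simp flip: one_pCons)

global_interpretation K: vector_space "(*) :: 'k::field \<Rightarrow> 'k \<Rightarrow> 'k"
  by unfold_locales (auto simp: algebra_simps)

global_interpretation VR: vector_space_pair "sc :: 'k::field \<Rightarrow> _" "\<lambda>c::'k::field. smult [:c:] :: 'k poly poly \<Rightarrow> _"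
  by unfold_locales

global_interpretation VV: vector_space_pair "sc :: 'k::field \<Rightarrow> _" "sc :: 'k::field \<Rightarrow> _"
  by unfold_locales

global_interpretation RK: vector_space_pair "\<lambda>c::'k::field. smult [:c:] :: 'k poly poly \<Rightarrow> _" "(*) :: 'k::field \<Rightarrow> 'k \<Rightarrow> 'k"
  by unfold_locales

text \<open>The degree \<open>m\<close> component of the direct sum of the modules \<open>R(-q k)\<close> over \<open>k < r\<close>.\<close>

definition gr :: "nat \<Rightarrow> (nat \<Rightarrow> nat) \<Rightarrow> nat \<Rightarrow> (nat \<Rightarrow> 'k::field poly poly) set" where
  "gr r q m = {w. (\<forall>k<r. w k \<in> forms (int m - int (q k))) \<and> (\<forall>k\<ge>r. w k = 0)}"

text \<open>The Hilbert function of the graded free module, by \<open>gr_dim\<close>. Truncated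
  subtraction is the right operation: forms of degree \<open>m - q k\<close> have dimension
  \<open>m + 1 - q k\<close>, and only zero is left once \<open>q k > m\<close>.\<close>

definition H :: "nat \<Rightarrow> (nat \<Rightarrow> nat) \<Rightarrow> nat \<Rightarrow> nat" where
  "H r q m = (\<Sum>k<r. m + 1 - q k)"

definition gr_unit :: "(nat \<Rightarrow> nat) \<Rightarrow> nat \<Rightarrow> nat \<times> nat \<Rightarrow> nat \<Rightarrow> 'k::field poly poly" where
  "gr_unit q m = (\<lambda>(k, i) l. if l = k then monom (monom 1 (m - q k - i)) i else 0)"

definition gr_index :: "nat \<Rightarrow> (nat \<Rightarrow> nat) \<Rightarrow> nat \<Rightarrow> (nat \<times> nat) set" where
  "gr_index r q m = (SIGMA k:{..<r}. {..<m + 1 - q k})"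

lemma finite_gr_index [simp]: "finite (gr_index r q m)"
  by (simp add: gr_index_def)

lemma gr_subspace: "V.subspace (gr r q m)"
  unfolding V.subspace_def gr_def by (auto intro: forms_add forms_smult)

lemma gr_unit_in_gr: "x \<in> gr_index r q m \<Longrightarrow> gr_unit q m x \<in> gr r q m"
  by (auto simp: gr_index_def gr_def gr_unit_def forms_def split: if_splits)

lemma gr_expand:
  assumes "w \<in> gr r q m"
  shows "w = (\<Sum>x\<in>gr_index r q m. sc (cc (w (fst x)) (snd x) (m - q (fst x) - snd x)) (gr_unit q m x))"
proof
  fix l
  have "(\<Sum>x\<in>gr_index r q m. sc (cc (w (fst x)) (snd x) (m - q (fst x) - snd x)) (gr_unit q m x)) l
     = (\<Sum>k<r. \<Sum>i<m + 1 - q k. if l = k then monom (monom (cc (w k) i (m - q k - i)) (m - q k - i)) i else 0)"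
    unfolding sum_fun_apply gr_index_def
    by (subst sum.Sigma) (auto intro!: sum.cong simp: gr_unit_def smult_monom)
  also have "\<dots> = (\<Sum>k<r. if l = k then (\<Sum>i<m + 1 - q k. monom (monom (cc (w k) i (m - q k - i)) (m - q k - i)) i) else 0)"
    by (rule sum.cong) auto
  also have "\<dots> = w l"
  proof (cases "l < r")
    case True
    then have l: "w l \<in> forms (int m - int (q l))" using assms by (auto simp: gr_def)
    show ?thesis
    proof (cases "q l \<le> m")
      case ql: True
      have "w l \<in> forms (int (m - q l))" using l ql by (simp add: of_nat_diff)
      then have "w l = (\<Sum>i<m + 1 - q l. monom (monom (cc (w l) i (m - q l - i)) (m - q l - i)) i)"
        using forms_expand[of "w l" "m - q l"] ql
        by (simp add: lessThan_Suc_atMost[symmetric] Suc_diff_le)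
      then show ?thesis using True by simp
    next
      case False
      then have "w l = 0" using forms_neg[OF _ l] by simp
      then show ?thesis using True False by simp
    qed
  next
    case False
    then show ?thesis using assms by (auto simp: gr_def)
  qed
  finally show "w l = (\<Sum>x\<in>gr_index r q m. sc (cc (w (fst x)) (snd x) (m - q (fst x) - snd x)) (gr_unit q m x)) l"
    by simp
qed

lemma gr_unit_coord:
  assumes "x \<in> gr_index r q m" "y \<in> gr_index r q m"
  shows "cc (gr_unit q m y (fst x)) (snd x) (m - q (fst x) - snd x) = (if x = y then 1 else 0)"
  using assms by (auto simp: gr_index_def gr_unit_def split: if_splits)

lemma gr_span: "gr r q m \<subseteq> V.span (gr_unit q m ` gr_index r q m)"
proof
  fix w :: "nat \<Rightarrow> 'k::field poly poly" assume "w \<in> gr r q m"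
  then show "w \<in> V.span (gr_unit q m ` gr_index r q m)"
    by (subst gr_expand[of w r q m], assumption, intro V.span_sum V.span_scale, intro V.span_base imageI)
qed

lemma gr_finite_span: "\<exists>T. finite T \<and> gr r q m \<subseteq> V.span T"
  using gr_span by (metis finite_gr_index finite_imageI)

lemma gr_dim: "V.dim (gr r q m :: (nat \<Rightarrow> 'k::field poly poly) set) = H r q m"
proof (rule V.dim_unique)
  let ?E = "gr_unit q m :: nat \<times> nat \<Rightarrow> nat \<Rightarrow> 'k poly poly" and ?I = "gr_index r q m"
  show "?E ` ?I \<subseteq> gr r q m" using gr_unit_in_gr by blast
  show "gr r q m \<subseteq> V.span (?E ` ?I)" by (rule gr_span)
  have inj: "inj_on ?E ?I"
  proof (rule inj_onI, rule ccontr)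
    fix x y assume xy: "x \<in> ?I" "y \<in> ?I" "?E x = ?E y" "x \<noteq> y"
    then show False using gr_unit_coord[OF xy(1,2), where 'a='k] gr_unit_coord[OF xy(1,1), where 'a='k] by simp
  qed
  show "V.independent (?E ` ?I)"
  proof (rule V.independent_if_scalars_zero)
    fix c x assume c: "(\<Sum>x\<in>?E ` ?I. sc (c x) x) = 0" and x: "x \<in> ?E ` ?I"
    then obtain y where y: "y \<in> ?I" "x = ?E y" by auto
    have "0 = cc ((\<Sum>x\<in>?E ` ?I. sc (c x) x) (fst y)) (snd y) (m - q (fst y) - snd y)" by (simp add: c)
    also have "\<dots> = (\<Sum>z\<in>?I. c (?E z) * cc (?E z (fst y)) (snd y) (m - q (fst y) - snd y))"
      by (simp add: sum.reindex[OF inj] sum_fun_apply coeff_sum)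
    also have "\<dots> = (\<Sum>z\<in>?I. if y = z then c (?E z) else 0)"
      by (rule sum.cong) (use gr_unit_coord[OF y(1), where 'a='k] in auto)
    finally show "c x = 0" using y by simp
  qed auto
  have "card (?E ` ?I) = card ?I" by (rule card_image[OF inj])
  also have "\<dots> = H r q m" by (simp add: gr_index_def H_def)
  finally show "card (?E ` ?I) = H r q m" .
qed

lemma forms_finite_span:
  "\<exists>T. finite T \<and> card T \<le> e + 1 \<and> (forms (int e) :: 'k::field poly poly set) \<subseteq> R.span T"
proof (intro exI conjI)
  let ?T = "(\<lambda>i. monom (monom 1 (e - i)) i) ` {..e} :: 'k poly poly set"
  show "finite ?T" by simp
  show "card ?T \<le> e + 1" using card_image_le[of "{..e}"] by fastforce
  show "(forms (int e) :: 'k poly poly set) \<subseteq> R.span ?T"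
  proof
    fix p :: "'k poly poly" assume "p \<in> forms (int e)"
    then have "p = (\<Sum>i\<le>e. smult [:cc p i (e - i):] (monom (monom 1 (e - i)) i))"
      by (subst forms_expand[of p e]) (simp_all add: smult_monom)
    also have "\<dots> \<in> R.span ?T"
      by (intro R.span_sum R.span_scale R.span_base) auto
    finally show "p \<in> R.span ?T" .
  qed
qed

section \<open>Graded bases of saturated submodules\<close>

abbreviation HV :: "nat \<Rightarrow> nat \<Rightarrow> (nat \<Rightarrow> 'k::field poly poly) set" where
  "HV r m \<equiv> gr r (\<lambda>_. 0) m"

text \<open>\<open>E\<close> is an arbitrary set so that the operation can be iterated:
  \<open>{a}\<close> yields the syzygies of \<open>a\<close>, a second application the vectors
  orthogonal to all syzygies. Vanishing from index \<open>r\<close> on makes functions represent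
  vectors uniquely.\<close>

definition perp :: "nat \<Rightarrow> (nat \<Rightarrow> 'k::field poly poly) set \<Rightarrow> (nat \<Rightarrow> 'k poly poly) set" where
  "perp r E = {v. (\<forall>j\<ge>r. v j = 0) \<and> (\<forall>e\<in>E. (\<Sum>j<r. v j * e j) = 0)}"

text \<open>By \<open>coeff_0_forms\<close> the form vector \<open>v i\<close> of degree
  \<open>deg i\<close> is, modulo s, a scalar vector times a power of t. The scalar vectors are
  required to be independent over k.\<close>

definition leads_indep :: "nat \<Rightarrow> nat \<Rightarrow> (nat \<Rightarrow> nat) \<Rightarrow> (nat \<Rightarrow> nat \<Rightarrow> 'k::field poly poly) \<Rightarrow> bool" where
  "leads_indep r N deg v \<longleftrightarrow>
     (\<forall>c. (\<forall>j<r. (\<Sum>i<N. c i * cc (v i j) 0 (deg i)) = 0) \<longrightarrow> (\<forall>i<N. c i = 0))"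

definition R_indep :: "nat \<Rightarrow> nat \<Rightarrow> (nat \<Rightarrow> nat \<Rightarrow> 'a::comm_ring_1) \<Rightarrow> bool" where
  "R_indep r N v \<longleftrightarrow> (\<forall>w. (\<forall>j<r. (\<Sum>i<N. w i * v i j) = 0) \<longrightarrow> (\<forall>i<N. w i = 0))"

lemma HV_iff: "v \<in> HV r m \<longleftrightarrow> (\<forall>j<r. v j \<in> forms (int m)) \<and> (\<forall>j\<ge>r. v j = 0)"
  by (simp add: gr_def)

lemma pCons_0_coeff: "poly.coeff p 0 = 0 \<Longrightarrow> p = [:0, 1:] * poly_shift 1 p"
  for p :: "'a::comm_semiring_1 poly"
  by (rule poly_eqI) (auto simp: coeff_pCons coeff_poly_shift split: nat.splits)

text \<open>Modulo s a relation splits by powers of t into relations between the scalar leading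
  vectors, so all its coefficients are divisible by s. Dividing by s gives another relation, and all
  coefficients vanish to every order in s.\<close>

lemma leads_indep_imp_R_indep:
  fixes v :: "nat \<Rightarrow> nat \<Rightarrow> 'k::field poly poly"
  assumes v: "\<And>i. i < N \<Longrightarrow> v i \<in> HV r (deg i)" and li: "leads_indep r N deg v"
  shows "R_indep r N v"
proof -
  have base: "poly.coeff (w i) 0 = 0"
    if w: "\<forall>j<r. (\<Sum>i<N. w i * v i j) = 0" and i: "i < N" for w i
  proof (rule poly_eqI)
    fix a
    \<comment> \<open>The contributions to the power \<open>deg i + a\<close> of t at s = 0; the
      case distinction keeps the natural number subtraction honest.\<close>
    define c where "c i' = (if deg i' \<le> deg i + a then cc (w i') 0 (deg i + a - deg i') else 0)" for i'
    have "(\<Sum>i'<N. c i' * cc (v i' j) 0 (deg i')) = 0" if j: "j < r" for j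
    proof -
      have "c i' * cc (v i' j) 0 (deg i') = cc (w i' * v i' j) 0 (deg i + a)" if "i' < N" for i'
      proof -
        have "v i' j \<in> forms (int (deg i'))" using v[OF that] j by (simp add: HV_iff)
        then have "poly.coeff (v i' j) 0 = monom (cc (v i' j) 0 (deg i')) (deg i')"
          by (rule coeff_0_forms)
        moreover have "poly.coeff (w i' * v i' j) 0 = poly.coeff (v i' j) 0 * poly.coeff (w i') 0"
          by (simp add: coeff_mult)
        ultimately have "cc (w i' * v i' j) 0 (deg i + a)
            = poly.coeff (monom (cc (v i' j) 0 (deg i')) (deg i') * poly.coeff (w i') 0) (deg i + a)"
          by metis
        then show ?thesis by (simp add: c_def coeff_monom_mult)
      qed
      then have "(\<Sum>i'<N. c i' * cc (v i' j) 0 (deg i')) = cc (\<Sum>i'<N. w i' * v i' j) 0 (deg i + a)"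
        by (simp add: coeff_sum)
      then show ?thesis using w j by simp
    qed
    then have "c i = 0" using li i unfolding leads_indep_def by blast
    then show "cc (w i) 0 a = poly.coeff 0 a" by (simp add: c_def)
  qed
  have "\<forall>i<N. poly.coeff (w i) n = 0" if "\<forall>j<r. (\<Sum>i<N. w i * v i j) = 0" for w n
    using that
  proof (induction n arbitrary: w)
    case 0
    then show ?case using base by blast
  next
    case (Suc n)
    define w' where "w' i = poly_shift 1 (w i)" for i
    have w': "w i = S * w' i" if "i < N" for i
      unfolding w'_def by (rule pCons_0_coeff) (rule base[OF Suc.prems that])
    have "(\<Sum>i<N. w' i * v i j) = 0" if j: "j < r" for j
    proof -
      have "S * (\<Sum>i<N. w' i * v i j) = (\<Sum>i<N. w i * v i j)"
        unfolding sum_distrib_left by (rule sum.cong) (simp_all only: w' lessThan_iff mult.assoc)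
      then show ?thesis using Suc.prems j by simp
    qed
    then have "\<forall>i<N. poly.coeff (w' i) n = 0" using Suc.IH by blast
    then show ?case using w' by simp
  qed
  then show ?thesis unfolding R_indep_def by (auto simp: poly_eq_iff)
qed

text \<open>Otherwise \<open>r + 1\<close> of the rows, padded by a zero column, form a singular
  square matrix, and a relation between its rows is a relation between the vectors.\<close>

lemma R_indep_le:
  fixes v :: "nat \<Rightarrow> nat \<Rightarrow> 'a::idom"
  assumes "R_indep r N v"
  shows "N \<le> r"
proof (rule ccontr)
  assume "\<not> N \<le> r"
  then have N: "Suc r \<le> N" by simp
  define A where "A i j = (if j < r then v i j else 0)" for i j
  have "Det (Suc r) A = 0"
    unfolding Det_0_iff
    by (intro exI[of _ "\<lambda>j. if j = r then 1 else 0"]) (auto simp: A_def intro!: sum.neutral)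
  then obtain w where w: "\<exists>i<Suc r. w i \<noteq> 0" "\<forall>j<Suc r. (\<Sum>i<Suc r. w i * A i j) = 0"
    unfolding Det_0_iff_rows by blast
  define w' where "w' i = (if i < Suc r then w i else 0)" for i
  have "(\<Sum>i<N. w' i * v i j) = 0" if "j < r" for j
  proof -
    have "(\<Sum>i<N. w' i * v i j) = (\<Sum>i<Suc r. w' i * v i j)"
      using N by (intro sum.mono_neutral_right) (auto simp: w'_def)
    also have "\<dots> = (\<Sum>i<Suc r. w i * A i j)"
      using that by (intro sum.cong) (auto simp: w'_def A_def)
    finally show ?thesis using w(2) that by simp
  qed
  then have "\<forall>i<N. w' i = 0" using assms unfolding R_indep_def by blast
  then have "\<forall>i<Suc r. w i = 0" using N unfolding w'_def by (metis less_le_trans)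
  then show False using w(1) by blast
qed

lemma perp_add: "v \<in> perp r E \<Longrightarrow> w \<in> perp r E \<Longrightarrow> (\<lambda>j. v j + w j) \<in> perp r E"
  by (simp add: perp_def distrib_right sum.distrib)

lemma perp_mult: "v \<in> perp r E \<Longrightarrow> (\<lambda>j. f * v j) \<in> perp r E"
  by (simp add: perp_def mult.assoc sum_distrib_left[symmetric])

lemma perp_mult_cancel: "f \<noteq> 0 \<Longrightarrow> (\<lambda>j. f * v j) \<in> perp r E \<Longrightarrow> v \<in> perp r E"
  by (auto simp: perp_def mult.assoc sum_distrib_left[symmetric])

lemma perp_0: "(\<lambda>j. 0) \<in> perp r E"
  by (simp add: perp_def)

lemma perp_sum: "(\<And>i. i \<in> I \<Longrightarrow> v i \<in> perp r E) \<Longrightarrow> (\<lambda>j. \<Sum>i\<in>I. v i j) \<in> perp r E"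
  by (induction I rule: infinite_finite_induct) (auto intro: perp_0 perp_add)

lemma perp_diff: "v \<in> perp r E \<Longrightarrow> w \<in> perp r E \<Longrightarrow> (\<lambda>j. v j - w j) \<in> perp r E"
  by (simp add: perp_def left_diff_distrib sum_subtractf)

text \<open>The module \<open>perp r E\<close> is saturated with respect to \<open>s\<close>, so modulo \<open>s\<close> it embeds into \<open>k[t]\<^sup>r\<close>.
  A basis is a family whose reductions modulo \<open>s\<close> are independent, of maximal size and, among
  those, of minimal total degree.\<close>

lemma graded_basis_exists:
  fixes E :: "(nat \<Rightarrow> 'k::field poly poly) set"
  obtains N deg v where
    "\<And>i. i < N \<Longrightarrow> v i \<in> HV r (deg i)" "\<And>i. i < N \<Longrightarrow> v i \<in> perp r E"
    "R_indep r N v"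
    "\<And>m x. x \<in> HV r m \<Longrightarrow> x \<in> perp r E \<Longrightarrow> \<exists>w\<in>gr N deg m. \<forall>j. x j = (\<Sum>i<N. w i * v i j)"
proof -
  define good where "good N deg v \<longleftrightarrow> (\<forall>i<N. v i \<in> HV r (deg i) \<inter> perp r E) \<and> leads_indep r N deg v"
    for N and deg :: "nat \<Rightarrow> nat" and v :: "nat \<Rightarrow> nat \<Rightarrow> 'k poly poly"
  have ri: "R_indep r N v" if "good N deg v" for N deg v
    using that leads_indep_imp_R_indep[of N v r deg] by (auto simp: good_def)
  have bound: "N \<le> r" if "\<exists>deg v. good N deg v" for N
    using that ri R_indep_le by blast
  have "\<exists>deg v. good 0 deg v" by (auto simp: good_def leads_indep_def)
  then have "\<exists>N. (\<exists>deg v. good N deg v) \<and> (\<forall>N'. (\<exists>deg v. good N' deg v) \<longrightarrow> N' \<le> N)"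
    by (rule Nat.ex_has_greatest_nat) (use bound in blast)
  then obtain N where N: "\<exists>deg v. good N deg v" "\<And>N'. \<exists>deg v. good N' deg v \<Longrightarrow> N' \<le> N"
    by blast
  have "\<exists>dv. good N (fst dv) (snd dv)" using N(1) by auto
  then obtain dv0 where "good N (fst dv0) (snd dv0)" by blast
  then have "\<exists>dv. good N (fst dv) (snd dv) \<and>
      (\<forall>dv'. good N (fst dv') (snd dv') \<longrightarrow> (\<Sum>i<N. fst dv i) \<le> (\<Sum>i<N. fst dv' i))"
    by (rule ex_has_least_nat)
  then obtain dv where dv: "good N (fst dv) (snd dv)"
    "\<And>dv'. good N (fst dv') (snd dv') \<Longrightarrow> (\<Sum>i<N. fst dv i) \<le> (\<Sum>i<N. fst dv' i)"
    by blast
  define deg where "deg = fst dv"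
  define v where "v = snd dv"
  have good: "good N deg v" using dv(1) by (simp add: deg_def v_def)
  have least: "(\<Sum>i<N. deg i) \<le> (\<Sum>i<N. deg' i)" if "good N deg' v'" for deg' v'
    using dv(2)[of "(deg', v')"] that by (simp add: deg_def)
  have v: "v i \<in> HV r (deg i)" "v i \<in> perp r E" if "i < N" for i
    using good that by (auto simp: good_def)
  \<comment> \<open>Maximality of \<open>N\<close> makes the leading vector of \<open>x\<close>
    dependent on those of the \<open>v i\<close>. Were some \<open>v i0\<close> of degree above
    \<open>m\<close> involved, exchanging it for \<open>x\<close> would lower the total
    degree.\<close>
  have lead: "\<exists>c. (\<forall>j<r. cc (x j) 0 m = (\<Sum>i<N. c i * cc (v i j) 0 (deg i))) \<and> (\<forall>i<N. m < deg i \<longrightarrow> c i = 0)"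
    if x: "x \<in> HV r m" "x \<in> perp r E" for x m
  proof -
    have "\<not> good (Suc N) (deg(N := m)) (v(N := x))" using N(2)[of "Suc N"] by auto
    then have "\<not> leads_indep r (Suc N) (deg(N := m)) (v(N := x))"
      using v x unfolding good_def by (auto simp: less_Suc_eq)
    then obtain b where b: "\<forall>j<r. (\<Sum>i<Suc N. b i * cc ((v(N := x)) i j) 0 ((deg(N := m)) i)) = 0"
      "\<exists>i<Suc N. b i \<noteq> 0" unfolding leads_indep_def by blast
    have b': "(\<Sum>i<N. b i * cc (v i j) 0 (deg i)) + b N * cc (x j) 0 m = 0" if "j < r" for j
    proof -
      have "(\<Sum>i<N. b i * cc ((v(N := x)) i j) 0 ((deg(N := m)) i)) = (\<Sum>i<N. b i * cc (v i j) 0 (deg i))"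
        by (rule sum.cong) auto
      then show ?thesis using b(1) that by simp
    qed
    have bN: "b N \<noteq> 0"
    proof
      assume "b N = 0"
      then have "\<forall>i<N. b i = 0" using b' good unfolding good_def leads_indep_def by simp
      then show False using b(2) \<open>b N = 0\<close> by (auto simp: less_Suc_eq)
    qed
    define c where "c i = - b i / b N" for i
    have c: "cc (x j) 0 m = (\<Sum>i<N. c i * cc (v i j) 0 (deg i))" if "j < r" for j
    proof -
      have "b N * (\<Sum>i<N. c i * cc (v i j) 0 (deg i)) = - (\<Sum>i<N. b i * cc (v i j) 0 (deg i))"
        unfolding sum_distrib_left sum_negf[symmetric] by (rule sum.cong) (use bN in \<open>auto simp: c_def\<close>)
      also have "\<dots> = b N * cc (x j) 0 m"
        by (rule minus_unique) (rule b'[OF that])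
      finally show ?thesis using bN by simp
    qed
    have "c i0 = 0" if i0: "i0 < N" "m < deg i0" for i0
    proof (rule ccontr)
      assume ci0: "c i0 \<noteq> 0"
      have "leads_indep r N (deg(i0 := m)) (v(i0 := x))"
        unfolding leads_indep_def
      proof (rule allI, rule impI)
        fix b assume b: "\<forall>j<r. (\<Sum>i<N. b i * cc ((v(i0 := x)) i j) 0 ((deg(i0 := m)) i)) = 0"
        \<comment> \<open>The relation after \<open>x\<close> has been expanded in the old leading
          vectors.\<close>
        define b' where "b' i = (if i = i0 then 0 else b i) + b i0 * c i" for i
        have "(\<Sum>i<N. b' i * cc (v i j) 0 (deg i)) = 0" if "j < r" for j
        proof -
          have "(\<Sum>i<N. b' i * cc (v i j) 0 (deg i)) =
              (\<Sum>i<N. (if i = i0 then 0 else b i) * cc (v i j) 0 (deg i)) + b i0 * cc (x j) 0 m"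
            unfolding b'_def c[OF that] by (simp only: distrib_right sum.distrib sum_distrib_left mult.assoc)
          also have "(\<Sum>i<N. (if i = i0 then 0 else b i) * cc (v i j) 0 (deg i))
              = (\<Sum>i\<in>{..<N} - {i0}. b i * cc ((v(i0 := x)) i j) 0 ((deg(i0 := m)) i))"
            by (rule sum.mono_neutral_cong_right) auto
          also have "\<dots> + b i0 * cc (x j) 0 m
              = (\<Sum>i<N. b i * cc ((v(i0 := x)) i j) 0 ((deg(i0 := m)) i))"
            using i0 by (subst sum.remove[of "{..<N}" i0]) auto
          finally show ?thesis using b that by simp
        qed
        then have b'0: "\<forall>i<N. b' i = 0" using good unfolding good_def leads_indep_def by blast
        then have "b i0 = 0" using i0 ci0 unfolding b'_def by auto
        then show "\<forall>i<N. b i = 0" using b'0 unfolding b'_def by (metis add.right_neutral mult_zero_left)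
      qed
      then have "good N (deg(i0 := m)) (v(i0 := x))"
        using v x by (auto simp: good_def)
      then have "(\<Sum>i<N. deg i) \<le> (\<Sum>i<N. (deg(i0 := m)) i)" by (rule least)
      moreover have "(\<Sum>i<N. (deg(i0 := m)) i) < (\<Sum>i<N. deg i)"
        by (rule sum_strict_mono_ex1) (use i0 in auto)
      ultimately show False by simp
    qed
    then show ?thesis using c by blast
  qed
  \<comment> \<open>Cancelling the leading vector by a combination with coefficients that are
    scalars times powers of t leaves a remainder divisible by s.\<close>
  have reduce: "\<exists>u\<in>gr N deg m. (\<lambda>j. x j - (\<Sum>i<N. u i * v i j)) \<in> HV r m \<inter> perp r E \<and>
      (\<forall>j. poly.coeff (x j - (\<Sum>i<N. u i * v i j)) 0 = 0)"
    if x: "x \<in> HV r m" "x \<in> perp r E" for x m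
  proof -
    obtain c where c: "\<forall>j<r. cc (x j) 0 m = (\<Sum>i<N. c i * cc (v i j) 0 (deg i))"
      "\<forall>i<N. m < deg i \<longrightarrow> c i = 0" using lead[OF x] by blast
    define u where "u i = (if i < N \<and> deg i \<le> m then monom (monom (c i) (m - deg i)) 0 else 0)" for i
    have "monom (monom a (m - e)) 0 \<in> forms (int m - int e)" if "e \<le> m" for a :: 'k and e
      using forms_monom[of a "m - e" 0] that by (simp add: of_nat_diff)
    then have u: "u \<in> gr N deg m" by (simp add: gr_def u_def)
    have uv: "u i * v i j \<in> forms (int m)" if "i < N" "j < r" for i j
    proof -
      have "u i \<in> forms (int m - int (deg i))" "v i j \<in> forms (int (deg i))"
        using u v(1)[OF that(1)] that by (auto simp: gr_def)
      from forms_mult[OF this] show ?thesis by simp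
    qed
    let ?y = "\<lambda>j. x j - (\<Sum>i<N. u i * v i j)"
    have yp: "?y \<in> perp r E"
      by (rule perp_diff[OF x(2) perp_sum]) (rule perp_mult, use v(2) in auto)
    have yf: "?y j \<in> forms (int m)" if "j < r" for j
      using x(1) uv that by (intro forms_diff forms_sum) (auto simp: HV_iff)
    have yz: "?y j = 0" if "j \<ge> r" for j using yp that by (simp add: perp_def)
    have "poly.coeff (?y j) 0 = 0" for j
    proof (cases "j < r")
      case True
      have "cc (u i * v i j) 0 m = c i * cc (v i j) 0 (deg i)" if "i < N" for i
        using that c(2) by (auto simp: u_def monom_0 coeff_monom_mult)
      then have "cc (?y j) 0 m = 0" using c(1) True by (simp add: coeff_sum)
      then show ?thesis using coeff_0_forms[OF yf[OF True]] by simp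
    next
      case False
      then show ?thesis using yz by simp
    qed
    then show ?thesis using u yp yf yz by (intro bexI[of _ u]) (auto simp: HV_iff)
  qed
  \<comment> \<open>Induction on the degree: the remainder is s times a vector \<open>y\<close> of
    one degree less, and \<open>y\<close> is again in \<open>perp r E\<close> because s can be
    cancelled there.\<close>
  have gen: "\<exists>w\<in>gr N deg m. \<forall>j. x j = (\<Sum>i<N. w i * v i j)"
    if "x \<in> HV r m" "x \<in> perp r E" for m x
    using that
  proof (induction m arbitrary: x)
    case 0
    obtain u where u: "u \<in> gr N deg 0" "(\<lambda>j. x j - (\<Sum>i<N. u i * v i j)) \<in> HV r 0"
      "\<forall>j. poly.coeff (x j - (\<Sum>i<N. u i * v i j)) 0 = 0"
      using reduce[OF 0] by blast
    have "x j - (\<Sum>i<N. u i * v i j) = 0" for j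
    proof (cases "j < r")
      case True
      then obtain a where "x j - (\<Sum>i<N. u i * v i j) = [:[:a:]:]"
        using u(2) forms_deg_0 by (fastforce simp: HV_iff)
      then show ?thesis using u(3) by (metis coeff_pCons_0 pCons_0_0)
    qed (use u(2) in \<open>auto simp: HV_iff\<close>)
    then show ?case using u(1) by auto
  next
    case (Suc m)
    obtain u where u: "u \<in> gr N deg (Suc m)" "(\<lambda>j. x j - (\<Sum>i<N. u i * v i j)) \<in> HV r (Suc m)"
      "(\<lambda>j. x j - (\<Sum>i<N. u i * v i j)) \<in> perp r E"
      "\<forall>j. poly.coeff (x j - (\<Sum>i<N. u i * v i j)) 0 = 0"
      using reduce[OF Suc.prems] by blast
    define y where "y j = poly_shift 1 (x j - (\<Sum>i<N. u i * v i j))" for j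
    have y: "x j - (\<Sum>i<N. u i * v i j) = S * y j" for j
      unfolding y_def by (rule pCons_0_coeff) (use u(4) in blast)
    have S0: "(S :: 'k poly poly) \<noteq> 0" by simp
    have "y \<in> perp r E"
      by (rule perp_mult_cancel[OF S0]) (use u(3) in \<open>simp only: y\<close>)
    moreover have "y j \<in> forms (int m)" if "j < r" for j
    proof -
      have "S * y j \<in> forms (int (Suc m))" using u(2) that unfolding y HV_iff by blast
      from forms_factor[OF S_forms S0 this] show ?thesis by simp
    qed
    ultimately obtain w where w: "w \<in> gr N deg m" "\<forall>j. y j = (\<Sum>i<N. w i * v i j)"
      using Suc.IH[of y] by (auto simp: HV_iff perp_def)
    have "(\<lambda>i. u i + S * w i) \<in> gr N deg (Suc m)"
    proof -
      have "S * w i \<in> forms (int (Suc m) - int (deg i))" if "i < N" for i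
      proof -
        have "w i \<in> forms (int m - int (deg i))" using w(1) that by (simp add: gr_def)
        from forms_mult[OF S_forms this] show ?thesis by (simp add: algebra_simps)
      qed
      then show ?thesis using u(1) w(1) unfolding gr_def by (auto intro: forms_add simp del: mult_pCons_left)
    qed
    moreover have "x j = (\<Sum>i<N. (u i + S * w i) * v i j)" for j
    proof -
      have "x j = (\<Sum>i<N. u i * v i j) + S * y j" using y[of j] by (simp only: diff_eq_eq add.commute)
      then show ?thesis unfolding w(2)[rule_format] distrib_right sum.distrib sum_distrib_left mult.assoc .
    qed
    ultimately show ?case by (intro bexI[of _ "\<lambda>i. u i + S * w i"] allI)
  qed
  show thesis
    by (rule that[OF v ri[OF good] gen])
qed

section \<open>Syzygies of a tuple\<close>

definition comb :: "nat \<Rightarrow> (nat \<Rightarrow> nat \<Rightarrow> 'a::comm_ring_1) \<Rightarrow> (nat \<Rightarrow> 'a) \<Rightarrow> nat \<Rightarrow> 'a" where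
  "comb N v w = (\<lambda>j. \<Sum>i<N. w i * v i j)"

text \<open>The index \<open>m\<close> is the degree of the entries, without the shift by n, so that
  the members of a basis have degrees equal to the parts of the type.\<close>

definition hsyz :: "nat \<Rightarrow> (nat \<Rightarrow> 'k::field poly poly) \<Rightarrow> nat \<Rightarrow> (nat \<Rightarrow> 'k poly poly) set" where
  "hsyz d a m = HV (d + 1) m \<inter> perp (d + 1) {a}"

definition hdim :: "nat \<Rightarrow> (nat \<Rightarrow> 'k::field poly poly) \<Rightarrow> nat \<Rightarrow> nat" where
  "hdim d a m = V.dim (hsyz d a m)"

definition mulmap :: "nat \<Rightarrow> (nat \<Rightarrow> 'a::comm_ring_1) \<Rightarrow> (nat \<Rightarrow> 'a) \<Rightarrow> 'a" where
  "mulmap d a x = (\<Sum>j<d + 1. x j * a j)"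

lemma hsyz_subset: "hsyz d a m \<subseteq> HV (d + 1) m"
  by (simp add: hsyz_def)

lemma hsyz_eq_kernel: "hsyz d a m = {x \<in> HV (d + 1) m. mulmap d a x = 0}"
  by (auto simp: hsyz_def perp_def mulmap_def HV_iff)

lemma comb_linear: "Vector_Spaces.linear sc sc (comb N v)"
  unfolding Vector_Spaces.linear_iff
  by (auto simp: comb_def fun_eq_iff distrib_right sum.distrib R.scale_sum_right V.vector_space_axioms
      intro: V.vector_space_axioms)

lemma mulmap_linear: "Vector_Spaces.linear sc (\<lambda>c. smult [:c:]) (mulmap d a)"
  unfolding Vector_Spaces.linear_iff
  by (auto simp: mulmap_def smult_add_right distrib_right sum.distrib R.scale_sum_right
      V.vector_space_axioms R.vector_space_axioms)

lemma dim_comb_image: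
  fixes v :: "nat \<Rightarrow> nat \<Rightarrow> 'k::field poly poly"
  assumes v: "R_indep r N v" "\<And>i j. i < N \<Longrightarrow> j \<ge> r \<Longrightarrow> v i j = 0"
  shows "V.dim (comb N v ` gr N q m) = H N q m"
proof -
  have "V.dim (comb N v ` gr N q m) = V.dim (gr N q m :: (nat \<Rightarrow> 'k poly poly) set)"
  proof (rule VV.dim_inj_image[OF comb_linear gr_subspace])
    fix x :: "nat \<Rightarrow> 'k poly poly" assume x: "x \<in> gr N q m" "comb N v x = 0"
    then have "(\<Sum>i<N. x i * v i j) = 0" for j by (auto simp: comb_def fun_eq_iff)
    then have "\<forall>i<N. x i = 0" using v(1) unfolding R_indep_def by blast
    then show "x = 0" using x(1) by (auto simp: gr_def fun_eq_iff not_less[symmetric])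
  qed
  then show ?thesis by (simp add: gr_dim)
qed

lemma comb_in_HV:
  assumes v: "\<And>i. i < N \<Longrightarrow> v i \<in> HV r (q i)" and w: "w \<in> gr N q m"
  shows "comb N v w \<in> HV r m"
proof -
  have "w i * v i j \<in> forms (int m)" if "i < N" "j < r" for i j
    using forms_mult[of "w i" "int m - int (q i)" "v i j" "int (q i)"] v[OF that(1)] w that
    by (auto simp: gr_def)
  then show ?thesis using v by (auto simp: HV_iff comb_def intro!: forms_sum sum.neutral)
qed

lemma comb_in_perp: "(\<And>i. i < N \<Longrightarrow> v i \<in> perp r E) \<Longrightarrow> comb N v w \<in> perp r E"
  unfolding comb_def by (rule perp_sum) (auto intro: perp_mult)

lemma H_le_hdim:
  assumes v: "\<And>i. i < N \<Longrightarrow> v i \<in> hsyz d a (q i)" and indep: "R_indep (d + 1) N v"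
  shows "H N q m \<le> hdim d a m"
proof -
  have v': "v i \<in> HV (d + 1) (q i)" "v i \<in> perp (d + 1) {a}" if "i < N" for i
    using v[OF that] by (auto simp: hsyz_def)
  have "comb N v ` gr N q m \<subseteq> hsyz d a m"
    using comb_in_HV[of N v "d + 1" q _ m] comb_in_perp[of N v] v' unfolding hsyz_def by blast
  moreover obtain T where "finite T" "hsyz d a m \<subseteq> V.span T"
    using gr_finite_span hsyz_subset by (metis subset_trans)
  ultimately have "V.dim (comb N v ` gr N q m) \<le> hdim d a m"
    unfolding hdim_def by (intro V.dim_mono_finite)
  then show ?thesis using dim_comb_image[OF indep, of q m] v' by (simp add: HV_iff)
qed

lemma hdim_eq_H:
  assumes v: "\<And>i. i < N \<Longrightarrow> v i \<in> hsyz d a (q i)" and indep: "R_indep (d + 1) N v"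
    and gen: "\<And>x. x \<in> hsyz d a m \<Longrightarrow> \<exists>w\<in>gr N q m. \<forall>j. x j = (\<Sum>i<N. w i * v i j)"
  shows "hdim d a m = H N q m"
proof -
  have v': "v i \<in> HV (d + 1) (q i)" "v i \<in> perp (d + 1) {a}" if "i < N" for i
    using v[OF that] by (auto simp: hsyz_def)
  have "comb N v ` gr N q m \<subseteq> hsyz d a m"
    using comb_in_HV[of N v "d + 1" q _ m] comb_in_perp[of N v] v' unfolding hsyz_def by blast
  moreover have "hsyz d a m \<subseteq> comb N v ` gr N q m"
    using gen by (fastforce simp: comb_def fun_eq_iff)
  ultimately have "comb N v ` gr N q m = hsyz d a m" by blast
  then show ?thesis using dim_comb_image[OF indep, of q m] v' by (simp add: HV_iff hdim_def)
qed

text \<open>Rank--nullity for the multiplication map into forms of degree \<open>n + m\<close>, a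
  space of dimension at most \<open>n + m + 1\<close>. The additive form avoids truncated
  subtraction.\<close>

lemma hdim_lower:
  assumes a: "\<And>j. j \<le> d \<Longrightarrow> a j \<in> forms (int n)"
  shows "(d + 1) * (m + 1) \<le> hdim d a m + n + m + 1"
proof -
  obtain T :: "(nat \<Rightarrow> 'a poly poly) set" where T: "finite T" "HV (d + 1) m \<subseteq> V.span T"
    using gr_finite_span by blast
  obtain W where W: "W \<subseteq> HV (d + 1) m" "finite W" "inj_on (mulmap d a) W"
    "R.independent (mulmap d a ` W)"
    "card W + V.dim {x \<in> HV (d + 1) m. mulmap d a x = 0} = V.dim (HV (d + 1) m :: (nat \<Rightarrow> 'a poly poly) set)"
    by (rule VR.kernel_complement[OF mulmap_linear gr_subspace T])
  obtain B :: "'a poly poly set" where B: "finite B" "card B \<le> n + m + 1" "forms (int (n + m)) \<subseteq> R.span B"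
    using forms_finite_span[of "n + m"] by auto
  have "mulmap d a x \<in> forms (int (n + m))" if "x \<in> HV (d + 1) m" for x
    unfolding mulmap_def
  proof (rule forms_sum)
    fix j assume j: "j \<in> {..<d + 1}"
    then have "x j \<in> forms (int m)" using that by (auto simp: HV_iff)
    from forms_mult[OF this a[of j]] j show "x j * a j \<in> forms (int (n + m))"
      by (simp add: add.commute)
  qed
  then have "card (mulmap d a ` W) \<le> card B"
    using R.independent_span_bound[OF B(1) W(4)] W(1) B(3) by blast
  then have "card W \<le> n + m + 1" using B(2) card_image[OF W(3)] by simp
  moreover have "V.dim (HV (d + 1) m :: (nat \<Rightarrow> 'a poly poly) set) = (d + 1) * (m + 1)"
    by (simp add: gr_dim H_def)
  ultimately show ?thesis using W(5) unfolding hdim_def hsyz_eq_kernel by simp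
qed

text \<open>Generation concerns all syzygies, homogeneous or not, as exactness in
  \<open>has_mu_type\<close> does; \<open>is_basis_hdim\<close> recovers homogeneous coefficients.
  The degrees need not be sorted.\<close>

definition is_basis :: "nat \<Rightarrow> (nat \<Rightarrow> nat) \<Rightarrow> (nat \<Rightarrow> 'k::field poly poly) \<Rightarrow> (nat \<Rightarrow> nat \<Rightarrow> 'k poly poly) \<Rightarrow> bool" where
  "is_basis d q a v \<longleftrightarrow> (\<forall>i<d. v i \<in> hsyz d a (q i)) \<and> R_indep (d + 1) d v \<and>
     (\<forall>x\<in>perp (d + 1) {a}. \<exists>w. \<forall>j. x j = (\<Sum>i<d. w i * v i j))"

lemma is_basis_hdim:
  assumes "is_basis d q a v"
  shows "hdim d a m = H d q m"
proof (rule hdim_eq_H)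
  show v: "v i \<in> hsyz d a (q i)" if "i < d" for i using assms that by (simp add: is_basis_def)
  show "R_indep (d + 1) d v" using assms by (simp add: is_basis_def)
  fix x assume x: "x \<in> hsyz d a m"
  then obtain w where w: "\<And>j. x j = (\<Sum>i<d. w i * v i j)"
    using assms unfolding is_basis_def hsyz_def by blast
  \<comment> \<open>Only the part of \<open>w i\<close> of degree \<open>m - q i\<close> contributes
    in degree \<open>m\<close>.\<close>
  define u where "u i = (if i < d then hom_part (int m - int (q i)) (w i) else 0)" for i
  have "x j = (\<Sum>i<d. u i * v i j)" for j
  proof (cases "j < d + 1")
    case True
    then have "x j = hom_part (int m) (x j)"
      using x hom_part_forms[of "x j" "int m" "int m"] by (simp add: hsyz_def HV_iff)
    also have "\<dots> = (\<Sum>i<d. hom_part (int m) (v i j * w i))"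
      unfolding w[of j] hom_part_sum by (simp add: mult.commute)
    also have "\<dots> = (\<Sum>i<d. u i * v i j)"
    proof (rule sum.cong)
      fix i assume "i \<in> {..<d}"
      then have "i < d" "v i j \<in> forms (int (q i))" using v[of i] True by (auto simp: hsyz_def HV_iff)
      then show "hom_part (int m) (v i j * w i) = u i * v i j"
        using hom_part_mult[of "v i j" "int (q i)" "int m" "w i"] by (simp add: u_def mult.commute)
    qed simp
    finally show ?thesis .
  next
    case False
    then have "x j = 0" "\<forall>i<d. v i j = 0" using x v by (auto simp: hsyz_def HV_iff)
    then show ?thesis by simp
  qed
  moreover have "u \<in> gr d q m" by (simp add: gr_def u_def hom_part_in_forms)
  ultimately show "\<exists>w\<in>gr d q m. \<forall>j. x j = (\<Sum>i<d. w i * v i j)" by blast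
qed

lemma is_basis_perm:
  assumes b: "is_basis d q a v" and p: "bij_betw p {..<d} {..<d}"
  shows "is_basis d (q \<circ> p) a (v \<circ> p)"
  unfolding is_basis_def
proof (intro conjI ballI allI impI)
  fix i assume "i < d"
  then have "p i < d" using p by (auto simp: bij_betw_def)
  then show "(v \<circ> p) i \<in> hsyz d a ((q \<circ> p) i)" using b by (simp add: is_basis_def)
next
  have inv: "inv_into {..<d} p (p i) = i" if "i < d" for i
    using p that by (simp add: bij_betw_inv_into_left)
  show "R_indep (d + 1) d (v \<circ> p)"
    unfolding R_indep_def
  proof (intro allI impI)
    fix w i assume w: "\<forall>j<d + 1. (\<Sum>i<d. w i * (v \<circ> p) i j) = 0" and i: "i < d"
    let ?w = "\<lambda>i. w (inv_into {..<d} p i)"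
    have "(\<Sum>i<d. ?w i * v i j) = (\<Sum>i<d. w i * (v \<circ> p) i j)" for j
      by (subst sum.reindex_bij_betw[OF p, symmetric]) (auto simp: inv)
    then have "\<forall>j<d + 1. (\<Sum>i<d. ?w i * v i j) = 0" using w by simp
    moreover have "R_indep (d + 1) d v" using b by (simp add: is_basis_def)
    ultimately have "\<forall>i<d. ?w i = 0" unfolding R_indep_def by (elim allE[of _ ?w] impE)
    moreover have "p i < d" using p i by (auto simp: bij_betw_def)
    ultimately show "w i = 0" using inv[OF i] by metis
  qed
next
  fix x assume "x \<in> perp (d + 1) {a}"
  then obtain w where w: "\<And>j. x j = (\<Sum>i<d. w i * v i j)"
    using b unfolding is_basis_def by blast
  have "x j = (\<Sum>i<d. (w \<circ> p) i * (v \<circ> p) i j)" for j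
    unfolding w using sum.reindex_bij_betw[OF p, of "\<lambda>i. w i * v i j"] by simp
  then show "\<exists>w. \<forall>j. x j = (\<Sum>i<d. w i * (v \<circ> p) i j)" by blast
qed

lemma hom_part_perp:
  assumes a: "\<And>j. j \<le> d \<Longrightarrow> a j \<in> forms (int n)" and x: "x \<in> perp (d + 1) {a}"
  shows "(\<lambda>j. hom_part (int m) (x j)) \<in> hsyz d a m"
proof -
  have "(\<Sum>j<d + 1. hom_part (int m) (x j) * a j) = (\<Sum>j<d + 1. hom_part (int (n + m)) (a j * x j))"
  proof (rule sum.cong)
    fix j assume "j \<in> {..<d + 1}"
    then have "a j \<in> forms (int n)" using a by simp
    from hom_part_mult[OF this, of "int (n + m)" "x j"] show "hom_part (int m) (x j) * a j = hom_part (int (n + m)) (a j * x j)"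
      by (simp add: mult.commute)
  qed simp
  also have "\<dots> = hom_part (int (n + m)) (\<Sum>j<d + 1. x j * a j)"
    by (simp only: hom_part_sum mult.commute)
  also have "\<dots> = 0" using x by (simp add: perp_def)
  finally show ?thesis using x by (simp add: hsyz_def HV_iff perp_def hom_part_in_forms)
qed

text \<open>The rank is read off from growth: for large \<open>m\<close> the Hilbert function of a
  basis with \<open>N\<close> elements is \<open>N * (m + 1)\<close> minus the sum of its degrees,
  while \<open>hdim_lower\<close> demands slope at least \<open>d\<close>. Rank \<open>d + 1\<close>
  is excluded because all syzygies annihilate the nonzero tuple \<open>a\<close>. With
  \<open>N = d\<close> the same inequality bounds the degree sum by \<open>n\<close>.\<close>

lemma basis_exists:
  fixes a :: "nat \<Rightarrow> 'k::field poly poly"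
  assumes a: "\<And>j. j \<le> d \<Longrightarrow> a j \<in> forms (int n)" and nz: "\<exists>j\<le>d. a j \<noteq> 0"
  obtains q v where "is_basis d q a v" "(\<Sum>i<d. q i) \<le> n"
proof -
  obtain N q v where v: "\<And>i. i < N \<Longrightarrow> v i \<in> HV (d + 1) (q i)" "\<And>i. i < N \<Longrightarrow> v i \<in> perp (d + 1) {a}"
    and indep: "R_indep (d + 1) N v"
    and gen: "\<And>m x. x \<in> HV (d + 1) m \<Longrightarrow> x \<in> perp (d + 1) {a} \<Longrightarrow>
      \<exists>w\<in>gr N q m. \<forall>j. x j = (\<Sum>i<N. w i * v i j)"
    by (rule graded_basis_exists[of "d + 1" "{a}"], rule that)
  have v': "v i \<in> hsyz d a (q i)" if "i < N" for i using v that by (simp add: hsyz_def)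
  have hd: "hdim d a m = H N q m" for m
    by (rule hdim_eq_H[OF v' indep]) (use gen in \<open>auto simp: hsyz_def\<close>)
  have "N \<noteq> d + 1"
  proof
    assume N: "N = d + 1"
    have "Det (d + 1) v = 0"
      unfolding Det_0_iff using nz v(2) N by (intro exI[of _ a]) (auto simp: perp_def less_Suc_eq_le)
    then show False using indep N unfolding Det_0_iff_rows R_indep_def by blast
  qed
  then have Nd: "N \<le> d" using R_indep_le[OF indep] by simp
  \<comment> \<open>Large enough that no term of \<open>H\<close> is truncated; the summand
    \<open>n\<close> makes a slope below \<open>d\<close> contradictory.\<close>
  define m where "m = (\<Sum>i<N. q i) + n"
  have qm: "q i \<le> m + 1" if "i < N" for i
    using member_le_sum[of i "{..<N}" q] that by (simp add: m_def)
  have "H N q m + (\<Sum>i<N. q i) = (\<Sum>i<N. (m + 1 - q i) + q i)"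
    by (simp add: H_def sum.distrib)
  also have "\<dots> = (\<Sum>i<N. m + 1)" using qm by (intro sum.cong) auto
  finally have H: "H N q m + (\<Sum>i<N. q i) = N * (m + 1)" by simp
  have low: "(d + 1) * (m + 1) \<le> H N q m + n + m + 1"
    using hdim_lower[of d a n m] a hd[of m] by simp
  have "N = d"
  proof (rule ccontr)
    assume "N \<noteq> d"
    then have "(N + 1) * (m + 1) \<le> d * (m + 1)" using Nd by (intro mult_le_mono1) simp
    then show False using low H by (simp add: m_def)
  qed
  moreover have "(\<Sum>i<N. q i) \<le> n" using low H \<open>N = d\<close> by simp
  moreover have "is_basis d q a v"
    unfolding is_basis_def
  proof (intro conjI ballI allI impI)
    show "R_indep (d + 1) d v" using indep \<open>N = d\<close> by simp
    show "v i \<in> hsyz d a (q i)" if "i < d" for i using v' that \<open>N = d\<close> by simp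
    fix x assume x: "x \<in> perp (d + 1) {a}"
    have "\<forall>m. \<exists>w. \<forall>j. hom_part (int m) (x j) = (\<Sum>i<d. w i * v i j)"
      using gen hom_part_perp[OF a x] \<open>N = d\<close> unfolding hsyz_def by (meson IntD1 IntD2)
    then obtain w where w: "\<And>m j. hom_part (int m) (x j) = (\<Sum>i<d. w m i * v i j)" by metis
    have "\<exists>M. \<forall>j. \<forall>M'\<ge>M j. x j = (\<Sum>m<M'. hom_part (int m) (x j))"
      by (intro choice allI hom_part_decomp)
    then obtain M where M: "\<And>j M'. M' \<ge> M j \<Longrightarrow> x j = (\<Sum>m<M'. hom_part (int m) (x j))" by blast
    \<comment> \<open>One truncation bound for all entries of \<open>x\<close>.\<close>
    define L where "L = (\<Sum>j<d + 1. M j)"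
    have "x j = (\<Sum>i<d. (\<Sum>m<L. w m i) * v i j)" for j
    proof -
      have "x j = (\<Sum>m<L. hom_part (int m) (x j))"
      proof (cases "j < d + 1")
        case True
        then have "M j \<le> L" unfolding L_def by (intro member_le_sum) auto
        then show ?thesis by (rule M)
      qed (use x in \<open>auto simp: perp_def\<close>)
      also have "\<dots> = (\<Sum>i<d. (\<Sum>m<L. w m i) * v i j)"
        unfolding w sum_distrib_right by (rule sum.swap)
      finally show ?thesis .
    qed
    then show "\<exists>w. \<forall>j. x j = (\<Sum>i<d. w i * v i j)" by (intro exI allI)
  qed
  ultimately show thesis using that by blast
qed

section \<open>Linear independence and types in terms of bases of syzygies\<close>

lemma R_indepD: "R_indep r N v \<Longrightarrow> (\<And>j. j < r \<Longrightarrow> (\<Sum>i<N. w i * v i j) = 0) \<Longrightarrow> i < N \<Longrightarrow> w i = 0"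
  unfolding R_indep_def by blast

lemma tuples_forms: "a \<in> tuples n d \<Longrightarrow> j \<le> d \<Longrightarrow> a $ j \<in> forms (int n)"
  by (simp add: tuples_def)

lemma hdim_0_iff: "hdim d a m = 0 \<longleftrightarrow> hsyz d a m \<subseteq> {0}"
proof
  assume z: "hdim d a m = 0"
  obtain T where T: "finite T" "hsyz d a m \<subseteq> V.span T"
    using gr_finite_span hsyz_subset by (metis subset_trans)
  show "hsyz d a m \<subseteq> {0}"
  proof (rule ccontr)
    assume "\<not> hsyz d a m \<subseteq> {0}"
    then obtain x where x: "x \<in> hsyz d a m" "x \<noteq> 0" by blast
    then have "card {x} \<le> hdim d a m"
      unfolding hdim_def by (intro V.card_independent_le_dim(2)[OF T]) auto
    then show False using z by simp
  qed
next
  assume "hsyz d a m \<subseteq> {0}"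
  then show "hdim d a m = 0" unfolding hdim_def using V.dim_le_card[of "hsyz d a m" "{}"] by simp
qed

text \<open>A linear relation over k is a syzygy with entries of degree 0. Thus membership in
  \<open>CP\<close> becomes a condition on the same function \<open>hdim\<close> that determines the
  type.\<close>

lemma CP_iff:
  fixes a :: "'k::field poly poly vec"
  assumes a: "a \<in> tuples n d"
  shows "a \<in> CP n d \<longleftrightarrow> hdim d (($) a) 0 = 0"
proof -
  have "a \<in> CP n d \<longleftrightarrow> hsyz d (($) a) 0 \<subseteq> {0}"
  proof
    assume cp: "a \<in> CP n d"
    show "hsyz d (($) a) 0 \<subseteq> {0}"
    proof
      fix x assume x: "x \<in> hsyz d (($) a) 0"
      have "\<forall>j. \<exists>c. x j = [:[:c:]:]"
        using x forms_deg_0 by (metis IntD1 HV_iff hsyz_def linorder_not_less of_nat_0 pCons_0_0)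
      then obtain c where c: "\<And>j. x j = [:[:c j:]:]" by metis
      have "(\<Sum>j<d + 1. x j * a $ j) = 0" using x by (simp add: hsyz_def perp_def)
      then have "(\<Sum>j\<le>d. [:[:c j:]:] * a $ j) = 0" by (simp add: c lessThan_Suc_atMost)
      then have "\<forall>j\<le>d. c j = 0" using cp unfolding CP_def by blast
      then have "x j = 0" for j
        using c[of j] x by (cases "j \<le> d") (auto simp: hsyz_def HV_iff)
      then show "x \<in> {0}" by (auto simp: fun_eq_iff)
    qed
  next
    assume h: "hsyz d (($) a) 0 \<subseteq> {0}"
    have "c j = 0" if c: "(\<Sum>j\<le>d. [:[:c j:]:] * a $ j) = 0" and j: "j \<le> d" for c j
    proof -
      define x where "x j = (if j \<le> d then [:[:c j:]:] else 0)" for j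
      have "(\<Sum>j<d + 1. x j * a $ j) = (\<Sum>j\<le>d. [:[:c j:]:] * a $ j)"
        by (rule sum.cong) (auto simp: x_def)
      then have "x \<in> hsyz d (($) a) 0" using c by (auto simp: hsyz_def HV_iff perp_def x_def forms_const)
      then have "x = 0" using h by auto
      then have "x j = 0" by simp
      then show ?thesis using j by (simp add: x_def)
    qed
    then show "a \<in> CP n d" using a by (simp add: CP_def)
  qed
  then show ?thesis by (simp add: hdim_0_iff)
qed

lemma CP_nonzero:
  assumes "a \<in> CP n d"
  obtains j where "j \<le> d" "a $ j \<noteq> 0"
proof (rule ccontr)
  assume "\<not> thesis"
  then have "a $ j = 0" if "j \<le> d" for j using that \<open>\<And>j. j \<le> d \<Longrightarrow> a $ j \<noteq> 0 \<Longrightarrow> thesis\<close> by blast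
  then have "(\<Sum>j\<le>d. [:[:1:]:] * a $ j) = 0" by (intro sum.neutral) auto
  moreover have "(\<Sum>j\<le>d. [:[:c j:]:] * a $ j) = 0 \<longrightarrow> (\<forall>j\<le>d. c j = 0)" for c
    using assms by (simp add: CP_def)
  from this[of "\<lambda>_. 1"] calculation show False by auto
qed

lemma scalar_prod_sum: "a \<in> carrier_vec (d + 1) \<Longrightarrow> v \<bullet> a = (\<Sum>j<d + 1. v $ j * a $ j)"
  by (simp add: scalar_prod_def atLeast0LessThan)

text \<open>The basis consists of the images of the unit vectors; injectivity of the graded map
  gives independence, exactness in the middle gives generation.\<close>

lemma has_mu_type_basis:
  fixes a :: "'k::field poly poly vec"
  assumes a: "a \<in> carrier_vec (d + 1)" and t: "has_mu_type n d mu a"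
  obtains v where "is_basis d ((!) mu) (($) a) v"
proof -
  obtain \<phi> where hom: "graded_hom d (\<lambda>i. - int n - int (mu ! i)) (d + 1) (\<lambda>j. - int n) \<phi>"
    and inj: "inj_on \<phi> (carrier_vec d)"
    and im: "\<phi> ` carrier_vec d = {v \<in> carrier_vec (d + 1). v \<bullet> a = 0}"
    using t unfolding has_mu_type_def by blast
  have carr: "\<phi> w \<in> carrier_vec (d + 1)" if "w \<in> carrier_vec d" for w
    using hom that by (auto simp: graded_hom_def)
  have add: "\<phi> (v + w) = \<phi> v + \<phi> w" if "v \<in> carrier_vec d" "w \<in> carrier_vec d" for v w
    using hom that by (auto simp: graded_hom_def)
  have smul: "\<phi> (c \<cdot>\<^sub>v v) = c \<cdot>\<^sub>v \<phi> v" if "v \<in> carrier_vec d" for c v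
    using hom that by (auto simp: graded_hom_def)
  define v where "v i j = (if j < d + 1 then \<phi> (unit_vec d i) $ j else 0)" for i j
  \<comment> \<open>Additivity is given for two summands, so coordinates are switched on one at a
    time.\<close>
  have expand: "\<phi> (vec d (\<lambda>i. if i < k then w i else 0)) $ j = (\<Sum>i<k. w i * v i j)"
    if "k \<le> d" "j < d + 1" for k j w
    using that(1)
  proof (induction k)
    case 0
    have "vec d (\<lambda>i. if i < 0 then w i else 0) = 0 \<cdot>\<^sub>v 0\<^sub>v d" by auto
    then show ?case using smul[of "0\<^sub>v d" 0] carr[of "0\<^sub>v d"] that(2) by simp
  next
    case (Suc k)
    have "vec d (\<lambda>i. if i < Suc k then w i else 0)
        = vec d (\<lambda>i. if i < k then w i else 0) + w k \<cdot>\<^sub>v unit_vec d k"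
      using Suc.prems by (intro eq_vecI) (auto simp: less_Suc_eq)
    then have "\<phi> (vec d (\<lambda>i. if i < Suc k then w i else 0)) $ j
        = \<phi> (vec d (\<lambda>i. if i < k then w i else 0)) $ j + w k * \<phi> (unit_vec d k) $ j"
      using add[of "vec d (\<lambda>i. if i < k then w i else 0)" "w k \<cdot>\<^sub>v unit_vec d k"]
        smul[of "unit_vec d k"] carr[of "unit_vec d k"] carr[of "vec d (\<lambda>i. if i < k then w i else 0)"] that(2)
      by simp
    then show ?case using Suc that(2) by (simp add: v_def)
  qed
  have phi: "\<phi> (vec d w) $ j = (\<Sum>i<d. w i * v i j)" if "j < d + 1" for w j
  proof -
    have "vec d w = vec d (\<lambda>i. if i < d then w i else 0)" by auto
    then show ?thesis using expand[of d j w] that by simp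
  qed
  have "is_basis d ((!) mu) (($) a) v"
    unfolding is_basis_def
  proof (intro conjI allI impI ballI)
    fix i assume i: "i < d"
    \<comment> \<open>The generator number \<open>i\<close> sits in degree
      \<open>n + mu ! i\<close>; the twist by \<open>n\<close> on the target leaves entries of
      degree \<open>mu ! i\<close>.\<close>
    have "(unit_vec d i :: 'k poly poly vec) \<in> free_component d (\<lambda>i. - int n - int (mu ! i)) (int n + int (mu ! i))"
      using i by (auto simp: free_component_def unit_vec_def forms_1)
    then have "\<phi> (unit_vec d i) \<in> free_component (d + 1) (\<lambda>j. - int n) (int n + int (mu ! i))"
      using hom unfolding graded_hom_def by blast
    then have "v i \<in> HV (d + 1) (mu ! i)"
      by (auto simp: free_component_def HV_iff v_def)
    moreover have "\<phi> (unit_vec d i) \<in> \<phi> ` carrier_vec d" by simp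
    then have "\<phi> (unit_vec d i) \<bullet> a = 0" unfolding im by simp
    then have "v i \<in> perp (d + 1) {($) a}"
      by (simp add: scalar_prod_sum[OF a] perp_def v_def)
    ultimately show "v i \<in> hsyz d (($) a) (mu ! i)" by (simp add: hsyz_def)
  next
    show "R_indep (d + 1) d v"
      unfolding R_indep_def
    proof (intro allI impI)
      fix w i assume w: "\<forall>j<d + 1. (\<Sum>i<d. w i * v i j) = 0" and i: "i < d"
      have z: "\<phi> (0\<^sub>v d) = 0\<^sub>v (d + 1)"
        using phi[of _ "\<lambda>_. 0"] carr[of "0\<^sub>v d"] by (intro eq_vecI) (auto simp: zero_vec_def)
      have "\<phi> (vec d w) = \<phi> (0\<^sub>v d)"
        unfolding z using carr[of "vec d w"] phi[of _ w] w by (intro eq_vecI) auto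
      then have "vec d w = 0\<^sub>v d" by (rule inj_onD[OF inj]) auto
      then show "w i = 0" using i by (metis index_vec index_zero_vec(1))
    qed
  next
    fix x assume x: "x \<in> perp (d + 1) {($) a}"
    have "vec (d + 1) x \<bullet> a = 0" using x by (simp add: scalar_prod_sum[OF a] perp_def)
    then have "vec (d + 1) x \<in> \<phi> ` carrier_vec d" unfolding im by simp
    then obtain w where w: "w \<in> carrier_vec d" "\<phi> w = vec (d + 1) x" by auto
    have "w = vec d (($) w)" using w(1) by auto
    then have "x j = (\<Sum>i<d. w $ i * v i j)" if "j < d + 1" for j
      using phi[OF that, of "($) w"] w(2) that by simp
    moreover have "x j = (\<Sum>i<d. w $ i * v i j)" if "\<not> j < d + 1" for j
      using x that by (simp add: perp_def v_def)
    ultimately show "\<exists>w. \<forall>j. x j = (\<Sum>i<d. w i * v i j)" by blast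
  qed
  then show thesis by (rule that)
qed

text \<open>Provides the last clause of \<open>has_mu_type\<close>, that the second map has the
  ideal as its image.\<close>

lemma ideal_eq_image:
  fixes a :: "'a::comm_ring_1 vec"
  assumes a: "a \<in> carrier_vec N"
  shows "(\<lambda>v. v \<bullet> a) ` carrier_vec N = module.span (*) (set\<^sub>v a)"
proof -
  interpret M: Modules.module "(*) :: 'a \<Rightarrow> 'a \<Rightarrow> 'a" by unfold_locales (auto simp: algebra_simps)
  have sp: "v \<bullet> a = (\<Sum>j<N. v $ j * a $ j)" for v
    using a by (simp add: scalar_prod_def atLeast0LessThan)
  show ?thesis
  proof
    show "(\<lambda>v. v \<bullet> a) ` carrier_vec N \<subseteq> M.span (set\<^sub>v a)"
    proof clarify
      fix v :: "'a vec"
      have "a $ j \<in> set\<^sub>v a" if "j < N" for j using a that by (auto simp: vec_set_def)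
      then show "v \<bullet> a \<in> M.span (set\<^sub>v a)" unfolding sp
        by (intro M.span_sum M.span_scale M.span_base) auto
    qed
    show "M.span (set\<^sub>v a) \<subseteq> (\<lambda>v. v \<bullet> a) ` carrier_vec N"
    proof (rule M.span_minimal)
      show "set\<^sub>v a \<subseteq> (\<lambda>v. v \<bullet> a) ` carrier_vec N"
      proof
        fix p assume "p \<in> set\<^sub>v a"
        then obtain j where j: "j < N" "p = a $ j" using a by (auto simp: vec_set_def)
        then have "p = unit_vec N j \<bullet> a" using a by (simp add: scalar_prod_left_unit)
        then show "p \<in> (\<lambda>v. v \<bullet> a) ` carrier_vec N" by auto
      qed
      show "M.subspace ((\<lambda>v. v \<bullet> a) ` carrier_vec N)"
        unfolding M.subspace_def
      proof (intro conjI ballI allI)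
        show "0 \<in> (\<lambda>v. v \<bullet> a) ` carrier_vec N"
          using a by (intro image_eqI[of _ _ "0\<^sub>v N"]) auto
        fix x y assume "x \<in> (\<lambda>v. v \<bullet> a) ` carrier_vec N"
        then obtain v where v: "v \<in> carrier_vec N" "x = v \<bullet> a" by blast
        show "c * x \<in> (\<lambda>v. v \<bullet> a) ` carrier_vec N" for c
          using v a by (intro image_eqI[of _ _ "c \<cdot>\<^sub>v v"]) auto
        assume "y \<in> (\<lambda>v. v \<bullet> a) ` carrier_vec N"
        then obtain w where w: "w \<in> carrier_vec N" "y = w \<bullet> a" by blast
        show "x + y \<in> (\<lambda>v. v \<bullet> a) ` carrier_vec N"
          using v w a by (intro image_eqI[of _ _ "v + w"]) (auto simp: add_scalar_prod_distrib[of _ N])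
      qed
    qed
  qed
qed

lemma basis_has_mu_type:
  fixes a :: "'k::field poly poly vec"
  assumes a: "a \<in> carrier_vec (d + 1)" and part: "is_partition d mu"
    and b: "is_basis d ((!) mu) (($) a) v"
  shows "has_mu_type n d mu a"
proof -
  have v: "v i \<in> hsyz d (($) a) (mu ! i)" if "i < d" for i using b that by (simp add: is_basis_def)
  have indep: "R_indep (d + 1) d v" using b by (simp add: is_basis_def)
  define \<phi> where "\<phi> w = vec (d + 1) (\<lambda>j. \<Sum>i<d. w $ i * v i j)" for w
  have "graded_hom d (\<lambda>i. - int n - int (mu ! i)) (d + 1) (\<lambda>j. - int n) \<phi>"
    unfolding graded_hom_def
  proof (intro conjI ballI allI)
    show "\<phi> \<in> carrier_vec d \<rightarrow> carrier_vec (d + 1)" by (auto simp: \<phi>_def)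
    show "\<phi> (x + y) = \<phi> x + \<phi> y" if "x \<in> carrier_vec d" "y \<in> carrier_vec d" for x y
      using that by (intro eq_vecI) (auto simp: \<phi>_def distrib_right sum.distrib)
    show "\<phi> (c \<cdot>\<^sub>v x) = c \<cdot>\<^sub>v \<phi> x" if "x \<in> carrier_vec d" for c x
      using that by (intro eq_vecI) (auto simp: \<phi>_def distrib_left sum_distrib_left mult.assoc)
    show "\<phi> ` free_component d (\<lambda>i. - int n - int (mu ! i)) m \<subseteq> free_component (d + 1) (\<lambda>j. - int n) m" for m
    proof clarify
      fix w :: "'k poly poly vec" assume w: "w \<in> free_component d (\<lambda>i. - int n - int (mu ! i)) m"
      have "w $ i * v i j \<in> forms (m + - int n)" if "i < d" "j < d + 1" for i j
      proof -
        have "w $ i \<in> forms (m + (- int n - int (mu ! i)))" using w that by (auto simp: free_component_def)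
        moreover have "v i j \<in> forms (int (mu ! i))" using v[OF that(1)] that(2) by (simp add: hsyz_def HV_iff)
        ultimately show ?thesis using forms_mult by fastforce
      qed
      then show "\<phi> w \<in> free_component (d + 1) (\<lambda>j. - int n) m"
        unfolding free_component_def \<phi>_def by (auto intro!: forms_sum simp del: sum.lessThan_Suc)
    qed
  qed
  moreover have "inj_on \<phi> (carrier_vec d)"
  proof (rule inj_onI)
    fix x y assume xy: "x \<in> carrier_vec d" "y \<in> carrier_vec d" "\<phi> x = \<phi> y"
    have "(\<Sum>i<d. (x $ i - y $ i) * v i j) = 0" if "j < d + 1" for j
      using arg_cong[OF xy(3), of "\<lambda>u. u $ j"] that by (simp add: \<phi>_def left_diff_distrib sum_subtractf)
    then have "x $ i - y $ i = 0" if "i < d" for i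
      by (rule R_indepD[OF indep, where w = "\<lambda>i. x $ i - y $ i"]) (use that in auto)
    then show "x = y" using xy by (intro eq_vecI) auto
  qed
  moreover have "\<phi> ` carrier_vec d = {v \<in> carrier_vec (d + 1). v \<bullet> a = 0}"
  proof (intro equalityI subsetI)
    fix x assume "x \<in> \<phi> ` carrier_vec d"
    then obtain w where w: "w \<in> carrier_vec d" "x = \<phi> w" by blast
    have "(\<lambda>j. \<Sum>i<d. w $ i * v i j) \<in> perp (d + 1) {($) a}"
      by (rule perp_sum, rule perp_mult) (use v in \<open>auto simp: hsyz_def\<close>)
    then show "x \<in> {v \<in> carrier_vec (d + 1). v \<bullet> a = 0}"
      unfolding w(2) by (simp add: \<phi>_def scalar_prod_sum[OF a] perp_def)
  next
    fix x assume "x \<in> {v \<in> carrier_vec (d + 1). v \<bullet> a = 0}"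
    then have x: "x \<in> carrier_vec (d + 1)" "(\<Sum>j<d + 1. x $ j * a $ j) = 0"
      by (auto simp: scalar_prod_sum[OF a])
    define y where "y j = (if j < d + 1 then x $ j else 0)" for j
    have "y \<in> perp (d + 1) {($) a}" using x(2) by (simp add: perp_def y_def)
    then obtain w where w: "\<And>j. y j = (\<Sum>i<d. w i * v i j)"
      using b unfolding is_basis_def by blast
    have "x = \<phi> (vec d w)"
      using x(1) by (intro eq_vecI) (auto simp: \<phi>_def w[symmetric] y_def)
    then show "x \<in> \<phi> ` carrier_vec d" by auto
  qed
  ultimately show ?thesis using part ideal_eq_image[OF a] unfolding has_mu_type_def by blast
qed

text \<open>Linear independence excludes syzygies of degree 0, so all degrees of a basis are at
  least 1, and sorting them produces a partition.\<close>

lemma type_exists: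
  fixes a :: "'k::field poly poly vec"
  assumes a: "a \<in> CP n d"
  obtains mu where "is_partition d mu" "d \<le> sum_list mu" "sum_list mu \<le> n" "has_mu_type n d mu a"
proof -
  have at: "a \<in> tuples n d" and ac: "a \<in> carrier_vec (d + 1)" using a by (auto simp: CP_def tuples_def)
  have "\<exists>j\<le>d. a $ j \<noteq> 0" using CP_nonzero[OF a] by blast
  then obtain q v where qv: "is_basis d q (($) a) v" "(\<Sum>i<d. q i) \<le> n"
    using basis_exists[of d "($) a" n] tuples_forms[OF at] by blast
  have h0: "hdim d (($) a) 0 = 0" using a CP_iff[OF at] by simp
  then have "H d q 0 = 0" using is_basis_hdim[OF qv(1)] by simp
  then have q1: "1 \<le> q i" if "i < d" for i using that by (auto simp: H_def)
  define xs where "xs = sort_key q [0..<d]"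
  have xs: "length xs = d" "set xs = {..<d}" "distinct xs" "sorted (map q xs)"
    by (auto simp: xs_def)
  have bij: "bij_betw ((!) xs) {..<d} {..<d}"
    by (rule bij_betw_nth[OF xs(3)]) (simp_all only: xs(1,2))
  define mu where "mu = map q xs"
  have part: "is_partition d mu" using xs q1 by (auto simp: is_partition_def mu_def)
  have "sum_list mu = (\<Sum>i<d. q (xs ! i))"
    by (simp add: mu_def sum_list_sum_nth xs(1) atLeast0LessThan)
  also have "\<dots> = (\<Sum>i<d. q i)" by (rule sum.reindex_bij_betw[OF bij])
  finally have sum: "sum_list mu = (\<Sum>i<d. q i)" .
  have "(\<Sum>i<d. 1) \<le> (\<Sum>i<d. q i)" using q1 by (intro sum_mono) auto
  then have "d \<le> sum_list mu" using sum by simp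
  moreover have "is_basis d ((!) mu) (($) a) (v \<circ> (!) xs)"
  proof -
    have "(q \<circ> (!) xs) i = mu ! i" if "i < d" for i using that by (simp add: mu_def xs(1))
    then show ?thesis using is_basis_perm[OF qv(1) bij] unfolding is_basis_def by simp
  qed
  ultimately show thesis using that[of mu] part sum qv(2) basis_has_mu_type[OF ac part] by simp
qed

section \<open>Semicontinuity\<close>

text \<open>Working with the function instead of the polynomial lets determinants be treated by
  closure properties, without writing the polynomial down.\<close>

definition poly_fun :: "nat \<Rightarrow> nat \<Rightarrow> ('k::field poly poly vec \<Rightarrow> 'k) \<Rightarrow> bool" where
  "poly_fun n d g \<longleftrightarrow> (\<exists>f\<in>coord_polys n d. \<forall>b\<in>tuples n d. mpoly_eval (coords n b) f = g b)"

lemma Det_nonzeroD: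
  fixes A :: "nat \<Rightarrow> nat \<Rightarrow> 'a::idom"
  assumes "Det N A \<noteq> 0" "\<And>i. i < N \<Longrightarrow> (\<Sum>j<N. A i j * x j) = 0" "j < N"
  shows "x j = 0"
proof (rule ccontr)
  assume "x j \<noteq> 0"
  then have "Det N A = 0" unfolding Det_0_iff using assms(2,3) by (intro exI[of _ x]) auto
  then show False using assms(1) by simp
qed

lemma poly_fun_cong:
  "poly_fun n d g \<Longrightarrow> (\<And>b. b \<in> tuples n d \<Longrightarrow> g b = h b) \<Longrightarrow> poly_fun n d h"
  unfolding poly_fun_def by simp

lemma poly_fun_const: "poly_fun n d (\<lambda>b. c)"
  unfolding poly_fun_def
  by (intro bexI[of _ "Poly_Mapping.single 0 c"])
    (auto simp: mpoly_eval_single monom_eval_def coord_polys_def)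

lemma poly_fun_coord:
  assumes "j \<le> d" "i \<le> n"
  shows "poly_fun n d (\<lambda>b. coords n b (j, i))"
  unfolding poly_fun_def
  by (intro bexI[of _ "Poly_Mapping.single (Poly_Mapping.single (j, i) 1) 1"])
    (use assms in \<open>auto simp: mpoly_eval_single monom_eval_def coord_polys_def\<close>)

lemma coord_polys_add:
  "f \<in> coord_polys n d \<Longrightarrow> g \<in> coord_polys n d \<Longrightarrow> f + g \<in> coord_polys n d"
  unfolding coord_polys_def using keys_add[of f g] by blast

lemma poly_fun_add:
  assumes "poly_fun n d g" "poly_fun n d h"
  shows "poly_fun n d (\<lambda>b. g b + h b)"
proof -
  obtain f f' where "f \<in> coord_polys n d" "\<forall>b\<in>tuples n d. mpoly_eval (coords n b) f = g b"
    "f' \<in> coord_polys n d" "\<forall>b\<in>tuples n d. mpoly_eval (coords n b) f' = h b"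
    using assms unfolding poly_fun_def by blast
  then show ?thesis unfolding poly_fun_def
    by (intro bexI[of _ "f + f'"]) (auto simp: mpoly_eval_add coord_polys_add)
qed

lemma poly_fun_mult:
  assumes "poly_fun n d g" "poly_fun n d h"
  shows "poly_fun n d (\<lambda>b. g b * h b)"
proof -
  obtain f f' where "f \<in> coord_polys n d" "\<forall>b\<in>tuples n d. mpoly_eval (coords n b) f = g b"
    "f' \<in> coord_polys n d" "\<forall>b\<in>tuples n d. mpoly_eval (coords n b) f' = h b"
    using assms unfolding poly_fun_def by blast
  then show ?thesis unfolding poly_fun_def
    by (intro bexI[of _ "f * f'"]) (auto simp: mpoly_eval_mult coord_polys_mult)
qed

lemma poly_fun_sum: "(\<And>x. x \<in> A \<Longrightarrow> poly_fun n d (g x)) \<Longrightarrow> poly_fun n d (\<lambda>b. \<Sum>x\<in>A. g x b)"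
  by (induction A rule: infinite_finite_induct) (auto intro: poly_fun_const poly_fun_add)

lemma poly_fun_prod: "(\<And>x. x \<in> A \<Longrightarrow> poly_fun n d (g x)) \<Longrightarrow> poly_fun n d (\<lambda>b. \<Prod>x\<in>A. g x b)"
  by (induction A rule: infinite_finite_induct) (auto intro: poly_fun_const poly_fun_mult)

lemma poly_fun_Det:
  assumes "\<And>i j. i < N \<Longrightarrow> j < N \<Longrightarrow> poly_fun n d (\<lambda>b. A b i j)"
  shows "poly_fun n d (\<lambda>b. Det N (A b))"
  unfolding Det_Leibniz
proof (intro poly_fun_sum poly_fun_mult poly_fun_const poly_fun_prod assms)
  fix p i assume "p \<in> {p. p permutes {0..<N}}" "i \<in> {0..<N}"
  then show "i < N" "p i < N" using permutes_in_image[of p "{0..<N}" i] by auto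
qed

text \<open>For fixed \<open>x\<close> the product is linear in the coefficients of
  \<open>b\<close>, so a linear functional of it is a linear form in the coordinates.\<close>

lemma poly_fun_linear_mulmap:
  fixes l :: "'k::field poly poly \<Rightarrow> 'k"
  assumes l: "Vector_Spaces.linear (\<lambda>c. smult [:c:]) (*) l"
  shows "poly_fun n d (\<lambda>b. l (mulmap d (($) b) x))"
proof -
  have "poly_fun n d (\<lambda>b. \<Sum>j<d + 1. \<Sum>i\<le>n. coords n b (j, i) * l (x j * monom (monom 1 (n - i)) i))"
    by (intro poly_fun_sum poly_fun_mult poly_fun_const poly_fun_coord) auto
  moreover have "(\<Sum>j<d + 1. \<Sum>i\<le>n. coords n b (j, i) * l (x j * monom (monom 1 (n - i)) i))
      = l (mulmap d (($) b) x)" if "b \<in> tuples n d" for b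
  proof -
    have "x j * b $ j = (\<Sum>i\<le>n. smult [:coords n b (j, i):] (x j * monom (monom 1 (n - i)) i))"
      if "j < d + 1" for j
    proof -
      have "b $ j = (\<Sum>i\<le>n. monom (monom (coords n b (j, i)) (n - i)) i)"
        using forms_expand[of "b $ j" n] tuples_forms[OF \<open>b \<in> tuples n d\<close>, of j] that
        by (simp add: coords_def)
      also have "\<dots> = (\<Sum>i\<le>n. smult [:coords n b (j, i):] (monom (monom 1 (n - i)) i))"
        by (simp add: smult_monom)
      finally show ?thesis by (simp only: sum_distrib_left mult_smult_right)
    qed
    then have "l (mulmap d (($) b) x)
        = l (\<Sum>j<d + 1. \<Sum>i\<le>n. smult [:coords n b (j, i):] (x j * monom (monom 1 (n - i)) i))"
      unfolding mulmap_def by (intro arg_cong[of _ _ l] sum.cong) auto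
    also have "\<dots> = (\<Sum>j<d + 1. \<Sum>i\<le>n. coords n b (j, i) * l (x j * monom (monom 1 (n - i)) i))"
      by (simp only: RK.linear_sum[OF l] RK.linear_scale[OF l])
    finally show ?thesis by simp
  qed
  ultimately show ?thesis by (rule poly_fun_cong)
qed

text \<open>Semicontinuity: on a complement of the kernel at \<open>a\<close> the multiplication map at \<open>a\<close> has a left
  inverse; the determinant of the composition with the multiplication map at \<open>b\<close> is the
  polynomial in \<open>b\<close> sought for.\<close>

lemma hdim_open:
  fixes a :: "'k::field poly poly vec"
  shows "\<exists>f\<in>coord_polys n d. (a \<in> tuples n d \<longrightarrow> mpoly_eval (coords n a) f \<noteq> 0) \<and>
    (\<forall>b\<in>tuples n d. mpoly_eval (coords n b) f \<noteq> 0 \<longrightarrow> hdim d (($) b) m \<le> hdim d (($) a) m)"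
proof -
  obtain T :: "(nat \<Rightarrow> 'k poly poly) set" where T: "finite T" "HV (d + 1) m \<subseteq> V.span T"
    using gr_finite_span by blast
  let ?M = "\<lambda>b::'k poly poly vec. mulmap d (($) b)"
  obtain W where W: "W \<subseteq> HV (d + 1) m" "finite W" "inj_on (?M a) W" "R.independent (?M a ` W)"
    "card W + V.dim {x \<in> HV (d + 1) m. ?M a x = 0} = V.dim (HV (d + 1) m :: (nat \<Rightarrow> 'k poly poly) set)"
    by (rule VR.kernel_complement[OF mulmap_linear gr_subspace T])
  have "\<exists>l. Vector_Spaces.linear (\<lambda>c. smult [:c:]) (*) l \<and> (\<forall>x\<in>?M a ` W. l x = (if x = ?M a w then 1 else 0))" for w
    by (rule RK.linear_independent_extend[OF W(4)])
  then have "\<exists>l. \<forall>w. Vector_Spaces.linear (\<lambda>c. smult [:c:]) (*) (l w) \<and>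
      (\<forall>x\<in>?M a ` W. l w x = (if x = ?M a w then 1 else 0))"
    by (intro choice allI)
  then obtain l where l: "\<And>w. Vector_Spaces.linear (\<lambda>c. smult [:c:]) (*) (l w)"
    "\<And>w x. x \<in> W \<Longrightarrow> l w (?M a x) = (if ?M a x = ?M a w then 1 else 0)"
    by blast
  define N where "N = card W"
  obtain h where h: "bij_betw h {..<N} W"
    using ex_bij_betw_nat_finite[OF W(2)] unfolding N_def atLeast0LessThan by blast
  have hW: "h i \<in> W" if "i < N" for i using h that by (auto simp: bij_betw_def)
  define A where "A b i j = l (h i) (?M b (h j))" for b i j
  have "poly_fun n d (\<lambda>b. Det N (A b))"
    unfolding A_def by (intro poly_fun_Det poly_fun_linear_mulmap l(1))
  then obtain f where f: "f \<in> coord_polys n d" "\<And>b. b \<in> tuples n d \<Longrightarrow> mpoly_eval (coords n b) f = Det N (A b)"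
    unfolding poly_fun_def by blast
  \<comment> \<open>At \<open>a\<close> the functionals are dual to the images of \<open>W\<close>,
    so the matrix is the identity.\<close>
  have "A a i j = (if i = j then 1 else 0)" if "i < N" "j < N" for i j
  proof -
    have "?M a (h j) = ?M a (h i) \<longleftrightarrow> i = j"
      using inj_on_eq_iff[OF W(3) hW[OF that(2)] hW[OF that(1)]] h that
      by (auto simp: bij_betw_def inj_on_eq_iff)
    then show ?thesis using l(2)[OF hW[OF that(2)]] by (simp add: A_def)
  qed
  then have "Det N (A a) = det (1\<^sub>m N)"
    unfolding Det_def by (intro arg_cong[of _ _ det]) auto
  then have "Det N (A a) \<noteq> 0" by simp
  \<comment> \<open>A nonzero determinant keeps the images of \<open>W\<close> independent at
    \<open>b\<close>, so the kernel at \<open>b\<close> has codimension at least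
    \<open>card W\<close>, its codimension at \<open>a\<close>.\<close>
  moreover have "hdim d (($) b) m \<le> hdim d (($) a) m" if "Det N (A b) \<noteq> 0" for b
  proof -
    have "card W + V.dim {x \<in> HV (d + 1) m. ?M b x = 0} \<le> V.dim (HV (d + 1) m :: (nat \<Rightarrow> 'k poly poly) set)"
    proof (rule VR.kernel_dim_bound[OF mulmap_linear gr_subspace T W(1,2)])
      fix c assume c: "(\<Sum>w\<in>W. smult [:c w:] (?M b w)) = 0"
      have "(\<Sum>j<N. A b i j * c (h j)) = 0" for i
      proof -
        have "(\<Sum>j<N. A b i j * c (h j)) = (\<Sum>w\<in>W. c w * l (h i) (?M b w))"
          unfolding sum.reindex_bij_betw[OF h, symmetric] A_def by (simp add: mult.commute)
        also have "\<dots> = l (h i) (\<Sum>w\<in>W. smult [:c w:] (?M b w))"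
          by (simp only: RK.linear_sum[OF l(1)] RK.linear_scale[OF l(1)])
        also have "\<dots> = 0" unfolding c by (rule RK.linear_0[OF l(1)])
        finally show ?thesis .
      qed
      then have "c (h j) = 0" if "j < N" for j
        using Det_nonzeroD[OF \<open>Det N (A b) \<noteq> 0\<close>, of "\<lambda>j. c (h j)"] that by blast
      then show "\<forall>w\<in>W. c w = 0" using h by (auto simp: bij_betw_def)
    qed
    then show ?thesis using W(5) unfolding hdim_def hsyz_eq_kernel by linarith
  qed
  ultimately show ?thesis using f by (intro bexI[of _ f]) auto
qed

text \<open>The closure in the whole affine space rather than in \<open>CP\<close>, since it is also
  applied to sets \<open>Z\<close>, which contain the zero tuple. In this form membership can be
  tested along curves.\<close>

definition vcl :: "nat \<Rightarrow> nat \<Rightarrow> 'k::field poly poly vec set \<Rightarrow> 'k poly poly vec set" where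
  "vcl n d A = {x \<in> tuples n d. \<forall>f\<in>coord_polys n d.
     (\<forall>a\<in>A. mpoly_eval (coords n a) f = 0) \<longrightarrow> mpoly_eval (coords n x) f = 0}"

lemma zariski_closure_of:
  assumes "A \<subseteq> tuples n d"
  shows "zariski n d closure_of A = vcl n d A"
proof (rule closure_of_unique)
  show "A \<subseteq> vcl n d A" using assms by (auto simp: vcl_def)
  show "closedin (zariski n d) (vcl n d A)"
    unfolding closedin_zariski
    by (intro exI[of _ "{f \<in> coord_polys n d. \<forall>a\<in>A. mpoly_eval (coords n a) f = 0}"])
      (auto simp: vcl_def zero_locus_def)
  fix C assume C: "A \<subseteq> C" "closedin (zariski n d) C"
  then obtain F where "F \<subseteq> coord_polys n d" "C = zero_locus n d F"
    unfolding closedin_zariski by blast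
  moreover from this have "mpoly_eval (coords n a) f = 0" if "f \<in> F" "a \<in> A" for f a
    using C(1) that by (auto simp: zero_locus_def)
  ultimately show "vcl n d A \<subseteq> C" unfolding vcl_def zero_locus_def by blast
qed

lemma closure_of_CP:
  assumes "A \<subseteq> CP n d"
  shows "subtopology (zariski n d) (CP n d) closure_of A = CP n d \<inter> vcl n d A"
proof -
  have "A \<subseteq> tuples n d" using assms by (auto simp: CP_def)
  then show ?thesis using assms
    by (simp add: closure_of_subtopology zariski_closure_of Int_absorb1)
qed

text \<open>The Legendre transform: the sum of \<open>c - q i\<close> over the first
  \<open>k + 1\<close> indices is at most \<open>H d q (c - 1)\<close>, and for monotone
  \<open>q'\<close> with \<open>c = q' k\<close> this is an equality. Hence a smaller Hilbert
  function means larger partial sums.\<close>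

lemma partial_sum_le:
  fixes q q' :: "nat \<Rightarrow> nat"
  assumes mono: "\<And>i j. i \<le> j \<Longrightarrow> j < d \<Longrightarrow> q' i \<le> q' j" and pos: "1 \<le> q' k" and k: "k < d"
    and H: "H d q (q' k - 1) \<le> H d q' (q' k - 1)"
  shows "(\<Sum>i<Suc k. q' i) \<le> (\<Sum>i<Suc k. q i)"
proof -
  let ?c = "q' k"
  have "H d q' (?c - 1) = (\<Sum>i<Suc k. ?c - q' i)"
    unfolding H_def using k pos mono by (intro sum.mono_neutral_cong_right) auto
  then have "(\<Sum>i<Suc k. q' i) + H d q' (?c - 1) = (\<Sum>i<Suc k. q' i + (?c - q' i))"
    by (simp add: sum.distrib)
  also have "\<dots> = (\<Sum>i<Suc k. ?c)" using mono k by (intro sum.cong) auto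
  also have "\<dots> \<le> (\<Sum>i<Suc k. q i + (?c - q i))" by (intro sum_mono) auto
  also have "\<dots> = (\<Sum>i<Suc k. q i) + (\<Sum>i<Suc k. ?c - q i)" by (simp add: sum.distrib)
  also have "(\<Sum>i<Suc k. ?c - q i) \<le> H d q (?c - 1)"
    unfolding H_def using k pos by (intro order.trans[OF _ sum_mono2[of "{..<d}" "{..<Suc k}"]]) auto
  finally show ?thesis using H by linarith
qed

text \<open>Only the degrees \<open>mu' ! k - 1\<close> are consulted, and they lie below
  \<open>n\<close>; finitely many semicontinuity conditions therefore suffice to fix a type.\<close>

lemma partition_leI:
  assumes "is_partition d mu" "is_partition d mu'" "sum_list mu' \<le> n"
    and H: "\<And>m. m < n \<Longrightarrow> H d ((!) mu) m \<le> H d ((!) mu') m"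
  shows "partition_le d mu' mu"
  unfolding partition_le_def
proof
  fix i assume i: "i \<in> {1..d}"
  then obtain k where k: "i = Suc k" "k < d" by (cases i) auto
  have len: "length mu = d" "length mu' = d" using assms by (auto simp: is_partition_def)
  have pos: "1 \<le> mu' ! k" using assms(2) k len by (auto simp: is_partition_def)
  have "mu' ! k \<le> sum_list mu'" using k len by (intro member_le_sum_list) auto
  then have "mu' ! k - 1 < n" using pos assms(3) by linarith
  then have "(\<Sum>i<Suc k. mu' ! i) \<le> (\<Sum>i<Suc k. mu ! i)"
    using assms(2) pos k len
    by (intro partial_sum_le[where d = d] H) (auto simp: is_partition_def sorted_iff_nth_mono)
  moreover have "sum_list (take i xs) = (\<Sum>i<Suc k. xs ! i)" if "length xs = d" for xs :: "nat list"
    using that k by (simp add: sum_list_sum_nth atLeast0LessThan min_absorb2 Suc_leI del: sum.lessThan_Suc)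
  ultimately show "sum_list (take i mu') \<le> sum_list (take i mu)" using len by simp
qed

lemma P_type_hdim: "a \<in> P_type n d mu \<Longrightarrow> hdim d (($) a) m = H d ((!) mu) m"
  using has_mu_type_basis is_basis_hdim unfolding P_type_def CP_def tuples_def
  by (metis (no_types, lifting) mem_Collect_eq)

lemma closure_subset:
  fixes mu :: "nat list"
  assumes mu: "is_partition d mu" and x: "x \<in> CP n d" "x \<in> vcl n d (P_type n d mu :: 'k::field poly poly vec set)"
  obtains mu' where "is_partition d mu'" "d \<le> sum_list mu'" "sum_list mu' \<le> n"
    "partition_le d mu' mu" "x \<in> P_type n d mu'"
proof -
  obtain mu' where mu': "is_partition d mu'" "d \<le> sum_list mu'" "sum_list mu' \<le> n" "has_mu_type n d mu' x"
    using type_exists[OF x(1)] by metis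
  have xP: "x \<in> P_type n d mu'" using x mu'(4) by (simp add: P_type_def)
  have xt: "x \<in> tuples n d" using x(1) by (simp add: CP_def)
  have "partition_le d mu' mu"
  proof (rule partition_leI[OF mu mu'(1,3)], rule ccontr)
    fix m assume "\<not> H d ((!) mu) m \<le> H d ((!) mu') m"
    then have less: "hdim d (($) x) m < H d ((!) mu) m" using P_type_hdim[OF xP] by simp
    \<comment> \<open>In degree \<open>m\<close> the point \<open>x\<close> has fewer syzygies than
      every tuple of type \<open>mu\<close>, so the polynomial witnessing semicontinuity at
      \<open>x\<close> vanishes on that set but not at \<open>x\<close>.\<close>
    obtain f where f: "f \<in> coord_polys n d" "mpoly_eval (coords n x) f \<noteq> 0"
      "\<And>b. b \<in> tuples n d \<Longrightarrow> mpoly_eval (coords n b) f \<noteq> 0 \<Longrightarrow> hdim d (($) b) m \<le> hdim d (($) x) m"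
      using hdim_open[of n d x m] xt by blast
    have "mpoly_eval (coords n b) f = 0" if "b \<in> P_type n d mu" for b
      using f(3)[of b] P_type_hdim[OF that, of m] less that
      by (auto simp: P_type_def CP_def)
    then show False using x(2) f(1,2) by (auto simp: vcl_def)
  qed
  then show thesis using that mu' xP by blast
qed

section \<open>The Hilbert--Burch theorem\<close>

text \<open>The signed maximal minors of rows \<open>0\<close> to \<open>d - 1\<close>, as cofactors
  of row \<open>d\<close>. Row \<open>d\<close> of \<open>M\<close> is overwritten by a unit vector,
  which builds in the signs.\<close>

definition minors :: "nat \<Rightarrow> (nat \<Rightarrow> nat \<Rightarrow> 'a::comm_ring_1) \<Rightarrow> nat \<Rightarrow> 'a" where
  "minors d M l = Det (d + 1) (M(d := (\<lambda>k. if k = l then 1 else 0)))"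

definition hmat :: "nat \<Rightarrow> (nat \<Rightarrow> nat) \<Rightarrow> (nat \<Rightarrow> nat \<Rightarrow> 'k::comm_ring_1 poly poly) \<Rightarrow> bool" where
  "hmat d q M \<longleftrightarrow> (\<forall>i<d. \<forall>l<d + 1. M i l \<in> forms (int (q i)))"

definition minor_vec :: "nat \<Rightarrow> 'a::comm_ring_1 \<Rightarrow> (nat \<Rightarrow> nat \<Rightarrow> 'a) \<Rightarrow> 'a vec" where
  "minor_vec d g M = vec (d + 1) (\<lambda>l. g * minors d M l)"

text \<open>Unlike \<^const>\<open>P_type\<close>, the set \<open>Z n d q\<close> is the image of an affine space. By Hilbert--Burch it
  contains all tuples of type \<open>q\<close>. Here \<open>q\<close> need not be sorted.\<close>

definition Z :: "nat \<Rightarrow> nat \<Rightarrow> (nat \<Rightarrow> nat) \<Rightarrow> 'k::field poly poly vec set" where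
  "Z n d q = {minor_vec d g M | g M. g \<in> forms (int n - int (\<Sum>i<d. q i)) \<and> hmat d q M}"

text \<open>Laplace expansion along row \<open>d\<close>, by linearity in that row. Putting a row of
  \<open>M\<close> there gives its orthogonality to the minors.\<close>

lemma Det_eq_minors: "Det (d + 1) (M(d := x)) = (\<Sum>l<d + 1. x l * minors d M l)"
proof -
  have "(\<Sum>l<d + 1. x l * (if j = l then 1 else 0)) = (\<Sum>l<d + 1. if j = l then x l else 0)" for j
    by (rule sum.cong) auto
  then have x: "(\<Sum>l<d + 1. x l * (if j = l then 1 else 0)) = x j" if "j < d + 1" for j
    using that by (subst (asm) sum.delta') (simp_all del: sum.lessThan_Suc)
  have "Det (d + 1) (M(d := x))
      = Det (d + 1) (M(d := (\<lambda>j. \<Sum>l<d + 1. x l * (if j = l then 1 else 0))))"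
    by (rule Det_cong) (auto simp: x[symmetric] simp del: sum.lessThan_Suc)
  also have "\<dots> = (\<Sum>l<d + 1. x l * minors d M l)"
    unfolding minors_def by (subst Det_row_sum) (simp_all only: Det_row_smult less_add_one)
  finally show ?thesis .
qed

lemma minors_row: "i < d \<Longrightarrow> (\<Sum>l<d + 1. M i l * minors d M l) = 0"
  unfolding Det_eq_minors[symmetric] by (rule Det_same[of i _ d]) auto

lemma minors_forms:
  assumes "hmat d q M"
  shows "minors d M l \<in> forms (int (\<Sum>i<d. q i))"
proof -
  have "minors d M l \<in> forms (\<Sum>i<d + 1. (if i < d then int (q i) else 0))"
    unfolding minors_def
    by (rule Det_forms) (use assms in \<open>auto simp: hmat_def forms_1\<close>)
  then show ?thesis by simp
qed

lemma minor_vec_tuples: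
  assumes "g \<in> forms (int n - int (\<Sum>i<d. q i))" "hmat d q M"
  shows "minor_vec d g M \<in> tuples n d"
  using forms_mult[OF assms(1) minors_forms[OF assms(2)]] by (simp add: tuples_def minor_vec_def)

lemma Z_tuples: "Z n d q \<subseteq> tuples n d"
  using minor_vec_tuples unfolding Z_def by blast

text \<open>A relation between the rows, extended by coefficient 0 for the unit row, makes the
  determinant defining any minor vanish.\<close>

lemma minors_R_indep:
  fixes M :: "nat \<Rightarrow> nat \<Rightarrow> 'a::idom"
  assumes "minors d M l \<noteq> 0"
  shows "R_indep (d + 1) d M"
  unfolding R_indep_def
proof (intro allI impI, rule ccontr)
  fix w i assume w: "\<forall>j<d + 1. (\<Sum>i<d. w i * M i j) = 0" and i: "i < d" and nz: "w i \<noteq> 0"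
  have "Det (d + 1) (M(d := (\<lambda>k. if k = l then 1 else 0))) = 0"
    unfolding Det_0_iff_rows
  proof (intro exI[of _ "w(d := 0)"] conjI allI impI)
    show "\<exists>i<d + 1. (w(d := 0)) i \<noteq> 0" using i nz by (intro exI[of _ i]) auto
    fix j assume "j < d + 1"
    then show "(\<Sum>i<d + 1. (w(d := 0)) i * (M(d := (\<lambda>k. if k = l then 1 else 0))) i j) = 0"
      using w by simp
  qed
  then show False using assms by (simp add: minors_def)
qed

text \<open>The rows of the matrix are syzygies of the required degrees, and a nonzero entry of
  \<open>b\<close> makes them independent.\<close>

lemma Z_hdim:
  assumes "b \<in> Z n d q" "j \<le> d" "b $ j \<noteq> 0"
  shows "H d q m \<le> hdim d (($) b) m"
proof -
  obtain g M where M: "g \<in> forms (int n - int (\<Sum>i<d. q i))" "hmat d q M" "b = minor_vec d g M"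
    using assms(1) unfolding Z_def by blast
  have bl: "b $ l = g * minors d M l" if "l < d + 1" for l using that by (simp add: M(3) minor_vec_def)
  have "minors d M j \<noteq> 0" using bl[of j] assms(2,3) by auto
  then have indep: "R_indep (d + 1) d M" by (rule minors_R_indep)
  define v where "v i j = (if j < d + 1 then M i j else 0)" for i j
  show ?thesis
  proof (rule H_le_hdim)
    show "R_indep (d + 1) d v" using indep by (simp add: R_indep_def v_def)
    fix i assume i: "i < d"
    have "(\<Sum>l<d + 1. v i l * b $ l) = g * (\<Sum>l<d + 1. M i l * minors d M l)"
      unfolding sum_distrib_left by (rule sum.cong) (auto simp: v_def bl)
    then show "v i \<in> hsyz d (($) b) (q i)"
      using M(2) i minors_row[OF i, of M] by (auto simp: hsyz_def HV_iff perp_def hmat_def v_def)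
  qed
qed

text \<open>For large \<open>m\<close> nothing in \<open>H\<close> is truncated, and the linear
  terms in \<open>m\<close> cancel.\<close>

lemma sum_le_of_H:
  assumes "\<And>m. (d + 1) * (m + 1) \<le> H d q m + e + m + 1"
  shows "(\<Sum>i<d. q i) \<le> e"
proof -
  define m where "m = (\<Sum>i<d. q i)"
  have qm: "q i \<le> m + 1" if "i < d" for i
    using member_le_sum[of i "{..<d}" q] that by (simp add: m_def)
  have "H d q m + (\<Sum>i<d. q i) = (\<Sum>i<d. (m + 1 - q i) + q i)"
    by (simp add: H_def sum.distrib)
  also have "\<dots> = (\<Sum>i<d. m + 1)" using qm by (intro sum.cong) auto
  finally show ?thesis using assms[of m] by simp
qed

text \<open>Being orthogonal to all syzygies includes the Koszul syzygies, which express
  proportionality to \<open>a\<close>.\<close>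

lemma koszul_perp:
  fixes a :: "nat \<Rightarrow> 'k::field poly poly"
  assumes u: "u \<in> perp (d + 1) (perp (d + 1) {a})" and ij: "i < d + 1" "j < d + 1"
  shows "u i * a j = u j * a i"
proof (cases "i = j")
  case False
  define e where "e k = (if k = i then a j else if k = j then - a i else 0)" for k
  have sum: "(\<Sum>k<d + 1. x k * e k) = x i * a j - x j * a i" for x
  proof -
    have "(\<Sum>k<d + 1. x k * e k) = (\<Sum>k\<in>{i, j}. x k * e k)"
      using ij by (intro sum.mono_neutral_right) (auto simp: e_def)
    then show ?thesis using False by (simp add: e_def)
  qed
  have "(\<Sum>k<d + 1. e k * a k) = 0"
    using sum[of a] by (simp only: mult.commute) simp
  then have "e \<in> perp (d + 1) {a}" using ij by (auto simp: perp_def e_def)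
  then show ?thesis using u sum[of u] by (simp add: perp_def)
qed simp

text \<open>Both \<open>a\<close> and the vector of minors lie in the double orthogonal of
  \<open>a\<close>, which has a graded basis with a single element \<open>c 0\<close>. Comparing
  degrees shows that the minors are a nonzero scalar multiple of \<open>c 0\<close>, so
  \<open>a\<close> is a multiple of the minors.\<close>

lemma hilbert_burch:
  fixes a :: "nat \<Rightarrow> 'k::field poly poly"
  assumes a: "\<And>j. j \<le> d \<Longrightarrow> a j \<in> forms (int n)" and nz: "\<exists>j\<le>d. a j \<noteq> 0"
    and b: "is_basis d q a v"
  obtains g where "g \<in> forms (int n - int (\<Sum>i<d. q i))" "\<And>l. l \<le> d \<Longrightarrow> a l = g * minors d v l"
proof -
  let ?b = "minors d v"
  obtain j0 where j0: "j0 < d + 1" "a j0 \<noteq> 0" using nz by (auto simp: less_Suc_eq_le)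
  have v: "v i \<in> HV (d + 1) (q i)" "v i \<in> perp (d + 1) {a}" if "i < d" for i
    using b that by (auto simp: is_basis_def hsyz_def)
  have va: "(\<Sum>j<d + 1. v i j * a j) = 0" if "i < d" for i using v(2)[OF that] by (simp add: perp_def)
  have indep: "R_indep (d + 1) d v" using b by (simp add: is_basis_def)
  have hm: "hmat d q v" using v(1) by (auto simp: hmat_def HV_iff)
  \<comment> \<open>A vanishing minor gives a relation between the syzygies and a unit vector.
    Pairing it with \<open>a\<close> kills the syzygies and leaves
    \<open>w d * a j0\<close>.\<close>
  have bnz: "?b j0 \<noteq> 0"
  proof
    assume "?b j0 = 0"
    then obtain w where w: "\<exists>i<d + 1. w i \<noteq> 0"
      "\<And>j. j < d + 1 \<Longrightarrow> (\<Sum>i<d + 1. w i * (v(d := (\<lambda>k. if k = j0 then 1 else 0))) i j) = 0"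
      unfolding minors_def Det_0_iff_rows by blast
    have w': "(\<Sum>i<d. w i * v i j) + w d * (if j = j0 then 1 else 0) = 0" if "j < d + 1" for j
      using w(2)[OF that] by simp
    have "0 = (\<Sum>j<d + 1. ((\<Sum>i<d. w i * v i j) + w d * (if j = j0 then 1 else 0)) * a j)"
      using w' by (intro sum.neutral[symmetric]) simp
    also have "\<dots> = (\<Sum>j<d + 1. \<Sum>i<d. w i * (v i j * a j)) + (\<Sum>j<d + 1. if j = j0 then w d * a j else 0)"
      unfolding sum.distrib[symmetric]
      by (rule sum.cong) (auto simp: distrib_right sum_distrib_right mult.assoc)
    also have "(\<Sum>j<d + 1. \<Sum>i<d. w i * (v i j * a j)) = (\<Sum>i<d. w i * (\<Sum>j<d + 1. v i j * a j))"
      unfolding sum_distrib_left by (rule sum.swap)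
    also have "\<dots> = 0" using va by simp
    also have "(\<Sum>j<d + 1. if j = j0 then w d * a j else 0) = w d * a j0"
      using j0(1) by (subst sum.delta) auto
    finally have wd: "w d = 0" using j0(2) by simp
    then have "w i = 0" if "i < d" for i
      by (rule_tac R_indepD[OF indep]) (use w' that in auto)
    then show False using w(1) wd by (auto simp: less_Suc_eq)
  qed
  let ?E = "perp (d + 1) {a}"
  obtain N e c where c: "\<And>i. i < N \<Longrightarrow> c i \<in> HV (d + 1) (e i)" "\<And>i. i < N \<Longrightarrow> c i \<in> perp (d + 1) ?E"
    and cindep: "R_indep (d + 1) N c"
    and cgen: "\<And>m x. x \<in> HV (d + 1) m \<Longrightarrow> x \<in> perp (d + 1) ?E \<Longrightarrow>
      \<exists>w\<in>gr N e m. \<forall>j. x j = (\<Sum>i<N. w i * c i j)"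
    by (rule graded_basis_exists[of "d + 1" ?E], rule that)
  define a' where "a' j = (if j < d + 1 then a j else 0)" for j
  define b' where "b' j = (if j < d + 1 then ?b j else 0)" for j
  have a': "a' \<in> HV (d + 1) n" "a' \<in> perp (d + 1) ?E"
    using a by (auto simp: HV_iff a'_def perp_def mult.commute)
  have b'1: "b' \<in> HV (d + 1) (\<Sum>i<d. q i)"
    using minors_forms[OF hm] by (auto simp: HV_iff b'_def)
  have b'2: "b' \<in> perp (d + 1) ?E"
    unfolding perp_def[of "d + 1" ?E]
  proof (intro CollectI conjI ballI allI impI)
    fix x assume "x \<in> ?E"
    then obtain w where w: "\<And>j. x j = (\<Sum>i<d. w i * v i j)" using b unfolding is_basis_def by blast
    have "(\<Sum>j<d + 1. b' j * x j) = (\<Sum>j<d + 1. \<Sum>i<d. w i * (v i j * ?b j))"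
      by (rule sum.cong) (auto simp: w b'_def sum_distrib_left algebra_simps)
    also have "\<dots> = (\<Sum>i<d. w i * (\<Sum>j<d + 1. v i j * ?b j))"
      unfolding sum_distrib_left by (rule sum.swap)
    also have "\<dots> = 0" using minors_row[of _ d v] by simp
    finally show "(\<Sum>j<d + 1. b' j * x j) = 0" .
  qed (simp add: b'_def)
  have "a' j0 \<noteq> 0" using j0 by (simp add: a'_def)
  then have "N \<noteq> 0" using cgen[OF a'] by (auto intro!: gr0I)
  \<comment> \<open>Two vectors proportional to \<open>a\<close> satisfy the relation obtained by
    cross-multiplying their entries at \<open>j0\<close>.\<close>
  moreover have "\<not> 2 \<le> N"
  proof
    assume N: "2 \<le> N"
    have two: "(\<Sum>i<N. w i * c i j) = w 0 * c 0 j + w 1 * c 1 j" if "\<And>i. i \<ge> 2 \<Longrightarrow> w i = 0" for w j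
    proof -
      have "(\<Sum>i<N. w i * c i j) = (\<Sum>i\<in>{0, 1}. w i * c i j)"
        using N that by (intro sum.mono_neutral_right) (auto simp: numeral_2_eq_2 not_less_eq_eq[symmetric] less_Suc_eq)
      then show ?thesis by simp
    qed
    have kz: "c k i * a j = c k j * a i" if "k < N" "i < d + 1" "j < d + 1" for k i j
      by (rule koszul_perp[OF c(2)]) (use that in auto)
    define w where "w i = (if i = 0 then c 1 j0 else if i = 1 then - c 0 j0 else 0)" for i :: nat
    have "(\<Sum>i<N. w i * c i j) = 0" if j: "j < d + 1" for j
    proof -
      have "a j0 * (c 1 j0 * c 0 j - c 0 j0 * c 1 j) = c 1 j0 * (c 0 j * a j0) - c 0 j0 * (c 1 j * a j0)"
        by (simp add: algebra_simps)
      also have "\<dots> = c 1 j0 * (c 0 j0 * a j) - c 0 j0 * (c 1 j0 * a j)"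
        using kz[of 0 j j0] kz[of 1 j j0] N j j0(1) by simp
      also have "\<dots> = 0" by (simp add: algebra_simps)
      finally show ?thesis using j0(2) by (subst two) (auto simp: w_def)
    qed
    then have "w 1 = 0" by (rule R_indepD[OF cindep, where w = w and i = 1]) (use N in auto)
    then have "c 0 j0 = 0" by (simp add: w_def)
    then have "c 0 j = 0" if "j < d + 1" for j using kz[of 0 j j0] N that j0 by simp
    then have "(\<Sum>i<N. (if i = 0 then 1 else 0) * c i j) = 0" if "j < d + 1" for j
      using that by (subst two) auto
    then have "(if (0::nat) = 0 then 1 else 0 :: 'k poly poly) = 0"
      by (rule R_indepD[OF cindep, where w = "\<lambda>i. if i = 0 then 1 else 0" and i = 0]) (use N in auto)
    then show False by simp
  qed
  ultimately have N: "N = 1" by simp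
  obtain wa where wa: "wa \<in> gr N e n" "\<forall>j. a' j = (\<Sum>i<N. wa i * c i j)" using cgen[OF a'] by blast
  obtain wb where wb: "wb \<in> gr N e (\<Sum>i<d. q i)" "\<forall>j. b' j = (\<Sum>i<N. wb i * c i j)" using cgen[OF b'1 b'2] by blast
  define g where "g = wa 0"
  define h where "h = wb 0"
  have gf: "g \<in> forms (int n - int (e 0))" and hf: "h \<in> forms (int (\<Sum>i<d. q i) - int (e 0))"
    using wa(1) wb(1) N by (auto simp: gr_def g_def h_def)
  have ag: "a j = g * c 0 j" if "j < d + 1" for j using wa(2) that N by (auto simp: g_def a'_def split: if_splits)
  have bh: "?b j = h * c 0 j" if "j < d + 1" for j using wb(2) that N by (auto simp: h_def b'_def split: if_splits)
  have g0: "g \<noteq> 0" using ag[OF j0(1)] j0(2) by auto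
  have h0: "h \<noteq> 0" using bh[OF j0(1)] bnz by auto
  have "perp (d + 1) {c 0} = perp (d + 1) {a}"
  proof -
    have "(\<Sum>j<d + 1. x j * a j) = g * (\<Sum>j<d + 1. x j * c 0 j)" for x
      unfolding sum_distrib_left by (rule sum.cong) (auto simp: ag)
    then show ?thesis using g0 by (simp add: perp_def)
  qed
  then have hd: "hdim d (c 0) m = H d q m" for m
    using is_basis_hdim[OF b, of m] by (simp add: hdim_def hsyz_def)
  have cf: "c 0 j \<in> forms (int (e 0))" if "j \<le> d" for j using c(1)[of 0] N that by (simp add: HV_iff)
  \<comment> \<open>\<open>c 0\<close> has the same syzygies as \<open>a\<close>, so the lower bound
    on \<open>hdim\<close> applies to it with degree \<open>e 0\<close>. The opposite inequality
    comes from \<open>h\<close> being a nonzero form.\<close>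
  have "(\<Sum>i<d. q i) \<le> e 0"
    by (rule sum_le_of_H) (use hdim_lower[of d "c 0" "e 0"] cf hd in simp)
  moreover have "\<not> (\<Sum>i<d. q i) < e 0"
  proof
    assume "(\<Sum>i<d. q i) < e 0"
    then have "int (\<Sum>i<d. q i) - int (e 0) < 0" by (simp del: of_nat_sum)
    then show False using forms_neg[OF _ hf] h0 by blast
  qed
  ultimately have e0: "e 0 = (\<Sum>i<d. q i)" by simp
  then have "h \<in> forms 0" using hf by (simp del: of_nat_sum)
  then obtain k where k: "h = [:[:k:]:]" using forms_deg_0 by blast
  then have k0: "k \<noteq> 0" using h0 by auto
  have "[:[:1 / k:]:] * h = 1" using k0 by (simp add: k one_pCons)
  then have "c 0 j = [:[:1 / k:]:] * ?b j" if "j < d + 1" for j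
    unfolding bh[OF that] mult.assoc[symmetric] by (simp only: mult_1_left)
  then have "a l = (g * [:[:1 / k:]:]) * ?b l" if "l \<le> d" for l
    using ag[of l] that by (simp add: mult.assoc)
  moreover have "g * [:[:1 / k:]:] \<in> forms (int n - int (\<Sum>i<d. q i))"
    using forms_mult[OF gf forms_const[of "1 / k"]] e0 by simp
  ultimately show thesis by (rule that[rotated])
qed

lemma P_type_subset_Z: "P_type n d mu \<subseteq> Z n d ((!) mu)"
proof
  fix a :: "'k::field poly poly vec" assume a: "a \<in> P_type n d mu"
  then have ac: "a \<in> CP n d" and at: "a \<in> tuples n d" and acar: "a \<in> carrier_vec (d + 1)"
    and t: "has_mu_type n d mu a" by (auto simp: P_type_def CP_def tuples_def)
  obtain v where v: "is_basis d ((!) mu) (($) a) v" using has_mu_type_basis[OF acar t] .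
  have "\<exists>j\<le>d. a $ j \<noteq> 0" using CP_nonzero[OF ac] by blast
  then obtain g where g: "g \<in> forms (int n - int (\<Sum>i<d. mu ! i))" "\<And>l. l \<le> d \<Longrightarrow> a $ l = g * minors d v l"
    using hilbert_burch[OF _ _ v, of n] tuples_forms[OF at] by blast
  have "a = minor_vec d g v" using acar g(2) by (intro eq_vecI) (auto simp: minor_vec_def)
  moreover have "hmat d ((!) mu) v" using v by (auto simp: is_basis_def hsyz_def HV_iff hmat_def)
  ultimately show "a \<in> Z n d ((!) mu)" using g(1) unfolding Z_def by blast
qed

section \<open>Genericity along curves\<close>

text \<open>Read coefficientwise in s, this is cancellation of a power of t in k[t].\<close>

lemma t_power_dvd:
  fixes x y :: "'k::field poly poly"
  assumes y: "y = [:monom 1 (c + q):] * z" and xy: "x * monom (monom 1 c) b = y"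
  shows "[:monom 1 q:] dvd x"
  unfolding const_poly_dvd_iff
proof
  fix i
  have "poly.coeff y (i + b) = monom 1 c * poly.coeff x i"
    unfolding xy[symmetric] by (simp add: mult.commute[of x] coeff_monom_mult)
  moreover have "poly.coeff y (i + b) = monom 1 c * (monom 1 q * poly.coeff z (i + b))"
    unfolding y by (simp add: mult_monom mult.assoc[symmetric])
  ultimately have "monom 1 c * poly.coeff x i = monom 1 c * (monom 1 q * poly.coeff z (i + b))" by simp
  then have "poly.coeff x i = monom 1 q * poly.coeff z (i + b)" by (simp add: monom_eq_0_iff)
  then show "monom 1 q dvd poly.coeff x i" by simp
qed

text \<open>The witness consists of the monomials \<open>y j\<close> of s-degree \<open>s j\<close>,
  the partial sums of \<open>mu\<close>. Neighbouring monomials are related by the powers s^(q i)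
  and t^(q i), and these relations form a basis.\<close>

lemma P_type_nonempty:
  fixes mu :: "nat list"
  assumes mu: "is_partition d mu" "sum_list mu \<le> n"
  shows "(P_type n d mu :: 'k::field poly poly vec set) \<noteq> {}"
proof -
  define q where "q = (!) mu"
  define s where "s k = (\<Sum>i<k. q i)" for k
  have len: "length mu = d" using mu by (simp add: is_partition_def)
  have sSuc: "s (Suc k) = s k + q k" for k by (simp add: s_def)
  have smono: "s j \<le> s k" if "j \<le> k" for j k unfolding s_def using that by (intro sum_mono2) auto
  have "s d = sum_list mu" by (simp add: s_def q_def sum_list_sum_nth len atLeast0LessThan)
  then have sn: "s k \<le> n" if "k \<le> d" for k using smono[OF that] mu(2) by simp
  define y :: "nat \<Rightarrow> 'k poly poly" where "y j = monom (monom 1 (n - s j)) (s j)" for j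
  define v :: "nat \<Rightarrow> nat \<Rightarrow> 'k poly poly" where
    "v i j = (if j = i then monom 1 (q i) else if j = Suc i then - [:monom 1 (q i):] else 0)" for i j
  have yf: "y j \<in> forms (int n)" if "j \<le> d" for j
    using forms_monom[of "1::'k" "n - s j" "s j"] sn[OF that] by (simp add: y_def of_nat_diff)
  have rel: "monom 1 (q i) * y i = [:monom 1 (q i):] * y (Suc i)" if "i < d" for i
  proof -
    have "n - s i = q i + (n - s (Suc i))" using sn[of "Suc i"] that sSuc[of i] by simp
    then show ?thesis by (simp add: y_def mult_monom smult_monom sSuc add.commute)
  qed
  have vsum: "(\<Sum>j<N. v i j * x j) = monom 1 (q i) * x i - [:monom 1 (q i):] * x (Suc i)"
    if "Suc i < N" for i N x
  proof -
    have "(\<Sum>j<N. v i j * x j) = (\<Sum>j\<in>{i, Suc i}. v i j * x j)"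
      using that by (intro sum.mono_neutral_right) (auto simp: v_def)
    then show ?thesis by (simp add: v_def)
  qed
  have v: "v i \<in> hsyz d y (q i)" if "i < d" for i
  proof -
    have "[:monom 1 (q i):] \<in> forms (int (q i))" "monom 1 (q i) \<in> forms (int (q i))"
      using forms_monom[of 1 "q i" 0] forms_monom[of 1 0 "q i"] by (simp_all add: monom_0 one_pCons)
    then have "v i j \<in> forms (int (q i))" for j by (auto simp: v_def intro: forms_minus[of "[:_:]", simplified])
    then show ?thesis using that vsum[of i "d + 1" y] rel[OF that]
      by (auto simp: hsyz_def HV_iff perp_def v_def)
  qed
  have indep: "R_indep (d + 1) d v"
    unfolding R_indep_def
  proof (intro allI impI)
    fix w i assume w: "\<forall>j<d + 1. (\<Sum>i<d. w i * v i j) = 0" and "i < d"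
    then show "w i = 0"
    proof (induction i)
      case 0
      have "(\<Sum>i<d. w i * v i 0) = (\<Sum>i\<in>{0}. w i * v i 0)"
        using 0 by (intro sum.mono_neutral_right) (auto simp: v_def)
      then show ?case using 0 by (auto simp: v_def monom_eq_0_iff)
    next
      case (Suc i)
      have "(\<Sum>k<d. w k * v k (Suc i)) = (\<Sum>k\<in>{i, Suc i}. w k * v k (Suc i))"
        using Suc.prems by (intro sum.mono_neutral_right) (auto simp: v_def)
      then show ?case using Suc by (auto simp: v_def monom_eq_0_iff)
    qed
  qed
  \<comment> \<open>The last entry that may be nonzero is removed by subtracting a multiple of the
    last relation involved.\<close>
  have gen: "\<exists>w. \<forall>j. x j = (\<Sum>i<k. w i * v i j)"
    if "k \<le> d" "\<And>j. j > k \<Longrightarrow> x j = 0" "(\<Sum>j<Suc k. x j * y j) = 0" for k x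
    using that
  proof (induction k arbitrary: x)
    case 0
    have "x 0 = 0" using 0(3) by (simp add: y_def monom_eq_0_iff)
    then have "x j = 0" for j using 0(2)[of j] by (cases "j = 0") auto
    then show ?case by simp
  next
    case (Suc k)
    have "x (Suc k) * y (Suc k) = - (\<Sum>j<Suc k. x j * y j)"
      using Suc.prems(3) by (simp only: sum.lessThan_Suc[of _ "Suc k"] eq_neg_iff_add_eq_0 add.commute)
    \<comment> \<open>Every \<open>y j\<close> with \<open>j \<le> k\<close> carries at least this
      power of t, while \<open>y (Suc k)\<close> carries \<open>q k\<close> less; so
      \<open>x (Suc k)\<close> is divisible by t^(q k).\<close>
    also have "\<dots> = [:monom 1 (n - s (Suc k) + q k):] * - (\<Sum>j<Suc k. x j * monom (monom 1 (s k - s j)) (s j))"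
      unfolding mult_minus_right sum_distrib_left
    proof (intro arg_cong[of _ _ uminus] sum.cong refl)
      fix j assume "j \<in> {..<Suc k}"
      then have "s j \<le> s k" "s (Suc k) \<le> n" using smono sn Suc.prems(1) by auto
      then have "n - s j = (n - s (Suc k) + q k) + (s k - s j)" using sSuc[of k] by simp
      moreover have "monom (monom 1 (A + B)) N = [:monom 1 A:] * (monom (monom 1 B) N :: 'k poly poly)" for A B N
        by (simp add: smult_monom mult_monom)
      ultimately have "y j = [:monom 1 (n - s (Suc k) + q k):] * monom (monom 1 (s k - s j)) (s j)"
        by (simp only: y_def)
      then show "x j * y j = [:monom 1 (n - s (Suc k) + q k):] * (x j * monom (monom 1 (s k - s j)) (s j))"
        by (simp only: mult.left_commute)
    qed
    finally have "[:monom 1 (q k):] dvd x (Suc k)"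
      by (intro t_power_dvd[OF refl]) (simp only: y_def)
    then obtain z where z: "x (Suc k) = [:monom 1 (q k):] * z" by (rule dvdE)
    define x' where "x' j = x j + z * v k j" for j
    have x'0: "x' j = 0" if "j > k" for j
      using that Suc.prems(2)[of j] by (cases "j = Suc k") (auto simp: x'_def v_def z mult.commute)
    have "(\<Sum>j<Suc k. x' j * y j) = 0"
    proof -
      have "(\<Sum>j<Suc (Suc k). x' j * y j) = (\<Sum>j<Suc (Suc k). x j * y j) + z * (\<Sum>j<Suc (Suc k). v k j * y j)"
        unfolding x'_def distrib_right sum.distrib sum_distrib_left mult.assoc ..
      also have "\<dots> = 0" using Suc.prems(1,3) vsum[of k "Suc (Suc k)" y] rel[of k] by simp
      finally show ?thesis using x'0[of "Suc k"] by simp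
    qed
    then obtain w where w: "\<And>j. x' j = (\<Sum>i<k. w i * v i j)"
      using Suc.IH[of x'] x'0 Suc.prems(1) by auto
    have "x j = (\<Sum>i<Suc k. (w(k := - z)) i * v i j)" for j
    proof -
      have "(\<Sum>i<k. (w(k := - z)) i * v i j) = (\<Sum>i<k. w i * v i j)" by (rule sum.cong) auto
      then show ?thesis using w[of j] by (simp add: x'_def eq_diff_eq)
    qed
    then show ?case by (intro exI allI)
  qed
  have basis: "is_basis d q y v"
    unfolding is_basis_def
  proof (intro conjI ballI allI impI indep)
    show "v i \<in> hsyz d y (q i)" if "i < d" for i by (rule v[OF that])
    fix x assume "x \<in> perp (d + 1) {y}"
    then show "\<exists>w. \<forall>j. x j = (\<Sum>i<d. w i * v i j)"
      by (intro gen) (auto simp: perp_def)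
  qed
  define a where "a = vec (d + 1) y"
  have ac: "a \<in> carrier_vec (d + 1)" by (simp add: a_def)
  have at: "a \<in> tuples n d" using yf by (auto simp: a_def tuples_def)
  have eq: "hsyz d (($) a) = hsyz d y" "perp (d + 1) {($) a} = perp (d + 1) {y}"
    by (auto simp: hsyz_def perp_def a_def fun_eq_iff)
  have basis': "is_basis d ((!) mu) (($) a) v"
    using basis unfolding is_basis_def eq q_def .
  have "H d ((!) mu) 0 = 0"
    using mu(1) by (auto simp: H_def is_partition_def)
  then have "a \<in> CP n d" using CP_iff[OF at] is_basis_hdim[OF basis', of 0] by simp
  then have "a \<in> P_type n d mu"
    using basis_has_mu_type[OF ac mu(1) basis'] by (simp add: P_type_def)
  then show ?thesis by blast
qed

section \<open>Polynomial curves in the space of tuples\<close>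

definition upoly :: "('k::field \<Rightarrow> 'k) \<Rightarrow> bool" where
  "upoly F \<longleftrightarrow> (\<exists>P. \<forall>x. F x = poly P x)"

lemma upoly_const: "upoly (\<lambda>x. c)"
  unfolding upoly_def by (rule exI[of _ "[:c:]"]) simp

lemma upoly_id: "upoly (\<lambda>x. x)"
  unfolding upoly_def by (rule exI[of _ "[:0, 1:]"]) simp

lemma upoly_add: "upoly F \<Longrightarrow> upoly G \<Longrightarrow> upoly (\<lambda>x. F x + G x)"
  unfolding upoly_def by (metis poly_add)

lemma upoly_mult: "upoly F \<Longrightarrow> upoly G \<Longrightarrow> upoly (\<lambda>x. F x * G x)"
  unfolding upoly_def by (metis poly_mult)

lemma upoly_power: "upoly F \<Longrightarrow> upoly (\<lambda>x. F x ^ k)"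
  unfolding upoly_def by (metis poly_power)

lemma upoly_sum: "(\<And>y. y \<in> A \<Longrightarrow> upoly (F y)) \<Longrightarrow> upoly (\<lambda>x. \<Sum>y\<in>A. F y x)"
  by (induction A rule: infinite_finite_induct) (auto intro: upoly_const upoly_add)

lemma upoly_prod: "(\<And>y. y \<in> A \<Longrightarrow> upoly (F y)) \<Longrightarrow> upoly (\<lambda>x. \<Prod>y\<in>A. F y x)"
  by (induction A rule: infinite_finite_induct) (auto intro: upoly_const upoly_mult)

lemma upoly_zeros:
  assumes "upoly F" "infinite {x. F x = 0}"
  shows "F y = 0"
proof -
  obtain P where P: "\<And>x. F x = poly P x" using assms(1) unfolding upoly_def by blast
  have "P = 0" using poly_roots_finite[of P] assms(2) unfolding P by blast
  then show ?thesis by (simp add: P)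
qed

definition curve :: "('k::field \<Rightarrow> 'k poly poly) \<Rightarrow> bool" where
  "curve p \<longleftrightarrow> (\<forall>i j. upoly (\<lambda>x. cc (p x) i j))"

lemma curve_const: "curve (\<lambda>x. p)"
  by (simp add: curve_def upoly_const)

lemma curve_param: "curve (\<lambda>x. [:[:x:]:])"
  unfolding curve_def
proof (intro allI)
  fix i j show "upoly (\<lambda>x. cc [:[:x:]:] i j)"
    by (cases i; cases j) (simp_all add: upoly_const upoly_id)
qed

lemma curve_add: "curve p \<Longrightarrow> curve q \<Longrightarrow> curve (\<lambda>x. p x + q x)"
  by (simp add: curve_def upoly_add)

lemma curve_mult: "curve p \<Longrightarrow> curve q \<Longrightarrow> curve (\<lambda>x. p x * q x)"
  unfolding curve_def cc_mult by (intro allI upoly_sum upoly_mult) auto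

lemma curve_sum: "(\<And>y. y \<in> A \<Longrightarrow> curve (F y)) \<Longrightarrow> curve (\<lambda>x. \<Sum>y\<in>A. F y x)"
  by (induction A rule: infinite_finite_induct) (auto intro: curve_const curve_add)

lemma curve_prod: "(\<And>y. y \<in> A \<Longrightarrow> curve (F y)) \<Longrightarrow> curve (\<lambda>x. \<Prod>y\<in>A. F y x)"
  by (induction A rule: infinite_finite_induct) (auto intro: curve_const curve_mult)

lemma curve_Det: "(\<And>i j. curve (\<lambda>x. A x i j)) \<Longrightarrow> curve (\<lambda>x. Det N (A x))"
  unfolding Det_Leibniz by (intro curve_sum curve_mult curve_const curve_prod)

lemma curve_minors:
  assumes "\<And>i j. curve (\<lambda>x. M x i j)"
  shows "curve (\<lambda>x. minors d (M x) l)"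
  unfolding minors_def
proof (rule curve_Det)
  fix i j show "curve (\<lambda>x. ((M x)(d := \<lambda>k. if k = l then 1 else 0)) i j)"
    using assms by (cases "i = d") (auto intro: curve_const)
qed

lemma upoly_mpoly_eval:
  assumes a: "\<And>j. j \<le> d \<Longrightarrow> curve (\<lambda>x. a x $ j)" and f: "f \<in> coord_polys n d"
  shows "upoly (\<lambda>x. mpoly_eval (coords n (a x)) f)"
  unfolding mpoly_eval_def monom_eval_def
proof (intro upoly_sum upoly_mult upoly_const upoly_prod upoly_power)
  fix m v assume "m \<in> Poly_Mapping.keys f" "v \<in> Poly_Mapping.keys m"
  then have "fst v \<le> d" using f unfolding coord_polys_def by fastforce
  then show "upoly (\<lambda>x. coords n (a x) v)"
    using a[of "fst v"] by (cases v) (auto simp: coords_def curve_def)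
qed

text \<open>The common engine of the density arguments: \<open>y\<close> is the special parameter,
  and a coordinate polynomial vanishing on \<open>A\<close> has infinitely many zeros along the
  curve.\<close>

lemma vcl_curve:
  assumes a: "\<And>j. j \<le> d \<Longrightarrow> curve (\<lambda>x. a x $ j)" and y: "a y \<in> tuples n d"
    and inf: "infinite {x. a x \<in> vcl n d A}"
  shows "a y \<in> vcl n d A"
proof -
  have "mpoly_eval (coords n (a y)) f = 0"
    if f: "f \<in> coord_polys n d" "\<forall>b\<in>A. mpoly_eval (coords n b) f = 0" for f
  proof (rule upoly_zeros[OF upoly_mpoly_eval[OF a f(1)]])
    have "{x. a x \<in> vcl n d A} \<subseteq> {x. mpoly_eval (coords n (a x)) f = 0}"
      using f by (auto simp: vcl_def)
    then show "infinite {x. mpoly_eval (coords n (a x)) f = 0}" using inf by (rule infinite_super)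
  qed
  then show ?thesis using y by (simp add: vcl_def)
qed

lemma vcl_superset: "A \<subseteq> tuples n d \<Longrightarrow> A \<subseteq> vcl n d A"
  by (auto simp: vcl_def)

lemma vcl_trans: "A \<subseteq> vcl n d B \<Longrightarrow> B \<subseteq> vcl n d C \<Longrightarrow> A \<subseteq> vcl n d C"
  unfolding vcl_def by blast

lemma partition_le_antisym:
  assumes "is_partition d mu" "is_partition d mu'" "partition_le d mu mu'" "partition_le d mu' mu"
  shows "mu = mu'"
proof (rule nth_equalityI)
  show len: "length mu = length mu'" using assms by (simp add: is_partition_def)
  fix i assume "i < length mu"
  then have i: "i < length mu" "i < length mu'" "Suc i \<le> d" using len assms(1) by (auto simp: is_partition_def)
  have eq: "sum_list (take k mu) = sum_list (take k mu')" if "k \<le> d" for k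
    using assms(3,4) that unfolding partition_le_def by (cases "k = 0") (auto intro: order.antisym)
  show "mu ! i = mu' ! i"
    using eq[of i] eq[of "Suc i"] i by (simp add: take_Suc_conv_app_nth)
qed

text \<open>On \<open>Z\<close> the function \<open>H\<close> of \<open>mu\<close> is a lower bound
  for \<open>hdim\<close> at nonzero tuples. With the upper bound \<open>h\<close> the actual type
  is both below and above \<open>mu\<close>; degree 0 of \<open>h\<close> gives membership in
  \<open>CP\<close>.\<close>

lemma Z_generic_type:
  fixes b :: "'k::field poly poly vec"
  assumes mu: "is_partition d mu" "sum_list mu \<le> n" and b: "b \<in> Z n d ((!) mu)"
    and h: "\<And>m. m \<le> n \<Longrightarrow> hdim d (($) b) m \<le> H d ((!) mu) m"
  shows "b \<in> P_type n d mu"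
proof -
  have bt: "b \<in> tuples n d" using b Z_tuples by blast
  have "H d ((!) mu) 0 = 0" using mu(1) by (auto simp: H_def is_partition_def)
  then have bc: "b \<in> CP n d" using CP_iff[OF bt] h[of 0] by simp
  obtain mu' where mu': "is_partition d mu'" "d \<le> sum_list mu'" "sum_list mu' \<le> n" "has_mu_type n d mu' b"
    using type_exists[OF bc] .
  have h': "hdim d (($) b) m = H d ((!) mu') m" for m
    using P_type_hdim[of b n d mu'] bc mu'(4) by (simp add: P_type_def)
  obtain j where "j \<le> d" "b $ j \<noteq> 0" using CP_nonzero[OF bc] .
  then have h'': "H d ((!) mu) m \<le> H d ((!) mu') m" for m using Z_hdim[OF b, of j m] h' by simp
  have "partition_le d mu' mu" by (rule partition_leI[OF mu(1) mu'(1,3)]) (rule h'')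
  moreover have "partition_le d mu mu'"
    by (rule partition_leI[OF mu'(1) mu]) (use h h' in auto)
  ultimately have "mu' = mu" using partition_le_antisym[OF mu'(1) mu(1)] by blast
  then show ?thesis using bc mu'(4) by (simp add: P_type_def)
qed

lemma Z_subset_vcl_P_type:
  fixes mu :: "nat list"
  assumes inf: "infinite (UNIV :: 'k::field set)" and mu: "is_partition d mu" "sum_list mu \<le> n"
  shows "(Z n d ((!) mu) :: 'k poly poly vec set) \<subseteq> vcl n d (P_type n d mu)"
proof
  fix a :: "'k poly poly vec" assume "a \<in> Z n d ((!) mu)"
  then obtain g M where gM: "g \<in> forms (int n - int (\<Sum>i<d. mu ! i))" "hmat d ((!) mu) M" "a = minor_vec d g M"
    unfolding Z_def by blast
  obtain a' :: "'k poly poly vec" where a': "a' \<in> P_type n d mu" using P_type_nonempty[OF mu] by blast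
  then have "a' \<in> Z n d ((!) mu)" using P_type_subset_Z by blast
  then obtain g' M' where gM': "g' \<in> forms (int n - int (\<Sum>i<d. mu ! i))" "hmat d ((!) mu) M'" "a' = minor_vec d g' M'"
    unfolding Z_def by blast
  \<comment> \<open>The line in the parameter space of \<open>Z\<close> from the given tuple (at 0)
    to one of type \<open>mu\<close> (at 1).\<close>
  define b where "b x = minor_vec d (g + [:[:x:]:] * (g' - g)) (\<lambda>i l. M i l + [:[:x:]:] * (M' i l - M i l))" for x :: 'k
  have lin: "p + [:[:x:]:] * (p' - p) \<in> forms e" if "p \<in> forms e" "p' \<in> forms e" for p p' e and x :: 'k
    using forms_mult[OF forms_const[of x] forms_diff[OF that(2,1)]] that(1) by (intro forms_add) auto
  have bZ: "b x \<in> Z n d ((!) mu)" for x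
    using lin gM(1,2) gM'(1,2) unfolding Z_def b_def hmat_def by blast
  have curve: "curve (\<lambda>x. b x $ j)" if "j \<le> d" for j
    using that unfolding b_def minor_vec_def
    by (auto intro!: curve_mult curve_add curve_minors curve_const curve_param simp del: mult_pCons_left)
  have b0: "b 0 = a" and b1: "b 1 = a'" by (simp_all add: b_def gM gM' one_pCons[symmetric])
  have "\<forall>m. \<exists>f\<in>coord_polys n d. mpoly_eval (coords n a') f \<noteq> 0 \<and>
    (\<forall>b\<in>tuples n d. mpoly_eval (coords n b) f \<noteq> 0 \<longrightarrow> hdim d (($) b) m \<le> hdim d (($) a') m)"
    using hdim_open[of n d a'] a' by (auto simp: P_type_def CP_def)
  then obtain f where f: "\<And>m. f m \<in> coord_polys n d" "\<And>m. mpoly_eval (coords n a') (f m) \<noteq> 0"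
    "\<And>m b. b \<in> tuples n d \<Longrightarrow> mpoly_eval (coords n b) (f m) \<noteq> 0 \<Longrightarrow> hdim d (($) b) m \<le> hdim d (($) a') m"
    by metis
  \<comment> \<open>The exceptional parameters; none of the finitely many polynomials vanishes at
    parameter 1, so the set is finite.\<close>
  define X where "X = (\<Union>m\<le>n. {x. mpoly_eval (coords n (b x)) (f m) = 0})"
  have "finite {x. mpoly_eval (coords n (b x)) (f m) = 0}" for m
    using upoly_zeros[OF upoly_mpoly_eval[OF curve f(1)], where y = 1] f(2) b1 by metis
  then have "finite X" by (simp add: X_def)
  moreover have "b x \<in> P_type n d mu" if "x \<notin> X" for x
  proof (rule Z_generic_type[OF mu bZ])
    fix m assume "m \<le> n"
    then have "mpoly_eval (coords n (b x)) (f m) \<noteq> 0" using that by (auto simp: X_def)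
    then have "hdim d (($) (b x)) m \<le> hdim d (($) a') m" using bZ Z_tuples by (intro f(3)) blast+
    then show "hdim d (($) (b x)) m \<le> H d ((!) mu) m" using P_type_hdim[OF a'] by simp
  qed
  then have "UNIV - X \<subseteq> {x. b x \<in> vcl n d (P_type n d mu)}"
    using vcl_superset[of "P_type n d mu" n d] by (auto simp: P_type_def CP_def)
  ultimately have "infinite {x. b x \<in> vcl n d (P_type n d mu)}"
    using inf by (metis Diff_infinite_finite infinite_super)
  then have "b 0 \<in> vcl n d (P_type n d mu)"
    using bZ Z_tuples by (intro vcl_curve curve) blast+
  then show "a \<in> vcl n d (P_type n d mu)" by (simp add: b0)
qed

section \<open>Degenerations\<close>

lemma Z_cong: "(\<And>i. i < d \<Longrightarrow> q i = q' i) \<Longrightarrow> Z n d q = Z n d q'"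
  by (simp add: Z_def hmat_def)

lemma sum_lessThan_fun_upd:
  fixes q :: "nat \<Rightarrow> nat"
  shows "i < k \<Longrightarrow> (\<Sum>l<k. (q(i := v)) l) + q i = (\<Sum>l<k. q l) + v"
    and "\<not> i < k \<Longrightarrow> (\<Sum>l<k. (q(i := v)) l) = (\<Sum>l<k. q l)"
proof -
  assume "i < k"
  then have "(\<Sum>l<k. (q(i := v)) l) = v + (\<Sum>l\<in>{..<k} - {i}. (q(i := v)) l)"
    by (subst sum.remove[of _ i]) auto
  also have "(\<Sum>l\<in>{..<k} - {i}. (q(i := v)) l) = (\<Sum>l\<in>{..<k} - {i}. q l)"
    by (rule sum.cong) auto
  finally show "(\<Sum>l<k. (q(i := v)) l) + q i = (\<Sum>l<k. q l) + v"
    using \<open>i < k\<close> by (subst (2) sum.remove[of _ i]) auto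
next
  assume "\<not> i < k"
  then show "(\<Sum>l<k. (q(i := v)) l) = (\<Sum>l<k. q l)" by (intro sum.cong) auto
qed

text \<open>Multiplying row \<open>i\<close> by \<open>p\<close> multiplies every minor by
  \<open>p\<close>.\<close>

lemma Z_linear_factor:
  fixes M :: "nat \<Rightarrow> nat \<Rightarrow> 'k::field poly poly"
  assumes i: "i < d" and M: "hmat d q M" and p: "p \<in> forms 1"
    and g: "g \<in> forms (int n - int (\<Sum>i<d. q i) - 1)"
  shows "minor_vec d (p * g) M \<in> Z n d (q(i := Suc (q i)))"
proof -
  let ?M = "M(i := (\<lambda>l. p * M i l))"
  have "minors d ?M l = p * minors d M l" for l
    using Det_row_smult[of i "d + 1" "M(d := (\<lambda>k. if k = l then 1 else 0))" p "M i"] i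
    by (simp add: minors_def fun_upd_twist[of i d] fun_upd_idem)
  then have "minor_vec d (p * g) M = minor_vec d g ?M"
    by (simp add: minor_vec_def mult.assoc mult.left_commute)
  moreover have "hmat d (q(i := Suc (q i))) ?M"
    using M forms_mult[OF p, of "M i _" "int (q i)"] i by (auto simp: hmat_def)
  moreover have "(\<Sum>l<d. (q(i := Suc (q i))) l) = (\<Sum>l<d. q l) + 1"
    using sum_lessThan_fun_upd(1)[OF i, of q "Suc (q i)"] by simp
  then have "g \<in> forms (int n - int (\<Sum>l<d. (q(i := Suc (q i))) l))"
    using g by (simp only: of_nat_add of_nat_1 diff_diff_eq)
  ultimately show ?thesis unfolding Z_def by blast
qed

text \<open>Forms with a linear factor are dense: \<open>g - g(c, 1) t\<^sup>e\<close> is divisible by \<open>s - c t\<close>, and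
  \<open>g(c, 1)\<close> takes infinitely many values unless \<open>g\<close> itself is divisible by \<open>t\<close>.\<close>

lemma Z_step_gcd:
  assumes inf: "infinite (UNIV :: 'k::field set)" and i: "i < d" and less: "(\<Sum>i<d. q i) < n"
  shows "(Z n d q :: 'k poly poly vec set) \<subseteq> vcl n d (Z n d (q(i := Suc (q i))))" (is "_ \<subseteq> vcl n d ?Z")
proof
  fix a :: "'k poly poly vec" assume "a \<in> Z n d q"
  then obtain g M where gM: "g \<in> forms (int n - int (\<Sum>i<d. q i))" "hmat d q M" "a = minor_vec d g M"
    unfolding Z_def by blast
  define e where "e = n - (\<Sum>i<d. q i)"
  have e: "int n - int (\<Sum>i<d. q i) = int e" "e \<ge> 1" using less by (auto simp: e_def simp del: of_nat_sum)
  have g: "g \<in> forms (int e)" using gM(1) e by simp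
  have ZI: "minor_vec d (p * h) M \<in> ?Z" if "p \<in> forms 1" "h \<in> forms (int e - 1)" for p h
    using Z_linear_factor[OF i gM(2) that(1), of h n] that(2) e(1) by simp
  have Zv: "?Z \<subseteq> vcl n d ?Z" using Z_tuples by (rule vcl_superset)
  \<comment> \<open>The dehomogenisation g(x, 1) as a polynomial in one variable.\<close>
  define P where "P = (\<Sum>k\<le>e. monom (cc g k (e - k)) k)"
  have coeff_P: "poly.coeff P k = (if k \<le> e then cc g k (e - k) else 0)" for k
    by (auto simp: P_def coeff_sum)
  show "a \<in> vcl n d ?Z"
  proof (cases "degree P = 0")
    \<comment> \<open>Then \<open>g\<close> is a scalar multiple of t^e, which is divisible by t
      since \<open>e\<close> is positive.\<close>
    case True
    have "cc g k (e - k) = 0" if "k \<le> e" "k \<noteq> 0" for k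
      using coeff_P[of k] True that by (simp add: coeff_eq_0)
    then have "g = monom (monom (cc g 0 e) e) 0"
      using forms_monom[of "cc g 0 e" e 0] by (intro forms_eqI[OF g]) (auto simp: coeff_pCons monom_0 split: nat.splits)
    also have "\<dots> = [:monom 1 1:] * monom (monom (cc g 0 e) (e - 1)) 0"
      using e(2) by (simp add: monom_0 mult_monom)
    finally have "g = [:monom 1 1:] * monom (monom (cc g 0 e) (e - 1)) 0" .
    moreover have "minor_vec d ([:monom 1 1:] * monom (monom (cc g 0 e) (e - 1)) 0) M \<in> ?Z"
      using forms_monom[of "1::'k" 1 0] forms_monom[of "cc g 0 e" "e - 1" 0] e(2)
      by (intro ZI) (simp_all add: monom_0 of_nat_diff)
    ultimately have "minor_vec d g M \<in> ?Z" by simp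
    then show ?thesis using Zv gM(3) by blast
  next
    case False
    \<comment> \<open>Subtracting y t^e from \<open>g\<close> produces the linear factor s - c t
      whenever \<open>y = poly P c\<close>.\<close>
    define b where "b y = minor_vec d (g + [:[:y:]:] * (- [:monom 1 e:])) M" for y :: 'k
    have bZ: "b (poly P c) \<in> ?Z" for c
    proof -
      let ?g = "g + [:[:poly P c:]:] * (- [:monom 1 e:])" and ?p = "[:- [:0, c:], 1:]"
      have c1: "[:0, c:] = monom c 1" by (simp add: monom_Suc monom_0)
      have "poly g [:0, c:] = (\<Sum>k\<le>e. monom (cc g k (e - k)) (e - k) * monom (c ^ k) k)"
        by (subst forms_expand[OF g]) (simp add: poly_sum poly_monom c1 monom_power)
      also have "\<dots> = (\<Sum>k\<le>e. monom (cc g k (e - k) * c ^ k) e)"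
        by (rule sum.cong) (auto simp: mult_monom)
      also have "\<dots> = monom (poly P c) e"
        by (rule poly_eqI) (simp add: coeff_sum P_def poly_sum poly_monom)
      finally have "poly ?g [:0, c:] = 0" by (simp add: smult_monom)
      then obtain h where h: "?g = ?p * h" unfolding poly_eq_0_iff_dvd by (rule dvdE)
      have p1: "?p \<in> forms 1"
        by (auto simp: forms_def coeff_pCons split: nat.splits if_splits)
      have "([:monom 1 e:] :: 'k poly poly) \<in> forms (int e)" using forms_monom[of "1::'k" e 0] by (simp add: monom_0)
      from forms_mult[OF forms_const[of "poly P c"] forms_minus[OF this]]
      have "?g \<in> forms (int e)" unfolding add_0 by (rule forms_add[OF g])
      then have "h \<in> forms (int e - 1)" unfolding h by (intro forms_factor[OF p1]) auto
      then show ?thesis unfolding b_def h by (rule ZI[OF p1])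
    qed
    have "infinite (range (poly P))"
    proof
      assume fin: "finite (range (poly P))"
      have "finite {c. poly P c = y}" for y
      proof -
        have "P - [:y:] \<noteq> 0" using False by auto
        then have "finite {c. poly (P - [:y:]) c = 0}" by (rule poly_roots_finite)
        then show ?thesis by simp
      qed
      then have "finite (\<Union>y\<in>range (poly P). {c. poly P c = y})" using fin by blast
      moreover have "(\<Union>y\<in>range (poly P). {c. poly P c = y}) = UNIV" by auto
      ultimately show False using inf by simp
    qed
    moreover have "range (poly P) \<subseteq> {y. b y \<in> vcl n d ?Z}" using bZ Zv by blast
    ultimately have "infinite {y. b y \<in> vcl n d ?Z}" using infinite_super by blast
    moreover have "curve (\<lambda>y. b y $ j)" if "j \<le> d" for j
    proof -
      have "curve (\<lambda>y. (g + [:[:y:]:] * (- [:monom 1 e:])) * minors d M j)"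
        by (intro curve_mult curve_add curve_const curve_param)
      then show ?thesis using that by (simp add: b_def minor_vec_def)
    qed
    moreover have b0: "b 0 = a" by (simp add: b_def gM(3))
    moreover have "a \<in> tuples n d" using gM minor_vec_tuples by blast
    ultimately show ?thesis using vcl_curve[of d b 0 n ?Z] by simp
  qed
qed

text \<open>Writing row \<open>j\<close> as \<open>s w - t\<^sup>k u\<close> and row \<open>i\<close> as \<open>p\<close>, the minors of the matrix with these rows
  replaced by \<open>s p + \<tau> u\<close> and \<open>t\<^sup>k p + \<tau> w\<close> are \<open>\<tau>\<close> times the original ones, up to \<open>\<tau>\<^sup>2\<close>.\<close>

lemma minors_deform:
  fixes M :: "nat \<Rightarrow> nat \<Rightarrow> 'a::comm_ring_1"
  assumes ij: "i < d" "j < d" "i \<noteq> j" and row: "\<And>l. l < d + 1 \<Longrightarrow> M j l = A * w l - B * u l"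
  shows "minors d (M(i := (\<lambda>l. A * M i l + x * u l), j := (\<lambda>l. B * M i l + x * w l))) l
    = x * (minors d M l + x * minors d (M(i := u, j := w)) l)"
proof -
  define N where "N = M(d := (\<lambda>k. if k = l then 1 else 0))"
  define D where "D y z = Det (d + 1) (N(i := y, j := z))" for y z
  have tw: "minors d (M(i := y, j := z)) l = D y z" for y z
    using ij unfolding minors_def D_def N_def by (intro Det_cong) auto
  have lin2: "D y (\<lambda>l. b * z l + c * z' l) = b * D y z + c * D y z'" for y z z' b c
    using ij(2) by (simp only: D_def Det_row_add Det_row_smult less_add_one less_SucI Suc_eq_plus1[symmetric])
  have lin1: "D (\<lambda>l. b * z l + c * z' l) y = b * D z y + c * D z' y" for y z z' b c
  proof -
    have "D z'' y = Det (d + 1) ((N(j := y))(i := z''))" for z''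
      unfolding D_def using ij(3) by (simp add: fun_upd_twist)
    then show ?thesis
      using ij(1) by (simp only: Det_row_add Det_row_smult less_add_one less_SucI Suc_eq_plus1[symmetric])
  qed
  have same: "D y y = 0" for y
    unfolding D_def using ij by (intro Det_same[of i _ j]) auto
  have swap: "D u (M i) = - D (M i) u"
    unfolding D_def using ij by (intro Det_swap) auto
  have "minors d M l = D (M i) (\<lambda>l. A * w l + (- B) * u l)"
    unfolding minors_def D_def N_def using ij row by (intro Det_cong) auto
  also have "\<dots> = A * D (M i) w - B * D (M i) u" unfolding lin2 by simp
  finally have "minors d M l = A * D (M i) w - B * D (M i) u" .
  moreover have "D (\<lambda>l. A * M i l + x * u l) (\<lambda>l. B * M i l + x * w l)
      = x * (A * D (M i) w - B * D (M i) u + x * D u w)"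
    unfolding lin1 lin2 same swap by (simp add: algebra_simps)
  ultimately show ?thesis unfolding tw by simp
qed

text \<open>The sum of the degrees is preserved, so \<open>g\<close> keeps its degree. Away from
  parameter 0 the family consists of minors of a matrix with the new row degrees.\<close>

lemma Z_step_transfer:
  assumes inf: "infinite (UNIV :: 'k::field set)" and ij: "i < d" "j < d" "i \<noteq> j" and q: "q i + 2 \<le> q j"
  shows "(Z n d q :: 'k poly poly vec set) \<subseteq> vcl n d (Z n d (q(i := q i + 1, j := q j - 1)))" (is "_ \<subseteq> vcl n d ?Z")
proof
  fix a :: "'k poly poly vec" assume "a \<in> Z n d q"
  then obtain g M where gM: "g \<in> forms (int n - int (\<Sum>i<d. q i))" "hmat d q M" "a = minor_vec d g M"
    unfolding Z_def by blast
  define q' where "q' = q(i := q i + 1, j := q j - 1)"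
  have sum: "(\<Sum>l<d. q' l) = (\<Sum>l<d. q l)"
    using sum_lessThan_fun_upd(1)[OF ij(1), of q "q i + 1"] sum_lessThan_fun_upd(1)[OF ij(2), of "q(i := q i + 1)" "q j - 1"] ij(3) q
    unfolding q'_def by simp
  have Mf: "M k l \<in> forms (int (q k))" if "k < d" "l < d + 1" for k l
    using gM(2) that by (simp add: hmat_def)
  define B :: "'k poly poly" where "B = [:monom 1 (q j - 1 - q i):]"
  \<comment> \<open>The part of row \<open>j\<close> free of s is a scalar times t^(q j). It is
    split as the power \<open>B\<close> of t and a remaining factor of degree
    \<open>q i + 1\<close>, the new degree of row \<open>i\<close>; the rest of row \<open>j\<close>
    is s times \<open>w\<close>.\<close>
  define u where "u l = - [:monom (cc (M j l) 0 (q j)) (q i + 1):]" for l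
  define w where "w l = poly_shift 1 (M j l)" for l
  have const: "[:monom c k:] \<in> forms (int k)" for c :: 'k and k
    using forms_monom[of c k 0] by (simp add: monom_0)
  have "int (q j - 1 - q i) = int (q j) - 1 - int (q i)" using q by auto
  then have Bf: "B \<in> forms (int (q j) - 1 - int (q i))"
    using const[of 1 "q j - 1 - q i"] unfolding B_def by (simp only:)
  have uf: "u l \<in> forms (int (q i + 1))" for l unfolding u_def by (rule forms_minus[OF const])
  have Bu: "B * u l = - [:monom (cc (M j l) 0 (q j)) (q j):]" for l
    using q by (simp add: B_def u_def mult_monom)
  have row: "M j l = S * w l - B * u l" if "l < d + 1" for l
  proof (rule poly_eqI)
    fix k
    show "poly.coeff (M j l) k = poly.coeff (S * w l - B * u l) k"
      using coeff_0_forms[OF Mf[OF ij(2) that]] unfolding Bu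
      by (cases k) (simp_all add: w_def coeff_poly_shift)
  qed
  have wf: "w l \<in> forms (int (q j) - 1)" if "l < d + 1" for l
  proof -
    have "S * w l = M j l + B * u l" using row[OF that] by (simp only: diff_add_cancel)
    also have "\<dots> \<in> forms (int (q j))"
      using Mf[OF ij(2) that] unfolding Bu by (intro forms_add forms_minus const)
    finally show ?thesis by (intro forms_factor[OF S_forms]) auto
  qed
  define M' where "M' x = M(i := (\<lambda>l. S * M i l + [:[:x:]:] * u l), j := (\<lambda>l. B * M i l + [:[:x:]:] * w l))" for x :: 'k
  \<comment> \<open>The minors of \<open>M' x\<close> divided by \<open>x\<close>, written so that
    they make sense at \<open>x = 0\<close>.\<close>
  define b where "b x = vec (d + 1) (\<lambda>l. g * (minors d M l + [:[:x:]:] * minors d (M(i := u, j := w)) l))" for x :: 'k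
  have M'f: "hmat d q' (M' x)" for x
    unfolding hmat_def
  proof (intro allI impI)
    fix k l assume kl: "k < d" "l < d + 1"
    consider "k = j" | "k = i" "k \<noteq> j" | "k \<noteq> i" "k \<noteq> j" by blast
    then show "M' x k l \<in> forms (int (q' k))"
    proof cases
      case 1
      have "B * M i l \<in> forms (int (q j) - 1)" using forms_mult[OF Bf Mf[OF ij(1) kl(2)]] by simp
      moreover have "[:[:x:]:] * w l \<in> forms (int (q j) - 1)"
        using forms_mult[OF forms_const wf[OF kl(2)]] by (simp del: mult_pCons_left)
      ultimately show ?thesis using 1 q by (simp add: M'_def q'_def of_nat_diff forms_add del: mult_pCons_left)
    next
      case 2
      have "S * M i l \<in> forms (int (q i + 1))" using forms_mult[OF S_forms Mf[OF ij(1) kl(2)]] by (simp add: add.commute del: mult_pCons_left)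
      moreover have "[:[:x:]:] * u l \<in> forms (int (q i + 1))"
        using forms_mult[OF forms_const uf[of l]] by (simp del: mult_pCons_left)
      ultimately show ?thesis using 2 by (simp add: M'_def q'_def forms_add del: mult_pCons_left)
    next
      case 3
      then show ?thesis using Mf[OF kl] by (simp add: M'_def q'_def)
    qed
  qed
  have bZ: "b x \<in> ?Z" if "x \<noteq> 0" for x
  proof -
    have minors_M': "minors d (M' x) l = [:[:x:]:] * (minors d M l + [:[:x:]:] * minors d (M(i := u, j := w)) l)" for l
      unfolding M'_def by (rule minors_deform[OF ij]) (rule row)
    have x: "[:[:1 / x:]:] * [:[:x:]:] = (1 :: 'k poly poly)" using that by (simp add: one_pCons)
    have "b x = minor_vec d (g * [:[:1 / x:]:]) (M' x)"
    proof (rule eq_vecI)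
      fix l assume "l < dim_vec (minor_vec d (g * [:[:1 / x:]:]) (M' x))"
      then have l: "l < d + 1" by (simp add: minor_vec_def)
      have "minor_vec d (g * [:[:1 / x:]:]) (M' x) $ l
          = g * ([:[:1 / x:]:] * [:[:x:]:]) * (minors d M l + [:[:x:]:] * minors d (M(i := u, j := w)) l)"
        using l unfolding minor_vec_def by (simp only: index_vec minors_M' mult.assoc)
      then show "b x $ l = minor_vec d (g * [:[:1 / x:]:]) (M' x) $ l"
        using l unfolding x by (simp add: b_def del: mult_pCons_left)
    qed (simp add: b_def minor_vec_def)
    moreover have "g * [:[:1 / x:]:] \<in> forms (int n - int (\<Sum>l<d. q' l))"
      using forms_mult[OF gM(1) forms_const[of "1 / x"]] sum by simp
    ultimately show ?thesis using M'f unfolding Z_def q'_def by blast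
  qed
  have Zv: "?Z \<subseteq> vcl n d ?Z" using Z_tuples by (rule vcl_superset)
  have "UNIV - {0} \<subseteq> {x. b x \<in> vcl n d ?Z}" using bZ Zv by auto
  moreover have "infinite (UNIV - {0 :: 'k})" using inf by simp
  ultimately have "infinite {x. b x \<in> vcl n d ?Z}" using infinite_super by blast
  moreover have "curve (\<lambda>x. b x $ l)" if "l \<le> d" for l
    using that unfolding b_def
    by (auto intro!: curve_mult curve_add curve_const curve_param simp del: mult_pCons_left)
  moreover have "b 0 = a" by (simp add: b_def gM(3) minor_vec_def)
  moreover have "a \<in> tuples n d" using gM minor_vec_tuples by blast
  ultimately show "a \<in> vcl n d ?Z" using vcl_curve[of d b 0 n ?Z] by simp
qed

text \<open>Induction on the total gap between partial sums. First the last part is raised until the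
  totals agree; then units are moved to an earlier part, never pushing a partial sum above that of
  \<open>p\<close>.\<close>

lemma Z_subset_vcl_Z:
  fixes q p :: "nat \<Rightarrow> nat"
  assumes inf: "infinite (UNIV :: 'k::field set)" and mono: "\<And>i j. i \<le> j \<Longrightarrow> j < d \<Longrightarrow> p i \<le> p j"
    and n: "(\<Sum>i<d. p i) \<le> n" and le: "\<And>k. k \<le> d \<Longrightarrow> (\<Sum>i<k. q i) \<le> (\<Sum>i<k. p i)"
  shows "(Z n d q :: 'k poly poly vec set) \<subseteq> vcl n d (Z n d p)"
  using le
proof (induction "\<Sum>k\<le>d. (\<Sum>i<k. p i) - (\<Sum>i<k. q i)" arbitrary: q rule: less_induct)
  case less
  note le = less.prems
  have step: "(Z n d q :: 'k poly poly vec set) \<subseteq> vcl n d (Z n d p)"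
    if Zq: "(Z n d q :: 'k poly poly vec set) \<subseteq> vcl n d (Z n d q')"
      and le': "\<And>k. k \<le> d \<Longrightarrow> (\<Sum>i<k. q' i) \<le> (\<Sum>i<k. p i)"
      and ge: "\<And>k. k \<le> d \<Longrightarrow> (\<Sum>i<k. q i) \<le> (\<Sum>i<k. q' i)"
      and strict: "k0 \<le> d" "(\<Sum>i<k0. q i) < (\<Sum>i<k0. q' i)" for q' k0
  proof -
    have "(\<Sum>k\<le>d. (\<Sum>i<k. p i) - (\<Sum>i<k. q' i)) < (\<Sum>k\<le>d. (\<Sum>i<k. p i) - (\<Sum>i<k. q i))"
    proof (rule sum_strict_mono_ex1)
      show "\<forall>k\<in>{..d}. (\<Sum>i<k. p i) - (\<Sum>i<k. q' i) \<le> (\<Sum>i<k. p i) - (\<Sum>i<k. q i)"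
        using ge by (auto intro: diff_le_mono2)
      show "\<exists>k\<in>{..d}. (\<Sum>i<k. p i) - (\<Sum>i<k. q' i) < (\<Sum>i<k. p i) - (\<Sum>i<k. q i)"
        using strict le'[OF strict(1)] by (intro bexI[of _ k0]) auto
    qed simp
    then have "(Z n d q' :: 'k poly poly vec set) \<subseteq> vcl n d (Z n d p)"
      using le' by (rule less.hyps)
    then show ?thesis using Zq vcl_trans by blast
  qed
  show ?case
  proof (cases "(\<Sum>i<d. q i) < (\<Sum>i<d. p i)")
    case True
    then obtain c where d: "d = Suc c" by (cases d) auto
    let ?q = "q(c := Suc (q c))"
    have small: "(\<Sum>i<k. ?q i) = (\<Sum>i<k. q i)" if "k \<le> c" for k
      using that by (intro sum_lessThan_fun_upd(2)) simp
    have full: "(\<Sum>i<d. ?q i) = (\<Sum>i<d. q i) + 1"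
      using sum_lessThan_fun_upd(1)[of c d q "Suc (q c)"] d by simp
    show ?thesis
    proof (rule step[of ?q d])
      show "(Z n d q :: 'k poly poly vec set) \<subseteq> vcl n d (Z n d ?q)"
        using True n d by (intro Z_step_gcd inf) auto
      show "(\<Sum>i<k. ?q i) \<le> (\<Sum>i<k. p i)" if "k \<le> d" for k
        using le[OF that] small[of k] full True that d by (cases "k = d") auto
      show "(\<Sum>i<k. q i) \<le> (\<Sum>i<k. ?q i)" if "k \<le> d" for k
        using small[of k] full that d by (cases "k = d") auto
      show "(\<Sum>i<d. q i) < (\<Sum>i<d. ?q i)" using full by simp
    qed simp
  next
    case False
    then have eqd: "(\<Sum>i<d. q i) = (\<Sum>i<d. p i)" using le[of d] by simp
    show ?thesis
    proof (cases "\<forall>k\<le>d. (\<Sum>i<k. q i) = (\<Sum>i<k. p i)")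
      case True
      have "q i = p i" if "i < d" for i
        using True[rule_format, of i] True[rule_format, of "Suc i"] that by simp
      then have "(Z n d q :: 'k poly poly vec set) = Z n d p" by (rule Z_cong)
      then show ?thesis using vcl_superset[OF Z_tuples] by simp
    next
      case False
      define lt where "lt k \<longleftrightarrow> (\<Sum>i<k. q i) < (\<Sum>i<k. p i)" for k
      have not_lt: "(\<Sum>i<k. q i) = (\<Sum>i<k. p i)" if "\<not> lt k" "k \<le> d" for k
        using that le[of k] by (simp add: lt_def)
      obtain k1 where "k1 \<le> d" "lt k1" using False not_lt by blast
      define k0 where "k0 = (LEAST k. lt k)"
      \<comment> \<open>\<open>i\<close> is the first position whose partial sum, itself included,
        falls short; hence \<open>q i < p i\<close>.\<close>
      have k0: "lt k0" "\<And>k. k < k0 \<Longrightarrow> \<not> lt k" "k0 \<le> k1"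
        unfolding k0_def using \<open>lt k1\<close> by (auto intro: LeastI dest: not_less_Least intro: Least_le)
      have "\<not> lt 0" by (simp add: lt_def)
      then have "k0 \<noteq> 0" using k0(1) by metis
      then obtain i where i: "k0 = Suc i" by (cases k0) auto
      have id: "i < d" using k0(3) \<open>k1 \<le> d\<close> i by simp
      have qi: "q i < p i"
        using k0(1) not_lt[of i] k0(2)[of i] id by (simp add: i lt_def)
      \<comment> \<open>The first length after \<open>i\<close> at which the partial sums agree
        again. Its last part \<open>j\<close> therefore satisfies \<open>p j < q j\<close>, and
        monotonicity of \<open>p\<close> gives the gap of 2.\<close>
      define m where "m = (LEAST k. i < k \<and> \<not> lt k)"
      have ex: "i < d \<and> \<not> lt d" using id eqd by (simp add: lt_def)
      have "i < m \<and> \<not> lt m" unfolding m_def by (rule LeastI[of _ d]) (rule ex)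
      moreover have "m \<le> d" unfolding m_def by (rule Least_le) (rule ex)
      moreover have "lt k" if "i < k" "k < m" for k
        using not_less_Least[OF that(2)[unfolded m_def]] that(1) by blast
      ultimately have m: "i < m" "\<not> lt m" "m \<le> d" "\<And>k. i < k \<Longrightarrow> k < m \<Longrightarrow> lt k"
        by blast+
      obtain j where j: "m = Suc j" using m(1) by (cases m) auto
      have "j \<noteq> i" using m(2) k0(1) i j by auto
      then have ij: "i < j" "j < d" using m j by auto
      have "lt j" using m(4)[of j] ij j by simp
      then have qj: "p j < q j" using not_lt[OF m(2,3)] by (simp add: j lt_def)
      have "p i \<le> p j" using mono ij by simp
      then have q2: "q i + 2 \<le> q j" using qi qj by simp
      let ?q = "q(i := q i + 1, j := q j - 1)"
      \<comment> \<open>The transfer adds 1 to exactly the partial sums of lengths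
        \<open>i + 1\<close> to \<open>j\<close>, all of which are still strictly too small.\<close>
      have s: "(\<Sum>l<k. ?q l) = (\<Sum>l<k. q l) + (if i < k \<and> k \<le> j then 1 else 0)" for k
        using sum_lessThan_fun_upd[of i k q "q i + 1"] sum_lessThan_fun_upd[of j k "q(i := q i + 1)" "q j - 1"] ij q2
        by (cases "i < k"; cases "j < k") auto
      show ?thesis
      proof (rule step[of ?q "Suc i"])
        show "(Z n d q :: 'k poly poly vec set) \<subseteq> vcl n d (Z n d ?q)"
          using ij q2 by (intro Z_step_transfer inf) auto
        show "(\<Sum>l<k. ?q l) \<le> (\<Sum>l<k. p l)" if "k \<le> d" for k
        proof (cases "i < k \<and> k \<le> j")
          case True
          then have "lt k" using m(4)[of k] j by simp
          then show ?thesis using True unfolding s lt_def by simp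
        qed (use le[OF that] s[of k] in auto)
        show "(\<Sum>l<k. q l) \<le> (\<Sum>l<k. ?q l)" for k unfolding s by simp
        show "(\<Sum>l<Suc i. q l) < (\<Sum>l<Suc i. ?q l)" using ij unfolding s by simp
        show "Suc i \<le> d" using ij by simp
      qed
    qed
  qed
qed

theorem theorem3p14:
  fixes n d :: nat and mu :: "nat list"
  assumes "infinite (UNIV :: 'k::field set)"
    and "n \<ge> d" and "d \<ge> 2"
    and "is_partition d mu"
    and "d \<le> sum_list mu" and "sum_list mu \<le> n"
  shows "subtopology (zariski n d) (CP n d) closure_of (P_type n d mu :: 'k poly poly vec set) =
    (\<Union>mu' \<in> {mu'. is_partition d mu' \<and> d \<le> sum_list mu' \<and> sum_list mu' \<le> n \<and>
      partition_le d mu' mu}. P_type n d mu')"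
proof -
  have "P_type n d mu \<subseteq> (CP n d :: 'k poly poly vec set)" by (auto simp: P_type_def)
  then have cl: "subtopology (zariski n d) (CP n d) closure_of (P_type n d mu :: 'k poly poly vec set)
      = CP n d \<inter> vcl n d (P_type n d mu)" by (rule closure_of_CP)
  have psum: "(\<Sum>i<k. xs ! i) = sum_list (take k xs)" if "k \<le> length xs" for k and xs :: "nat list"
    using that by (simp add: sum_list_sum_nth atLeast0LessThan min_absorb2)
  have len: "length mu = d" using assms(4) by (simp add: is_partition_def)
  \<comment> \<open>The chain runs from type \<open>mu'\<close> into its \<open>Z\<close>, then into
    the closure of the \<open>Z\<close> of \<open>mu\<close>, and finally into the closure of type
    \<open>mu\<close>.\<close>
  have sub: "P_type n d mu' \<subseteq> vcl n d (P_type n d mu :: 'k poly poly vec set)"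
    if mu': "is_partition d mu'" "partition_le d mu' mu" for mu'
  proof -
    have len': "length mu' = d" using mu'(1) by (simp add: is_partition_def)
    have "(Z n d ((!) mu') :: 'k poly poly vec set) \<subseteq> vcl n d (Z n d ((!) mu))"
    proof (rule Z_subset_vcl_Z[OF assms(1)])
      show "mu ! i \<le> mu ! j" if "i \<le> j" "j < d" for i j
        using assms(4) that by (simp add: is_partition_def sorted_iff_nth_mono)
      show "(\<Sum>i<d. mu ! i) \<le> n" using psum[of d mu] len assms(6) by simp
      show "(\<Sum>i<k. mu' ! i) \<le> (\<Sum>i<k. mu ! i)" if "k \<le> d" for k
        using psum[of k mu] psum[of k mu'] len len' mu'(2) that
        by (cases "k = 0") (auto simp: partition_le_def)
    qed
    then show ?thesis
      using P_type_subset_Z Z_subset_vcl_P_type[OF assms(1,4,6)] vcl_trans by blast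
  qed
  show ?thesis
    unfolding cl
  proof (intro equalityI subsetI)
    fix x :: "'k poly poly vec" assume "x \<in> CP n d \<inter> vcl n d (P_type n d mu)"
    then obtain mu' where "is_partition d mu'" "d \<le> sum_list mu'" "sum_list mu' \<le> n"
      "partition_le d mu' mu" "x \<in> P_type n d mu'"
      using closure_subset[OF assms(4), of x n] by auto
    then show "x \<in> (\<Union>mu' \<in> {mu'. is_partition d mu' \<and> d \<le> sum_list mu' \<and> sum_list mu' \<le> n \<and>
        partition_le d mu' mu}. P_type n d mu')"
      by (intro UN_I[of mu']) simp_all
  next
    fix x :: "'k poly poly vec"
    assume "x \<in> (\<Union>mu' \<in> {mu'. is_partition d mu' \<and> d \<le> sum_list mu' \<and> sum_list mu' \<le> n \<and>
        partition_le d mu' mu}. P_type n d mu')"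
    then obtain mu' where "is_partition d mu'" "partition_le d mu' mu" and x: "x \<in> P_type n d mu'"
      by (elim UN_E) blast
    then have "x \<in> vcl n d (P_type n d mu)" using sub[of mu'] by (intro subsetD[OF sub[of mu']])
    moreover have "x \<in> CP n d" using x by (simp add: P_type_def)
    ultimately show "x \<in> CP n d \<inter> vcl n d (P_type n d mu)" by (rule IntI[rotated])
  qed
qed

end
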